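(* Let $A=(A_n)_{n\in\mathbb{N}}$ be a sequence of complex square matrices (of possibly different dimensions) whose spectra are contained in the open unit disc $\mathbb{D}$. Then $A$ is interpolating for $\mathrm{H}^\infty$ if and only if it is strongly separated, i.e. if and only if \[ \inf_{z\in\mathbb{D}}\ \sup_{n\in\mathbb{N}}\ \prod_{k\neq n}|B_{A_k}(z)|>0 . \]
   Context: $\mathrm{H}^\infty$ is the space of bounded analytic functions on the unit disc $\mathbb{D}$. For $f$ holomorphic on $\mathbb{D}$ and a square matrix $M$ with spectrum in $\mathbb{D}$, $f(M)$ is defined by the Riesz–Dunford holomorphic functional calculus; equivalently $f(M)=\sum_{n\ge 0} a_nM^n$ if $f(z)=\sum_{n\ge0} a_nz^n$. Interpolating: a sequence $(A_n)_{n\in\mathbb{N}}$ of complex square matrices (of perhaps different dimensions) with spectra in $\mathbb{D}$ is interpolating for $\mathrm{H}^\infty$ if for every bounded sequence $(\phi_n)_{n\in\mathbb{N}}$ in $\mathrm{H}^\infty$ (i.e. $\sup_n\|\phi_n\|_\infty<\infty$) there exists $\varphi\in\mathrm{H}^\infty$ with $\varphi(A_n)=\phi_n(A_n)$ for all $n\in\mathbb{N}$. For $\tau\in\mathbb{D}$, $b_\tau(z)=\frac{\tau-z}{1-\overline{\tau}z}$ is the (involutive) Blaschke factor at $\tau$. The order of an eigenvalue $\lambda$ of a square matrix $M$ is the maximal size of the Jordan blocks of $M$ associated with $\lambda$. If $M$ has distinct eigenvalues $\lambda_1,\dots,\lambda_k\in\mathbb{D}$ with orders $m_1,\dots,m_k$,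 the Blaschke factor associated to $M$ is $B_M(z)=\prod_{j=1}^k b_{\lambda_j}(z)^{m_j}$. Infinite products of numbers in $[0,1]$ are limits of the (decreasing) partial products. *)

theory Defs
  imports
    "HOL-Complex_Analysis.Complex_Analysis"
    "Jordan_Normal_Form.Spectral_Radius"
    "Jordan_Normal_Form.Jordan_Normal_Form_Uniqueness"
begin

section \<open>Bounded analytic functions\<close>

definition Hinf :: "(complex \<Rightarrow> complex) set" where
  "Hinf = {f. f holomorphic_on ball 0 1 \<and> bounded (f ` ball 0 1)}"

text \<open>Functions are total on the complex plane; their values outside the disc never matter.\<close>

definition Hinf_norm :: "(complex \<Rightarrow> complex) \<Rightarrow> real" where
  "Hinf_norm f = (SUP z\<in>ball 0 1. norm (f z))"

section \<open>Functions of matrices\<close>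

text \<open>The power series form of the holomorphic functional calculus, summed entrywise. It is
  meant for square matrices with spectrum in the unit disc, where it converges and agrees with the
  Riesz--Dunford integral (lemma \<open>mat_fun_Riesz_Dunford\<close> below).\<close>

definition mat_fun :: "(complex \<Rightarrow> complex) \<Rightarrow> complex mat \<Rightarrow> complex mat" where
  "mat_fun f M = mat (dim_row M) (dim_row M)
     (\<lambda>ij. \<Sum>k. (deriv ^^ k) f 0 / fact k * (M ^\<^sub>m k) $$ ij)"

section \<open>Interpolating sequences\<close>

definition interpolating_Hinf :: "(nat \<Rightarrow> complex mat) \<Rightarrow> bool" where
  "interpolating_Hinf A \<longleftrightarrow>
     (\<forall>\<phi> :: nat \<Rightarrow> complex \<Rightarrow> complex.
        (\<forall>n. \<phi> n \<in> Hinf) \<and> bdd_above (range (\<lambda>n. Hinf_norm (\<phi> n))) \<longrightarrow>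
        (\<exists>\<psi>\<in>Hinf. \<forall>n. mat_fun \<psi> (A n) = mat_fun (\<phi> n) (A n)))"

section \<open>Blaschke factors and strong separation\<close>

definition blaschke :: "complex \<Rightarrow> complex \<Rightarrow> complex" where
  "blaschke \<tau> z = (\<tau> - z) / (1 - cnj \<tau> * z)"

text \<open>The largest size of a Jordan block belonging to \<open>\<mu>\<close>. All Jordan normal forms of a matrix have
  the same blocks, so no particular one has to be chosen (lemma \<open>eigenvalue_order_jordan_nf\<close>
  below). Junk if \<open>\<mu>\<close> is not an eigenvalue.\<close>

definition eigenvalue_order :: "complex mat \<Rightarrow> complex \<Rightarrow> nat" where
  "eigenvalue_order M \<mu> = Max {m. \<exists>n_as. jordan_nf M n_as \<and> (m, \<mu>) \<in> set n_as}"

definition blaschke_mat :: "complex mat \<Rightarrow> complex \<Rightarrow> complex" where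
  "blaschke_mat M z = (\<Prod>\<mu>\<in>spectrum M. blaschke \<mu> z ^ eigenvalue_order M \<mu>)"

text \<open>The infinite product is the limit of its partial products. The library's \<open>prodinf\<close> is not
  suitable here: it does not assign the value 0 to products of nonzero factors whose partial
  products tend to 0.\<close>

definition strongly_separated :: "(nat \<Rightarrow> complex mat) \<Rightarrow> bool" where
  "strongly_separated A \<longleftrightarrow>
     (INF z\<in>ball 0 1. SUP n. lim (\<lambda>N. \<Prod>k\<in>{..<N} - {n}. cmod (blaschke_mat (A k) z))) > 0"

section \<open>Agreement with the Riesz--Dunford calculus\<close>

lemma smult_pow_mat:
  fixes A :: "complex mat"
  assumes A: "A \<in> carrier_mat n n"
  shows "(c \<cdot>\<^sub>m A) ^\<^sub>m k = c ^ k \<cdot>\<^sub>m (A ^\<^sub>m k)"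
proof (induction k)
  case (Suc k)
  have "(c \<cdot>\<^sub>m A) ^\<^sub>m Suc k = (c ^ k \<cdot>\<^sub>m (A ^\<^sub>m k)) * (c \<cdot>\<^sub>m A)"
    using Suc by simp
  also have "\<dots> = c ^ Suc k \<cdot>\<^sub>m (A ^\<^sub>m k * A)"
    using A pow_carrier_mat[OF A, of k]
    by (intro eq_matI) (auto simp: algebra_simps)
  finally show ?case by simp
qed (use A in \<open>auto intro!: eq_matI\<close>)

lemma pow_mat_bound:
  fixes A :: "complex mat"
  assumes A: "A \<in> carrier_mat n n" and s: "0 < s" and spec: "spectrum A \<subseteq> ball 0 s" and n: "0 < n"
  obtains c where "\<And>k i j. i < n \<Longrightarrow> j < n \<Longrightarrow> norm ((A ^\<^sub>m k) $$ (i, j)) \<le> c * s ^ k"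
proof -
  define B where "B = complex_of_real (1 / s) \<cdot>\<^sub>m A"
  have B: "B \<in> carrier_mat n n" using A by (simp add: B_def)
  have specB: "norm l < 1" if l: "l \<in> spectrum B" for l
  proof -
    obtain v where v: "v \<in> carrier_vec n" "v \<noteq> 0\<^sub>v n" "B *\<^sub>v v = l \<cdot>\<^sub>v v"
      using l B by (auto simp: spectrum_def eigenvalue_def eigenvector_def)
    have "A = complex_of_real s \<cdot>\<^sub>m B"
      using s A by (intro eq_matI) (auto simp: B_def)
    moreover have "(complex_of_real s \<cdot>\<^sub>m B) *\<^sub>v v = complex_of_real s \<cdot>\<^sub>v (B *\<^sub>v v)"
      using B v(1) by (intro eq_vecI) auto
    ultimately have "A *\<^sub>v v = (complex_of_real s * l) \<cdot>\<^sub>v v"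
      using v(3) by (simp add: smult_smult_assoc)
    hence "complex_of_real s * l \<in> spectrum A"
      using v A by (auto simp: spectrum_def eigenvalue_def eigenvector_def)
    hence "norm (complex_of_real s * l) < s" using spec by auto
    thus ?thesis using s by (simp add: norm_mult)
  qed
  have "spectral_radius B < 1"
    using spectral_radius_mem_max(1)[OF B n] specB by auto
  moreover have "\<exists>n_as. jordan_nf B n_as"
    using char_poly_factorized[OF B] jordan_nf_exists[OF B] by metis
  ultimately obtain c where c: "\<And>k. norm_bound (B ^\<^sub>m k) c"
    using spectral_radius_jnf_norm_bound_less_1[OF B] by blast
  have "norm ((A ^\<^sub>m k) $$ (i, j)) \<le> c * s ^ k" if ij: "i < n" "j < n" for k i j
  proof -
    have "norm ((B ^\<^sub>m k) $$ (i, j)) \<le> c"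
      using c[of k] ij B by (auto simp: norm_bound_def)
    moreover have "(B ^\<^sub>m k) $$ (i, j) = complex_of_real (1 / s) ^ k * (A ^\<^sub>m k) $$ (i, j)"
      using smult_pow_mat[OF A, of "complex_of_real (1 / s)" k] ij A by (simp add: B_def)
    ultimately show ?thesis
      using s by (simp add: norm_mult norm_power norm_divide field_simps)
  qed
  thus ?thesis using that by blast
qed

text \<open>Here \<open>R\<close> is the resolvent \<open>\<zeta> \<mapsto> (\<zeta> - A)\<^bsup>-1\<^esup>\<close> on the circle of radius \<open>r\<close>.\<close>

theorem mat_fun_Riesz_Dunford:
  fixes A :: "complex mat" and R :: "complex \<Rightarrow> complex mat"
  assumes A: "A \<in> carrier_mat n n" and r: "0 < r" "r < 1" and spec: "spectrum A \<subseteq> ball 0 r"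
    and f: "f holomorphic_on ball 0 1"
    and R: "\<And>\<zeta>. norm \<zeta> = r \<Longrightarrow> R \<zeta> \<in> carrier_mat n n"
           "\<And>\<zeta>. norm \<zeta> = r \<Longrightarrow> (\<zeta> \<cdot>\<^sub>m 1\<^sub>m n - A) * R \<zeta> = 1\<^sub>m n"
    and ij: "i < n" "j < n"
  shows "(\<lambda>k. (deriv ^^ k) f 0 / fact k * (A ^\<^sub>m k) $$ (i, j)) sums (mat_fun f A $$ (i, j))"
    and "((\<lambda>\<zeta>. f \<zeta> * R \<zeta> $$ (i, j)) has_contour_integral
           2 * pi * \<i> * mat_fun f A $$ (i, j)) (circlepath 0 r)"
proof -
  have n: "0 < n" using ij by simp
  define s where "s = (r + Max (insert 0 (norm ` spectrum A))) / 2"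
  let ?m = "Max (insert 0 (norm ` spectrum A))"
  have fin: "finite (spectrum A)" using card_finite_spectrum[OF A] by simp
  have m: "0 \<le> ?m" "?m < r" "\<And>l. l \<in> spectrum A \<Longrightarrow> norm l \<le> ?m"
    using fin spec r by auto
  have s: "0 < s" "s < r" "?m < s" using m r by (auto simp: s_def)
  have "spectrum A \<subseteq> ball 0 s" using m(3) s(3) by fastforce
  then obtain c where c: "\<And>k i j. i < n \<Longrightarrow> j < n \<Longrightarrow> norm ((A ^\<^sub>m k) $$ (i, j)) \<le> c * s ^ k"
    using pow_mat_bound[OF A s(1) _ n] by blast
  have fcont: "continuous_on (cball 0 r) f" and fhol: "f holomorphic_on ball 0 r"
    using f r by (auto intro!: holomorphic_on_imp_continuous_on elim!: holomorphic_on_subset)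

  define a where "a k = (A ^\<^sub>m k) $$ (i, j)" for k
  have a: "norm (a k) \<le> c * s ^ k" for k using c ij by (simp add: a_def)
  have resolvent: "(\<lambda>k. a k / \<zeta> ^ Suc k) sums (R \<zeta> $$ (i, j))" if z: "norm \<zeta> = r" for \<zeta>
  proof -
    have z0: "\<zeta> \<noteq> 0" using z r by auto
    define e where "e k = (A ^\<^sub>m k * R \<zeta>) $$ (i, j)" for k
    have step: "e k * \<zeta> = a k + e (Suc k)" for k
    proof -
      have car: "A ^\<^sub>m k \<in> carrier_mat n n" using A by simp
      have "A ^\<^sub>m k = A ^\<^sub>m k * ((\<zeta> \<cdot>\<^sub>m 1\<^sub>m n - A) * R \<zeta>)"
        using R(2)[OF z] right_mult_one_mat[OF car] by simp
      also have "(\<zeta> \<cdot>\<^sub>m 1\<^sub>m n - A) * R \<zeta> = \<zeta> \<cdot>\<^sub>m R \<zeta> - A * R \<zeta>"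
        using A R(1)[OF z]
        by (subst minus_mult_distrib_mat[of _ n n _ _ n])
           (auto simp: mult_smult_assoc_mat[of _ n n _ n])
      also have "A ^\<^sub>m k * \<dots> = \<zeta> \<cdot>\<^sub>m (A ^\<^sub>m k * R \<zeta>) - A ^\<^sub>m k * (A * R \<zeta>)"
        using A R(1)[OF z] car
        by (subst mult_minus_distrib_mat[of _ n n _ n])
           (auto simp: mult_smult_distrib[of _ n n _ n])
      also have "A ^\<^sub>m k * (A * R \<zeta>) = A ^\<^sub>m Suc k * R \<zeta>"
        using assoc_mult_mat[OF car A R(1)[OF z]] by simp
      finally have "A ^\<^sub>m k = \<zeta> \<cdot>\<^sub>m (A ^\<^sub>m k * R \<zeta>) - A ^\<^sub>m Suc k * R \<zeta>" .
      hence "a k = (\<zeta> \<cdot>\<^sub>m (A ^\<^sub>m k * R \<zeta>) - A ^\<^sub>m Suc k * R \<zeta>) $$ (i, j)"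
        by (simp only: a_def)
      also have "\<dots> = \<zeta> * e k - e (Suc k)"
        using ij A R(1)[OF z] car by (simp add: e_def del: pow_mat.simps)
      finally show ?thesis by (simp add: algebra_simps)
    qed
    have partial: "(\<Sum>k<N. a k / \<zeta> ^ Suc k) = R \<zeta> $$ (i, j) - e N / \<zeta> ^ N" for N
    proof (induction N)
      case 0
      show ?case using R(1)[OF z] A by (simp add: e_def)
    next
      case (Suc N)
      have "e N / \<zeta> ^ N = (e N * \<zeta>) / \<zeta> ^ Suc N" using z0 by simp
      also have "\<dots> = a N / \<zeta> ^ Suc N + e (Suc N) / \<zeta> ^ Suc N"
        unfolding step by (simp add: add_divide_distrib)
      finally show ?case using Suc by simp
    qed
    have e_eq: "e N = (\<Sum>l<n. (A ^\<^sub>m N) $$ (i, l) * R \<zeta> $$ (l, j))" for N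
      using ij A R(1)[OF z] pow_carrier_mat[OF A, of N]
      by (auto simp: e_def scalar_prod_def lessThan_atLeast0 intro!: sum.cong)
    define C where "C = (\<Sum>l<n. c * norm (R \<zeta> $$ (l, j)))"
    have "norm (e N / \<zeta> ^ N) \<le> C * (s / r) ^ N" for N
    proof -
      have "norm (e N) \<le> (\<Sum>l<n. (c * s ^ N) * norm (R \<zeta> $$ (l, j)))"
        unfolding e_eq using c ij
        by (intro sum_norm_le) (auto simp: norm_mult intro!: mult_right_mono)
      also have "\<dots> = C * s ^ N"
        unfolding C_def sum_distrib_right by (intro sum.cong) (auto simp: mult_ac)
      finally show ?thesis using r z
        by (simp add: norm_divide norm_power power_divide divide_right_mono)
    qed
    moreover have "(\<lambda>N. C * (s / r) ^ N) \<longlonglongrightarrow> C * 0"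
      using s r by (intro tendsto_mult tendsto_const LIMSEQ_power_zero) auto
    ultimately have "(\<lambda>N. e N / \<zeta> ^ N) \<longlonglongrightarrow> 0"
      using Lim_null_comparison[of "\<lambda>N. e N / \<zeta> ^ N" "\<lambda>N. C * (s / r) ^ N" sequentially]
      by auto
    hence "(\<lambda>N. R \<zeta> $$ (i, j) - e N / \<zeta> ^ N) \<longlonglongrightarrow> R \<zeta> $$ (i, j) - 0"
      by (intro tendsto_diff tendsto_const)
    thus ?thesis unfolding sums_def partial by simp
  qed

  have "compact (f ` cball 0 r)" using fcont by (intro compact_continuous_image) auto
  hence "bounded (f ` cball 0 r)" by (rule compact_imp_bounded)
  then obtain F where F: "\<And>\<zeta>. norm \<zeta> \<le> r \<Longrightarrow> norm (f \<zeta>) \<le> F"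
    unfolding bounded_iff by (metis imageI mem_cball_0)
  define g where "g k \<zeta> = f \<zeta> * (a k / \<zeta> ^ Suc k)" for k \<zeta>
  have ul: "uniform_limit (sphere 0 r) (\<lambda>N \<zeta>. \<Sum>k<N. g k \<zeta>) (\<lambda>\<zeta>. \<Sum>k. g k \<zeta>) sequentially"
  proof (rule Weierstrass_m_test)
    show "norm (g k \<zeta>) \<le> F * c / r * (s / r) ^ k" if "\<zeta> \<in> sphere 0 r" for k \<zeta>
    proof -
      have z: "norm \<zeta> = r" using that by simp
      have "norm (g k \<zeta>) \<le> F * (c * s ^ k / r ^ Suc k)"
        unfolding g_def norm_mult norm_divide norm_power z
        using F[of \<zeta>] z a[of k] r order_trans[OF norm_ge_zero F[of \<zeta>]]
        by (intro mult_mono divide_right_mono) auto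
      thus ?thesis by (simp add: power_divide field_simps)
    qed
    show "summable (\<lambda>k. F * c / r * (s / r) ^ k)"
      using s r by (intro summable_mult summable_geometric) auto
  qed
  have lim_eq: "(\<Sum>k. g k \<zeta>) = f \<zeta> * R \<zeta> $$ (i, j)" if "norm \<zeta> = r" for \<zeta>
    using sums_mult[OF resolvent[OF that], of "f \<zeta>"]
    unfolding g_def by (simp add: sums_iff)
  have ul': "uniform_limit (sphere 0 r) (\<lambda>N \<zeta>. \<Sum>k<N. g k \<zeta>) (\<lambda>\<zeta>. f \<zeta> * R \<zeta> $$ (i, j)) sequentially"
    using ul by (rule uniform_limit_cong'[THEN iffD1, rotated 2]) (auto simp: lim_eq)
  define t where "t k = (deriv ^^ k) f 0 / fact k * a k" for k
  have gint: "(g k has_contour_integral 2 * pi * \<i> * t k) (circlepath 0 r)" for k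
  proof -
    have "((\<lambda>u. f u / (u - 0) ^ Suc k) has_contour_integral
             (2 * pi * \<i>) / fact k * (deriv ^^ k) f 0) (circlepath 0 r)"
      using r by (intro Cauchy_has_contour_integral_higher_derivative_circlepath fcont fhol) auto
    from has_contour_integral_rmul[OF this, of "a k"] show ?thesis
      by (simp add: g_def t_def mult_ac fun_eq_iff cong: has_contour_integral_cong)
  qed
  have psum: "((\<lambda>\<zeta>. \<Sum>k<N. g k \<zeta>) has_contour_integral (\<Sum>k<N. 2 * pi * \<i> * t k)) (circlepath 0 r)"
    for N by (intro has_contour_integral_sum gint) auto
  have ev: "\<forall>\<^sub>F N in sequentially. (\<lambda>\<zeta>. \<Sum>k<N. g k \<zeta>) contour_integrable_on circlepath 0 r"
    using psum by (auto simp: contour_integrable_on_def intro!: always_eventually)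
  note lim = contour_integral_uniform_limit_circlepath[OF ev ul' sequentially_bot r(1)]
  have int: "(\<lambda>\<zeta>. f \<zeta> * R \<zeta> $$ (i, j)) contour_integrable_on circlepath 0 r"
    by (rule lim(1))
  from lim(2)
  have "(\<lambda>k. 2 * pi * \<i> * t k) sums
           contour_integral (circlepath 0 r) (\<lambda>\<zeta>. f \<zeta> * R \<zeta> $$ (i, j))" (is "_ sums ?I")
    unfolding sums_def contour_integral_unique[OF psum] .
  from sums_divide[OF this, of "2 * pi * \<i>"] have t: "t sums (?I / (2 * pi * \<i>))"
    by simp
  have "mat_fun f A $$ (i, j) = (\<Sum>k. t k)"
    using ij A by (simp add: mat_fun_def t_def a_def)
  hence I: "mat_fun f A $$ (i, j) = ?I / (2 * pi * \<i>)"
    using t by (simp add: sums_iff)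
  show "(\<lambda>k. (deriv ^^ k) f 0 / fact k * (A ^\<^sub>m k) $$ (i, j)) sums (mat_fun f A $$ (i, j))"
    using t unfolding I t_def a_def .
  show "((\<lambda>\<zeta>. f \<zeta> * R \<zeta> $$ (i, j)) has_contour_integral
           2 * pi * \<i> * mat_fun f A $$ (i, j)) (circlepath 0 r)"
    using has_contour_integral_integral[OF int] unfolding I by simp
qed

section \<open>The order of an eigenvalue and the infinite product are well defined\<close>

lemma jordan_nf_ex:
  fixes M :: "complex mat"
  assumes "square_mat M"
  shows "\<exists>n_as. jordan_nf M n_as"
proof -
  have M: "M \<in> carrier_mat (dim_row M) (dim_row M)" using assms by auto
  show ?thesis using char_poly_factorized[OF M] jordan_nf_exists[OF M] by metis
qed

lemma eigenvalue_order_jordan_nf: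
  assumes "jordan_nf M n_as"
  shows "eigenvalue_order M \<mu> = Max {m. (m, \<mu>) \<in> set n_as}"
proof -
  have "{m. \<exists>n_as. jordan_nf M n_as \<and> (m, \<mu>) \<in> set n_as} = {m. (m, \<mu>) \<in> set n_as}"
    using assms jordan_nf_unique[OF assms] by blast
  thus ?thesis by (simp add: eigenvalue_order_def)
qed

lemma norm_blaschke_le_1:
  assumes "norm \<tau> < 1" "norm z < 1"
  shows "norm (blaschke \<tau> z) \<le> 1"
proof -
  have "norm (Moebius_function 0 \<tau> z) < 1"
    using assms by (rule Moebius_function_norm_lt_1)
  moreover have "norm (blaschke \<tau> z) = norm (Moebius_function 0 \<tau> z)"
    by (simp add: blaschke_def Moebius_function_def norm_divide norm_mult norm_minus_commute)
  ultimately show ?thesis by simp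
qed

lemma strongly_separated_product_convergent:
  assumes spec: "\<And>n. spectrum (A n) \<subseteq> ball 0 1" and z: "z \<in> ball 0 1"
  shows "decseq (\<lambda>N. \<Prod>k\<in>{..<N} - {n}. cmod (blaschke_mat (A k) z))"
    and "convergent (\<lambda>N. \<Prod>k\<in>{..<N} - {n}. cmod (blaschke_mat (A k) z))"
proof -
  have le: "cmod (blaschke_mat (A k) z) \<le> 1" for k
    unfolding blaschke_mat_def prod_norm[symmetric] norm_power
    using spec[of k] z by (intro prod_le_1) (auto intro!: power_le_one norm_blaschke_le_1)
  show dec: "decseq (\<lambda>N. \<Prod>k\<in>{..<N} - {n}. cmod (blaschke_mat (A k) z))"
  proof (rule decseq_SucI)
    fix N
    have "{..<Suc N} - {n} = (if N = n then {..<N} - {n} else insert N ({..<N} - {n}))"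
      by auto
    thus "(\<Prod>k\<in>{..<Suc N} - {n}. cmod (blaschke_mat (A k) z))
        \<le> (\<Prod>k\<in>{..<N} - {n}. cmod (blaschke_mat (A k) z))"
      using le[of N] by (simp add: mult_left_le_one_le prod_nonneg)
  qed
  show "convergent (\<lambda>N. \<Prod>k\<in>{..<N} - {n}. cmod (blaschke_mat (A k) z))"
  proof -
    have "\<forall>N. 0 \<le> (\<Prod>k\<in>{..<N} - {n}. cmod (blaschke_mat (A k) z))"
      by (auto intro!: prod_nonneg)
    from decseq_convergent[OF dec this] show ?thesis
      by (blast intro: convergentI)
  qed
qed

end

theory Submission
  imports Defs
begin

text \<open>
  Interpolation is governed by the quotients of \<open>H\<^sup>2\<close> by finite Blaschke products \<open>\<Theta>\<close>. Strong
  separation bounds \<open>|B\<^sub>S| + |B\<^sub>T|\<close> from below for every splitting of the indices into \<open>S\<close> and \<open>T\<close>;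
  by Wolff's argument (Green's formula, Littlewood--Paley identity) the corona problem
  \<open>x = B\<^sub>S f + B\<^sub>T g\<close> is then solvable in \<open>H\<^sup>2\<close> with uniform bounds. Hence the idempotents modulo \<open>\<Theta>\<close>
  belonging to sets of indices act on the quotient with uniformly bounded norms, and by choosing
  signs so do all bounded combinations of them, in particular the interpolant of given data. A
  function acting on the quotient as a multiple of a strict contraction agrees modulo \<open>\<Theta>\<close> with a
  bounded function, by the Schur algorithm. The constants do not depend on the number of matrices,
  and a normal families argument handles infinitely many of them.

  Conversely, functions interpolating \<open>1\<close> on a set \<open>T\<close> of indices and \<open>0\<close> off \<open>T\<close> bound
  \<open>|B\<^sub>T| + |B\<^sub>U|\<close> from below, where \<open>U\<close> is the complement of \<open>T\<close>. A gliding hump makes this bound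
  uniform in \<open>T\<close>, which leaves room for at most one small factor at each point.
\<close>

section \<open>Green's formula on the disc\<close>

text \<open>The obstacle is that the index left out in strong separation varies with the point, so
  no node can be singled out once and for all. For any splitting, however, that index lies on at
  most one side, and the product over another side is bounded below; hence separation enters only
  through pairs of complementary products. The corona problem is solved in L2 rather than in the
  supremum norm because the quotients then obey the parallelogram law, so that combining idempotents
  costs a factor independent of their number. The supremum norm is recovered in one stroke, by
  lifting a contraction of the quotient. Boundary values are avoided altogether: the functions in
  the L2 estimates are analytic in a neighbourhood of the closed disc, Blaschke products are finite,
  and the data are dilated beforehand. The price is that minimisers and infinite series are replaced
  by approximate ones, an algebraic Bezout identity without any bound absorbing the last error. All
  constants must therefore depend on the separation alone.\<close>

definition cmean :: "(complex \<Rightarrow> 'a::euclidean_space) \<Rightarrow> real \<Rightarrow> 'a" where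
  "cmean F r = integral {0..1} (\<lambda>t. F (of_real r * cis (2 * pi * t)))"

text \<open>In polar coordinates this is the integral of \<open>F(z) log (1 / |z|)\<close> over the disc, divided by
  \<open>2\<pi>\<close>, written so that only continuous integrands occur.\<close>

definition disc_int :: "(complex \<Rightarrow> 'a::euclidean_space) \<Rightarrow> 'a" where
  "disc_int F = integral {0..1} (\<lambda>r. r *\<^sub>R integral {0..1} (\<lambda>s. s *\<^sub>R cmean F (r * s)))"

text \<open>Here \<open>p\<close> and \<open>q\<close> are the Wirtinger derivatives of \<open>F\<close> with respect to \<open>z\<close> and its
  conjugate.\<close>

definition wirt :: "(complex \<Rightarrow> complex) \<Rightarrow> complex \<Rightarrow> complex \<Rightarrow> complex \<Rightarrow> bool" where
  "wirt F p q z \<longleftrightarrow> (F has_derivative (\<lambda>h. p * h + q * cnj h)) (at z)"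

section \<open>Continuity and integrability in polar coordinates\<close>

lemma polar_cball: "r \<in> {0..1} \<Longrightarrow> of_real r * cis t \<in> cball 0 1"
  by (simp add: norm_mult)

lemma continuous_on_polar:
  assumes F: "continuous_on (cball 0 1) F" and g: "continuous_on X g" and h: "continuous_on X h"
    and "\<And>x. x \<in> X \<Longrightarrow> g x \<in> {0..1}"
  shows "continuous_on X (\<lambda>x. F (of_real (g x) * cis (2 * pi * h x)))"
  using assms polar_cball by (intro continuous_on_compose2[OF F] continuous_intros g h) auto

lemma integrable_circle:
  fixes F :: "complex \<Rightarrow> 'a::euclidean_space"
  assumes "continuous_on (cball 0 1) F" "r \<in> {0..1}"
  shows "(\<lambda>t. F (of_real r * cis (2 * pi * t))) integrable_on {0..1}"
  by (intro integrable_continuous_interval continuous_on_polar[OF assms(1)] continuous_intros assms)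

lemma continuous_cmean:
  fixes F :: "complex \<Rightarrow> 'a::euclidean_space"
  assumes F: "continuous_on (cball 0 1) F"
  shows "continuous_on {0..1} (cmean F)"
proof -
  have "continuous_on {0..1::real} (\<lambda>r. integral (cbox 0 1) (\<lambda>t. F (of_real r * cis (2 * pi * t))))"
    by (rule integral_continuous_on_param)
       (auto simp: case_prod_unfold intro!: continuous_on_polar[OF F] continuous_intros)
  thus ?thesis by (simp add: cmean_def[abs_def])
qed

lemma continuous_cmean_mult:
  fixes F :: "complex \<Rightarrow> 'a::euclidean_space"
  assumes F: "continuous_on (cball 0 1) F"
  shows "r \<in> {0..1} \<Longrightarrow> continuous_on {0..1} (\<lambda>s. s *\<^sub>R cmean F (r * s))"
    and "continuous_on {0..1} (\<lambda>r. r *\<^sub>R integral {0..1} (\<lambda>s. s *\<^sub>R cmean F (r * s)))"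
proof -
  show "continuous_on {0..1} (\<lambda>s. s *\<^sub>R cmean F (r * s))" if "r \<in> {0..1}"
    using that
    by (intro continuous_intros continuous_on_compose2[OF continuous_cmean[OF F]])
       (auto intro: mult_le_one)
  have "continuous_on {0..1::real} (\<lambda>r. integral (cbox 0 1) (\<lambda>s. s *\<^sub>R cmean F (r * s)))"
    by (rule integral_continuous_on_param)
       (auto simp: case_prod_unfold intro!: continuous_on_compose2[OF continuous_cmean[OF F]]
         continuous_intros mult_le_one)
  thus "continuous_on {0..1} (\<lambda>r. r *\<^sub>R integral {0..1} (\<lambda>s. s *\<^sub>R cmean F (r * s)))"
    by (auto intro!: continuous_intros)
qed

lemma integrable_cmean:
  fixes F :: "complex \<Rightarrow> 'a::euclidean_space"
  assumes F: "continuous_on (cball 0 1) F"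
  shows "r \<in> {0..1} \<Longrightarrow> (\<lambda>s. s *\<^sub>R cmean F (r * s)) integrable_on {0..1}"
    and "(\<lambda>r. r *\<^sub>R integral {0..1} (\<lambda>s. s *\<^sub>R cmean F (r * s))) integrable_on {0..1}"
  using continuous_cmean_mult[OF F] by (auto intro: integrable_continuous_interval)

lemma cmean_add:
  assumes "continuous_on (cball 0 1) F" "continuous_on (cball 0 1) G" "r \<in> {0..1}"
  shows "cmean (\<lambda>z. F z + G z) r = cmean F r + cmean G r"
  unfolding cmean_def by (intro integral_add integrable_circle assms)

lemma cmean_cmul: "cmean (\<lambda>z. c * F z) r = c * cmean F r"
  for c :: "'a::{real_normed_field,euclidean_space}"
  unfolding cmean_def by simp

lemma cmean_nonneg:
  assumes "continuous_on (cball 0 1) F" "r \<in> {0..1}" "\<And>z. z \<in> cball 0 1 \<Longrightarrow> 0 \<le> F z"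
  shows "0 \<le> (cmean F r :: real)"
  unfolding cmean_def using assms(2) polar_cball
  by (intro integral_nonneg integrable_circle assms) blast

lemma cmean_norm_le:
  assumes "continuous_on (cball 0 1) F" "r \<in> {0..1}"
  shows "norm (cmean F r) \<le> cmean (\<lambda>z. norm (F z)) r"
  unfolding cmean_def
  by (intro integral_norm_bound_integral integrable_circle assms continuous_intros) auto

lemma disc_int_norm_le:
  assumes F: "continuous_on (cball 0 1) F"
  shows "norm (disc_int F) \<le> disc_int (\<lambda>z. norm (F z))"
proof -
  have nF: "continuous_on (cball 0 1) (\<lambda>z. norm (F z))" by (intro continuous_intros F)
  have 1: "norm (integral {0..1} (\<lambda>s. s *\<^sub>R cmean F (r * s)))
        \<le> integral {0..1} (\<lambda>s. s *\<^sub>R cmean (\<lambda>z. norm (F z)) (r * s))" if r: "r \<in> {0..1}" for r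
  proof (intro integral_norm_bound_integral integrable_cmean F nF r)
    fix s :: real assume s: "s \<in> {0..1}"
    with r have "r * s \<in> {0..1}" by (auto intro: mult_le_one)
    thus "norm (s *\<^sub>R cmean F (r * s)) \<le> s *\<^sub>R cmean (\<lambda>z. norm (F z)) (r * s)"
      using s cmean_norm_le[OF F] by (auto intro!: mult_left_mono)
  qed
  show ?thesis unfolding disc_int_def
    using 1 by (intro integral_norm_bound_integral integrable_cmean F nF) (auto intro!: mult_left_mono)
qed

text \<open>Circle means and weighted disc integrals of real functions both satisfy these rules. The
  abstraction lets monotonicity and the Cauchy-Schwarz inequality be derived once for both.\<close>

definition pos_functional :: "((complex \<Rightarrow> real) \<Rightarrow> real) \<Rightarrow> bool" where
  "pos_functional I \<longleftrightarrow>
     (\<forall>F G. continuous_on (cball 0 1) F \<longrightarrow> continuous_on (cball 0 1) G \<longrightarrow>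
        I (\<lambda>z. F z + G z) = I F + I G) \<and>
     (\<forall>c F. continuous_on (cball 0 1) F \<longrightarrow> I (\<lambda>z. c * F z) = c * I F) \<and>
     (\<forall>F. continuous_on (cball 0 1) F \<longrightarrow> (\<forall>z\<in>cball 0 1. 0 \<le> F z) \<longrightarrow> 0 \<le> I F)"

lemma pos_functional_cmean: "pos_functional (\<lambda>F. cmean F 1)"
  by (auto simp: pos_functional_def cmean_add cmean_cmul intro!: cmean_nonneg)

lemma pos_functional_disc_int: "pos_functional disc_int"
  unfolding pos_functional_def
proof (intro conjI allI impI)
  fix F G :: "complex \<Rightarrow> real" and c :: real
  assume F: "continuous_on (cball 0 1) F"
  show "disc_int (\<lambda>z. c * F z) = c * disc_int F"
    unfolding disc_int_def cmean_cmul by (simp add: mult.left_commute[of _ c])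
  {
    assume G: "continuous_on (cball 0 1) G"
    have 1: "integral {0..1} (\<lambda>s. s *\<^sub>R cmean (\<lambda>z. F z + G z) (r * s))
        = integral {0..1} (\<lambda>s. s *\<^sub>R cmean F (r * s)) + integral {0..1} (\<lambda>s. s *\<^sub>R cmean G (r * s))"
      if r: "r \<in> {0..1}" for r
    proof -
      have "integral {0..1} (\<lambda>s. s *\<^sub>R cmean (\<lambda>z. F z + G z) (r * s))
          = integral {0..1} (\<lambda>s. s *\<^sub>R cmean F (r * s) + s *\<^sub>R cmean G (r * s))"
        using r by (intro integral_cong) (auto simp: cmean_add F G mult_le_one algebra_simps)
      thus ?thesis by (simp only: integral_add integrable_cmean F G r)
    qed
    have "disc_int (\<lambda>z. F z + G z) = integral {0..1} (\<lambda>r.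
         r *\<^sub>R integral {0..1} (\<lambda>s. s *\<^sub>R cmean F (r * s)) +
         r *\<^sub>R integral {0..1} (\<lambda>s. s *\<^sub>R cmean G (r * s)))"
      unfolding disc_int_def by (intro integral_cong) (simp only: 1 scaleR_add_right)
    thus "disc_int (\<lambda>z. F z + G z) = disc_int F + disc_int G"
      unfolding disc_int_def by (simp only: integral_add integrable_cmean F G)
  }
  assume pos: "\<forall>z\<in>cball 0 1. 0 \<le> F z"
  have "0 \<le> integral {0..1} (\<lambda>s. s *\<^sub>R cmean F (r * s))" if r: "r \<in> {0..1}" for r
    using r pos
    by (intro integral_nonneg integrable_cmean F) (auto intro!: mult_nonneg_nonneg cmean_nonneg F mult_le_one)
  thus "0 \<le> disc_int F" unfolding disc_int_def
    by (intro integral_nonneg integrable_cmean F) (auto intro!: mult_nonneg_nonneg)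
qed

section \<open>Wirtinger calculus and derivatives of circle means\<close>

lemma wirt_add: "wirt F p q z \<Longrightarrow> wirt G p' q' z \<Longrightarrow> wirt (\<lambda>z. F z + G z) (p + p') (q + q') z"
  unfolding wirt_def by (drule (1) has_derivative_add) (simp add: algebra_simps)

lemma wirt_diff: "wirt F p q z \<Longrightarrow> wirt G p' q' z \<Longrightarrow> wirt (\<lambda>z. F z - G z) (p - p') (q - q') z"
  unfolding wirt_def by (drule (1) has_derivative_diff) (simp add: algebra_simps)

lemma wirt_mult: "wirt F p q z \<Longrightarrow> wirt G p' q' z \<Longrightarrow>
   wirt (\<lambda>z. F z * G z) (F z * p' + p * G z) (F z * q' + q * G z) z"
  unfolding wirt_def by (drule (1) has_derivative_mult) (simp add: algebra_simps)

lemma wirt_cnj: "wirt F p q z \<Longrightarrow> wirt (\<lambda>z. cnj (F z)) (cnj q) (cnj p) z"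
  unfolding wirt_def by (drule has_derivative_cnj) (simp add: algebra_simps)

lemma wirt_divide: "wirt F p q z \<Longrightarrow> wirt G p' q' z \<Longrightarrow> G z \<noteq> 0 \<Longrightarrow>
   wirt (\<lambda>z. F z / G z) ((p * G z - F z * p') / (G z)\<^sup>2) ((q * G z - F z * q') / (G z)\<^sup>2) z"
  unfolding wirt_def
  by (rule has_derivative_eq_rhs, erule (2) has_derivative_divide')
     (simp add: fun_eq_iff power2_eq_square add_divide_distrib diff_divide_distrib algebra_simps)

lemma wirt_DERIV: "(F has_field_derivative p) (at z) \<Longrightarrow> wirt F p 0 z"
  by (simp add: wirt_def has_field_derivative_def)

lemma wirt_const: "wirt (\<lambda>_. c) 0 0 z" and wirt_ident: "wirt (\<lambda>z. z) 1 0 z"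
  by (auto simp: wirt_def)

lemma wirt_compose_vector_derivative:
  assumes "wirt F p q (g x)" "(g has_vector_derivative g') (at x within S)"
  shows "((\<lambda>x. F (g x)) has_vector_derivative p * g' + q * cnj g') (at x within S)"
proof -
  have "(F \<circ> g has_derivative (\<lambda>h. p * h + q * cnj h) \<circ> (\<lambda>x. x *\<^sub>R g')) (at x within S)"
    using assms unfolding wirt_def has_vector_derivative_def
    by (intro diff_chain_within) (auto intro: has_derivative_at_withinI)
  thus ?thesis by (simp add: has_vector_derivative_def o_def algebra_simps)
qed

context
  fixes F p q :: "complex \<Rightarrow> complex"
  assumes w: "\<And>z. z \<in> cball 0 1 \<Longrightarrow> wirt F (p z) (q z) z"
    and p: "continuous_on (cball 0 1) p" and q: "continuous_on (cball 0 1) q"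
begin

lemma wirt_imp_continuous_on: "continuous_on (cball 0 1) F"
  using w has_derivative_continuous unfolding wirt_def
  by (intro continuous_at_imp_continuous_on) blast

text \<open>The derivative of \<open>F\<close> along the parametrised circle is
  \<open>2 * pi * \<i>\<close> times \<open>z * p z - cnj z * q z\<close>, and a derivative
  integrates to 0 over a full period.\<close>

lemma cmean_rotate:
  assumes r: "r \<in> {0..1}"
  shows "cmean (\<lambda>z. z * p z) r = cmean (\<lambda>z. cnj z * q z) r"
proof -
  let ?z = "\<lambda>t. of_real r * cis (2 * pi * t)"
  have der: "((\<lambda>t. F (?z t)) has_vector_derivative
      p (?z t) * (2 * pi * \<i> * ?z t) + q (?z t) * cnj (2 * pi * \<i> * ?z t)) (at t within {0..1})" for t
  proof (rule wirt_compose_vector_derivative[OF w])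
    show "?z t \<in> cball 0 1" using r by (simp add: norm_mult)
    have "((\<lambda>t. of_real r * exp (\<i> * (2 * of_real pi * of_real t))) has_vector_derivative
      2 * of_real pi * \<i> * (of_real r * exp (\<i> * (2 * of_real pi * of_real t)))) (at t within {0..1})"
      by (rule has_vector_derivative_real_field) (auto intro!: derivative_eq_intros)
    thus "(?z has_vector_derivative 2 * pi * \<i> * ?z t) (at t within {0..1})"
      by (simp add: cis_conv_exp)
  qed
  define c where "c = 2 * complex_of_real pi * \<i>"
  have nz: "c \<noteq> 0" by (simp add: c_def)
  from der have "((\<lambda>t. p (?z t) * (c * ?z t) + q (?z t) * cnj (c * ?z t)) has_integral 0) {0..1}"
    using fundamental_theorem_of_calculus[of 0 1 "\<lambda>t. F (?z t)"] unfolding c_def by force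
  hence "((\<lambda>t. c * (?z t * p (?z t) - cnj (?z t) * q (?z t))) has_integral 0) {0..1}"
    by (rule has_integral_eq[rotated]) (simp add: algebra_simps c_def)
  from has_integral_mult_right[OF this, of "inverse c"]
  have "((\<lambda>t. ?z t * p (?z t) - cnj (?z t) * q (?z t)) has_integral 0) {0..1}"
    using nz by (simp flip: mult.assoc[of "inverse c" c])
  moreover have "integral {0..1} (\<lambda>t. ?z t * p (?z t) - cnj (?z t) * q (?z t)) =
      integral {0..1} (\<lambda>t. ?z t * p (?z t)) - integral {0..1} (\<lambda>t. cnj (?z t) * q (?z t))"
    by (intro Henstock_Kurzweil_Integration.integral_diff integrable_circle[where F="\<lambda>z. z * p z"] integrable_circle[where F="\<lambda>z. cnj z * q z"] r
         continuous_intros p q)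
  ultimately show ?thesis by (simp add: cmean_def integral_unique)
qed

text \<open>Differentiation under the integral gives the mean of
  \<open>z * p z + cnj z * q z\<close> divided by \<open>r\<close>. By \<open>cmean_rotate\<close>
  the two summands have equal means, hence the factor 2.\<close>

lemma cmean_deriv:
  assumes r: "r \<in> {0<..1}"
  shows "(cmean F has_vector_derivative 2 * cmean (\<lambda>z. cnj z * q z) r / r) (at r within {0..1})"
proof -
  let ?z = "\<lambda>r t. of_real r * cis (2 * pi * t)"
  have "((\<lambda>r. integral (cbox 0 1) (\<lambda>t. F (?z r t))) has_vector_derivative
      integral (cbox 0 1) (\<lambda>t. p (?z r t) * cis (2 * pi * t) + q (?z r t) * cnj (cis (2 * pi * t)))) (at r within {0..1})"
  proof (rule leibniz_rule_vector_derivative)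
    show "((\<lambda>x. F (?z x t)) has_vector_derivative p (?z x t) * cis (2 * pi * t) + q (?z x t) * cnj (cis (2 * pi * t)))
          (at x within {0..1})" if "x \<in> {0..1}" for x t
      using that by (intro wirt_compose_vector_derivative[OF w])
        (auto simp: norm_mult has_vector_derivative_def intro!: derivative_eq_intros simp: scaleR_conv_of_real)
    show "(\<lambda>t. F (?z x t)) integrable_on cbox 0 1" if "x \<in> {0..1}" for x
      using integrable_circle[OF wirt_imp_continuous_on that] by simp
    show "continuous_on ({0..1} \<times> cbox 0 1) (\<lambda>(x, t). p (?z x t) * cis (2 * pi * t) + q (?z x t) * cnj (cis (2 * pi * t)))"
      unfolding case_prod_unfold
      by (intro continuous_intros continuous_on_polar p q) auto
  qed (use r in auto)
  moreover have "integral (cbox 0 1) (\<lambda>t. p (?z r t) * cis (2 * pi * t) + q (?z r t) * cnj (cis (2 * pi * t)))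
      = integral {0..1} (\<lambda>t. (?z r t * p (?z r t) + cnj (?z r t) * q (?z r t)) / of_real r)"
    unfolding cbox_interval using r by (intro integral_cong) (simp add: field_simps)
  also have "\<dots> = cmean (\<lambda>z. z * p z + cnj z * q z) r / r"
    unfolding cmean_def by simp
  also have "\<dots> = 2 * cmean (\<lambda>z. cnj z * q z) r / r"
    using r by (subst cmean_add) (auto simp: cmean_rotate intro!: continuous_intros p q)
  finally show ?thesis by (simp add: cmean_def[abs_def])
qed

end

text \<open>\<open>p'\<close> is the mixed second derivative of \<open>F\<close>, so
  \<open>4 * p'\<close> is its Laplacian. The radial derivative formula is used twice, for
  \<open>F\<close> and for \<open>cnj z * q z\<close>; integrating back twice from radius 0 produces
  the nested integral in \<open>disc_int\<close>.\<close>

lemma Green_disc: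
  assumes F: "\<And>z. z \<in> cball 0 1 \<Longrightarrow> wirt F (p z) (q z) z"
    and Q: "\<And>z. z \<in> cball 0 1 \<Longrightarrow> wirt q (p' z) (q' z) z"
    and cont: "continuous_on (cball 0 1) p" "continuous_on (cball 0 1) p'" "continuous_on (cball 0 1) q'"
  shows "cmean F 1 - F 0 = 4 * disc_int p'"
proof -
  note q = wirt_imp_continuous_on[OF Q cont(2,3), simplified]
  define S where "S = cmean (\<lambda>z. cnj z * q z)"
  have wS: "wirt (\<lambda>z. cnj z * q z) (cnj z * p' z) (cnj z * q' z + q z) z" if "z \<in> cball 0 1" for z
    using wirt_mult[OF wirt_cnj[OF wirt_ident] Q[OF that]] by simp
  have contS: "continuous_on (cball 0 1) (\<lambda>z. cnj z * p' z)" "continuous_on (cball 0 1) (\<lambda>z. cnj z * q' z + q z)"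
    by (intro continuous_intros cont q)+
  have dS: "(S has_vector_derivative 2 * r * cmean p' r) (at r within {0..1})" if r: "r \<in> {0<..1}" for r
  proof -
    \<comment> \<open>Rotation trades the conjugate derivative of \<open>cnj z * q z\<close> for its
      holomorphic one, and \<open>z * cnj z\<close> is constant on the circle.\<close>
    have "cmean (\<lambda>z. cnj z * (cnj z * q' z + q z)) r = cmean (\<lambda>z. z * (cnj z * p' z)) r"
      using r by (intro cmean_rotate[OF wS contS, symmetric]) auto
    also have "\<dots> = cmean (\<lambda>z. (of_real r)\<^sup>2 * p' z) r"
      unfolding cmean_def by (intro integral_cong) (simp add: power2_eq_square cis_cnj cis_mult mult.assoc[of "cis _" "cis _"])
    also have "\<dots> = (of_real r)\<^sup>2 * cmean p' r" unfolding cmean_def by simp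
    finally show ?thesis
      using cmean_deriv[OF wS contS r] r by (simp add: S_def power2_eq_square mult.assoc)
  qed
  have S: "S r = 2 * r\<^sup>2 * integral {0..1} (\<lambda>s. s *\<^sub>R cmean p' (r * s))" if r: "r \<in> {0<..1}" for r
  proof -
    \<comment> \<open>The substitution of \<open>r * s\<close> for the radius keeps the interval
      fixed and yields the inner integrand of \<open>disc_int\<close>. The boundary term vanishes
      because \<open>S 0 = 0\<close>.\<close>
    have "((\<lambda>s. r *\<^sub>R (2 * (r * s) * cmean p' (r * s))) has_integral (S (r * 1) - S (r * 0))) {0..1}"
    proof (rule fundamental_theorem_of_calculus_interior)
      show "continuous_on {0..1} (\<lambda>s. S (r * s))"
        unfolding S_def using r
        by (intro continuous_on_compose2[OF continuous_cmean] continuous_intros q) (auto intro: mult_le_one)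
      fix s :: real assume s: "s \<in> {0<..<1}"
      have "r * s \<le> s" using r s by (simp add: mult_left_le_one_le)
      moreover have "0 < r * s" using r s by simp
      ultimately have rs: "r * s \<in> {0<..<1}"
        using s unfolding greaterThanLessThan_iff by linarith
      hence "(S has_vector_derivative 2 * (r * s) * cmean p' (r * s)) (at (r * s))"
        using dS[of "r * s"] at_within_interior[of "r * s" "{0..1}"] by simp
      moreover have "((\<lambda>s. r * s) has_vector_derivative r) (at s)"
        unfolding has_vector_derivative_def by (auto intro!: derivative_eq_intros)
      ultimately show "((\<lambda>s. S (r * s)) has_vector_derivative r *\<^sub>R (2 * (r * s) * cmean p' (r * s))) (at s)"
        using vector_diff_chain_at[of "\<lambda>s. r * s" r s S] by (simp add: o_def)
    qed auto
    moreover have "S 0 = 0" by (simp add: S_def cmean_def)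
    ultimately have "S r = integral {0..1} (\<lambda>s. 2 * of_real r ^ 2 * (s *\<^sub>R cmean p' (r * s)))"
      by (simp add: integral_unique power2_eq_square mult_ac scaleR_conv_of_real)
    thus ?thesis by (simp only: integral_mult_right of_real_mult of_real_power of_real_numeral)
  qed
  have "((\<lambda>r. 4 * (r *\<^sub>R integral {0..1} (\<lambda>s. s *\<^sub>R cmean p' (r * s)))) has_integral (cmean F 1 - cmean F 0)) {0..1}"
  proof (rule fundamental_theorem_of_calculus_interior)
    show "continuous_on {0..1} (cmean F)"
      by (intro continuous_cmean wirt_imp_continuous_on[OF F cont(1) q])
    fix r :: real assume r: "r \<in> {0<..<1}"
    have "(cmean F has_vector_derivative 2 * S r / r) (at r)"
      using cmean_deriv[OF F cont(1) q, of r] r at_within_interior[of r "{0..1}"] by (simp add: S_def)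
    also have "2 * S r / r = 4 * (r *\<^sub>R integral {0..1} (\<lambda>s. s *\<^sub>R cmean p' (r * s)))"
      using S[of r] r by (simp add: scaleR_conv_of_real power2_eq_square)
    finally show "(cmean F has_vector_derivative 4 * (r *\<^sub>R integral {0..1} (\<lambda>s. s *\<^sub>R cmean p' (r * s)))) (at r)" .
  qed auto
  moreover have "cmean F 0 = F 0" by (simp add: cmean_def)
  ultimately show ?thesis unfolding disc_int_def integral_mult_right[symmetric]
    by (simp only: integral_unique)
qed

section \<open>Order properties of positive functionals\<close>

lemma pos_functional_add:
  "pos_functional I \<Longrightarrow> continuous_on (cball 0 1) F \<Longrightarrow> continuous_on (cball 0 1) G \<Longrightarrow>
     I (\<lambda>z. F z + G z) = I F + I G"
  and pos_functional_cmul: "pos_functional I \<Longrightarrow> continuous_on (cball 0 1) F \<Longrightarrow> I (\<lambda>z. c * F z) = c * I F"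
  and pos_functional_nonneg: "pos_functional I \<Longrightarrow> continuous_on (cball 0 1) F \<Longrightarrow>
     (\<And>z. z \<in> cball 0 1 \<Longrightarrow> 0 \<le> F z) \<Longrightarrow> 0 \<le> I F"
  unfolding pos_functional_def by blast+

lemma pos_functional_mono:
  assumes I: "pos_functional I" and F: "continuous_on (cball 0 1) F" and G: "continuous_on (cball 0 1) G"
    and le: "\<And>z. z \<in> cball 0 1 \<Longrightarrow> F z \<le> G z"
  shows "I F \<le> I G"
proof -
  have "0 \<le> I (\<lambda>z. G z + (-1) * F z)"
    using le by (intro pos_functional_nonneg[OF I] continuous_intros F G) auto
  also have "\<dots> = I G + I (\<lambda>z. (-1) * F z)"
    by (intro pos_functional_add[OF I] continuous_intros F G)
  also have "I (\<lambda>z. (-1) * F z) = - I F" using pos_functional_cmul[OF I F, of "-1"] by simp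
  finally show ?thesis by simp
qed

lemma pos_functional_lincomb:
  assumes I: "pos_functional I" and F: "continuous_on (cball 0 1) F" and G: "continuous_on (cball 0 1) G"
  shows "I (\<lambda>z. c * F z + d * G z) = c * I F + d * I G"
proof -
  have "I (\<lambda>z. c * F z + d * G z) = I (\<lambda>z. c * F z) + I (\<lambda>z. d * G z)"
    by (intro pos_functional_add[OF I] continuous_intros F G)
  thus ?thesis by (simp only: pos_functional_cmul[OF I] F G)
qed

text \<open>The value of \<open>I\<close> on the square of \<open>t * u - v\<close> is a nonnegative
  quadratic in \<open>t\<close>, which bounds its discriminant.\<close>

lemma pos_functional_Cauchy_Schwarz:
  assumes I: "pos_functional I" and u: "continuous_on (cball 0 1) u" and v: "continuous_on (cball 0 1) v"
  shows "I (\<lambda>z. u z * v z) \<le> sqrt (I (\<lambda>z. (u z)\<^sup>2)) * sqrt (I (\<lambda>z. (v z)\<^sup>2))"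
proof -
  define A B C where "A = I (\<lambda>z. (u z)\<^sup>2)" "B = I (\<lambda>z. u z * v z)" "C = I (\<lambda>z. (v z)\<^sup>2)"
  have cuv: "continuous_on (cball 0 1) (\<lambda>z. (u z)\<^sup>2)" "continuous_on (cball 0 1) (\<lambda>z. u z * v z)"
       "continuous_on (cball 0 1) (\<lambda>z. (v z)\<^sup>2)"
    by (intro continuous_intros u v)+
  have q: "0 \<le> t\<^sup>2 * A - 2 * t * B + C" for t
  proof -
    have "0 \<le> I (\<lambda>z. (t * u z - v z)\<^sup>2)"
      by (intro pos_functional_nonneg[OF I] continuous_intros u v) auto
    also have "(\<lambda>z. (t * u z - v z)\<^sup>2) = (\<lambda>z. 1 * (t\<^sup>2 * (u z)\<^sup>2 + (- 2 * t) * (u z * v z)) + 1 * (v z)\<^sup>2)"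
      by (auto simp: power2_eq_square algebra_simps)
    also have "I \<dots> = 1 * I (\<lambda>z. t\<^sup>2 * (u z)\<^sup>2 + (- 2 * t) * (u z * v z)) + 1 * C"
      unfolding A_B_C_def by (intro pos_functional_lincomb I continuous_intros u v)
    also have "I (\<lambda>z. t\<^sup>2 * (u z)\<^sup>2 + (- 2 * t) * (u z * v z)) = t\<^sup>2 * A + (- 2 * t) * B"
      unfolding A_B_C_def by (intro pos_functional_lincomb I cuv)
    finally show ?thesis by simp
  qed
  have AC: "0 \<le> A" "0 \<le> C"
    unfolding A_B_C_def by (intro pos_functional_nonneg[OF I] cuv; simp)+
  have "B\<^sup>2 \<le> A * C"
  proof (cases "A = 0")
    case True
    have "B = 0"
    proof (rule ccontr)
      assume "B \<noteq> 0"
      \<comment> \<open>For \<open>A = 0\<close> this choice of \<open>t\<close> gives the quadratic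
        the value \<open>-1\<close>.\<close>
      with q[of "(C + 1) / (2 * B)"] True show False by simp
    qed
    thus ?thesis using True by simp
  next
    case False
    hence "0 < A" using AC by simp
    with q[of "B / A"] show ?thesis by (simp add: field_simps power2_eq_square)
  qed
  hence "\<bar>B\<bar> \<le> sqrt (A * C)" by (simp add: real_le_rsqrt flip: real_sqrt_abs)
  thus ?thesis by (simp add: A_B_C_def real_sqrt_mult)
qed

lemma cmean_linear:
  assumes "bounded_linear h" "continuous_on (cball 0 1) F" "r \<in> {0..1}"
  shows "cmean (\<lambda>z. h (F z)) r = h (cmean F r)"
  unfolding cmean_def using integral_linear[OF integrable_circle[OF assms(2,3)] assms(1)]
  by (simp add: o_def)

lemma disc_int_linear:
  assumes h: "bounded_linear h" and F: "continuous_on (cball 0 1) F"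
  shows "disc_int (\<lambda>z. h (F z)) = h (disc_int F)"
proof -
  interpret bounded_linear h by fact
  have 1: "integral {0..1} (\<lambda>s. s *\<^sub>R cmean (\<lambda>z. h (F z)) (r * s)) = h (integral {0..1} (\<lambda>s. s *\<^sub>R cmean F (r * s)))"
    if r: "r \<in> {0..1}" for r
  proof -
    have "integral {0..1} (\<lambda>s. s *\<^sub>R cmean (\<lambda>z. h (F z)) (r * s)) = integral {0..1} (h \<circ> (\<lambda>s. s *\<^sub>R cmean F (r * s)))"
      using r by (intro integral_cong) (auto simp: scaleR cmean_linear[OF h F] mult_le_one)
    thus ?thesis using integral_linear[OF integrable_cmean(1)[OF F r] h] by simp
  qed
  have "disc_int (\<lambda>z. h (F z)) = integral {0..1} (h \<circ> (\<lambda>r. r *\<^sub>R integral {0..1} (\<lambda>s. s *\<^sub>R cmean F (r * s))))"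
    unfolding disc_int_def using 1 by (intro integral_cong) (auto simp: scaleR)
  thus ?thesis using integral_linear[OF integrable_cmean(2)[OF F] h] by (simp add: disc_int_def)
qed

section \<open>The Littlewood--Paley inequality and the Wolff estimate\<close>

text \<open>On functions analytic on the closed disc this is the squared norm of the Hardy space H2.
  Only values on the circle enter, so factors that are unimodular there, such as Blaschke products,
  do not change it.\<close>

definition sqn :: "(complex \<Rightarrow> complex) \<Rightarrow> real" where
  "sqn u = cmean (\<lambda>z. (norm (u z))\<^sup>2) 1"

definition l2 :: "(complex \<Rightarrow> complex) \<Rightarrow> real" where
  "l2 u = sqrt (sqn u)"

lemma cmean_circle_cong:
  assumes "\<And>z. norm z = 1 \<Longrightarrow> F z = G z"
  shows "cmean F 1 = cmean G 1"
  unfolding cmean_def by (intro integral_cong assms) (simp add: norm_mult)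

lemma sqn_cong:
  assumes "\<And>z. norm z = 1 \<Longrightarrow> norm (u z) = norm (v z)"
  shows "sqn u = sqn v"
  unfolding sqn_def by (intro cmean_circle_cong) (simp add: assms)

lemma l2_cong:
  assumes "\<And>z. norm z = 1 \<Longrightarrow> norm (u z) = norm (v z)"
  shows "l2 u = l2 v"
  using sqn_cong[of u v] assms by (simp add: l2_def)

lemma sqn_nonneg: "continuous_on (cball 0 1) u \<Longrightarrow> 0 \<le> sqn u"
  unfolding sqn_def by (intro cmean_nonneg continuous_intros) auto

lemma l2_nonneg: "continuous_on (cball 0 1) u \<Longrightarrow> 0 \<le> l2 u"
  unfolding l2_def using sqn_nonneg by simp

lemma l2_power2: "continuous_on (cball 0 1) u \<Longrightarrow> (l2 u)\<^sup>2 = sqn u"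
  unfolding l2_def using sqn_nonneg by simp

lemma sqn_mono:
  assumes "continuous_on (cball 0 1) u" "continuous_on (cball 0 1) v"
    and "\<And>z. z \<in> cball 0 1 \<Longrightarrow> norm (u z) \<le> norm (v z)"
  shows "sqn u \<le> sqn v"
  unfolding sqn_def
  by (intro pos_functional_mono[OF pos_functional_cmean] continuous_intros assms power_mono) auto

lemma cmean_norm_mult_le:
  assumes "continuous_on (cball 0 1) u" "continuous_on (cball 0 1) v"
  shows "cmean (\<lambda>z. norm (u z) * norm (v z)) 1 \<le> l2 u * l2 v"
  unfolding l2_def sqn_def
  by (rule pos_functional_Cauchy_Schwarz[OF pos_functional_cmean]) (intro continuous_intros assms)+

lemma norm_cmean_mult_le:
  fixes u v :: "complex \<Rightarrow> complex"
  assumes u: "continuous_on (cball 0 1) u" and v: "continuous_on (cball 0 1) v"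
  shows "norm (cmean (\<lambda>z. u z * v z) 1) \<le> l2 u * l2 v"
proof -
  have "norm (cmean (\<lambda>z. u z * v z) 1) \<le> cmean (\<lambda>z. norm (u z * v z)) 1"
    by (intro cmean_norm_le continuous_intros u v) auto
  thus ?thesis using cmean_norm_mult_le[OF u v] by (simp add: norm_mult)
qed

lemma l2_triangle:
  assumes u: "continuous_on (cball 0 1) u" and v: "continuous_on (cball 0 1) v"
  shows "l2 (\<lambda>z. u z + v z) \<le> l2 u + l2 v"
proof -
  have "sqn (\<lambda>z. u z + v z) \<le> cmean (\<lambda>z. 1 * (1 * (norm (u z))\<^sup>2 + 2 * (norm (u z) * norm (v z))) + 1 * (norm (v z))\<^sup>2) 1"
    unfolding sqn_def
  proof (rule pos_functional_mono[OF pos_functional_cmean])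
    fix z
    have "(norm (u z + v z))\<^sup>2 \<le> (norm (u z) + norm (v z))\<^sup>2"
      by (intro power_mono norm_triangle_ineq) auto
    thus "(norm (u z + v z))\<^sup>2 \<le> 1 * (1 * (norm (u z))\<^sup>2 + 2 * (norm (u z) * norm (v z))) + 1 * (norm (v z))\<^sup>2"
      by (simp add: power2_eq_square algebra_simps)
  qed (intro continuous_intros u v)+
  also have "\<dots> = 1 * cmean (\<lambda>z. 1 * (norm (u z))\<^sup>2 + 2 * (norm (u z) * norm (v z))) 1 + 1 * sqn v"
    unfolding sqn_def by (rule pos_functional_lincomb[OF pos_functional_cmean]) (intro continuous_intros u v)+
  also have "cmean (\<lambda>z. 1 * (norm (u z))\<^sup>2 + 2 * (norm (u z) * norm (v z))) 1 =
       1 * sqn u + 2 * cmean (\<lambda>z. norm (u z) * norm (v z)) 1"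
    unfolding sqn_def by (rule pos_functional_lincomb[OF pos_functional_cmean]) (intro continuous_intros u v)+
  also have "1 * (1 * sqn u + 2 * cmean (\<lambda>z. norm (u z) * norm (v z)) 1) + 1 * sqn v \<le> (l2 u + l2 v)\<^sup>2"
    using cmean_norm_mult_le[OF u v] l2_power2[OF u] l2_power2[OF v] by (simp add: power2_sum)
  finally show ?thesis
    using l2_nonneg[OF u] l2_nonneg[OF v] unfolding l2_def[of "\<lambda>z. u z + v z"] by (intro real_le_lsqrt) auto
qed

lemma l2_cmul: "l2 (\<lambda>z. c * u z) = norm c * l2 u"
  unfolding l2_def sqn_def by (simp add: norm_mult power_mult_distrib cmean_cmul real_sqrt_mult)

lemma continuous_on_analytic: "f analytic_on S \<Longrightarrow> continuous_on S f"
  by (intro holomorphic_on_imp_continuous_on analytic_imp_holomorphic)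

lemma wirt_analytic: "f analytic_on S \<Longrightarrow> z \<in> S \<Longrightarrow> wirt f (deriv f z) 0 z"
  using analytic_on_imp_differentiable_at field_differentiable_derivI wirt_DERIV by blast

text \<open>Green's formula with vanishing conjugate derivative.\<close>

lemma cmean_analytic:
  assumes f: "f analytic_on cball 0 1"
  shows "cmean f 1 = f 0"
proof -
  have "cmean f 1 - f 0 = 4 * disc_int (\<lambda>_. 0 :: complex)"
    using f by (intro Green_disc[OF wirt_analytic[OF f] wirt_const] continuous_intros
      continuous_on_analytic analytic_intros)
  thus ?thesis by (simp add: disc_int_def cmean_def)
qed

text \<open>Green's formula for \<open>f * cnj f\<close>, whose mixed derivative is the squared
  modulus of \<open>deriv f\<close>, gives an identity, from which the squared modulus of
  \<open>f 0\<close> is dropped.\<close>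

lemma Littlewood_Paley:
  assumes f: "f analytic_on cball 0 1"
  shows "4 * disc_int (\<lambda>z. (norm (deriv f z))\<^sup>2) \<le> sqn f"
proof -
  note f' = analytic_deriv[OF f]
  note cont = continuous_on_analytic[OF f] continuous_on_analytic[OF f']
    continuous_on_analytic[OF analytic_deriv[OF f']]
  have 1: "wirt (\<lambda>z. f z * cnj (f z)) (deriv f z * cnj (f z)) (f z * cnj (deriv f z)) z" if "z \<in> cball 0 1" for z
    using wirt_mult[OF wirt_analytic[OF f that] wirt_cnj[OF wirt_analytic[OF f that]]] by simp
  have 2: "wirt (\<lambda>z. f z * cnj (deriv f z)) (deriv f z * cnj (deriv f z)) (f z * cnj (deriv (deriv f) z)) z" if "z \<in> cball 0 1" for z
    using wirt_mult[OF wirt_analytic[OF f that] wirt_cnj[OF wirt_analytic[OF f' that]]] by simp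
  have "cmean (\<lambda>z. f z * cnj (f z)) 1 - f 0 * cnj (f 0) = 4 * disc_int (\<lambda>z. deriv f z * cnj (deriv f z))"
    by (rule Green_disc[OF 1 2]) (assumption | intro continuous_intros cont)+
  hence "cmean (\<lambda>z. of_real ((norm (f z))\<^sup>2)) 1 - of_real ((norm (f 0))\<^sup>2) = 4 * disc_int (\<lambda>z. complex_of_real ((norm (deriv f z))\<^sup>2))"
    unfolding complex_norm_square .
  also have "cmean (\<lambda>z. complex_of_real ((norm (f z))\<^sup>2)) 1 = of_real (sqn f)"
    unfolding sqn_def by (intro cmean_linear bounded_linear_of_real continuous_intros cont) auto
  also have "disc_int (\<lambda>z. complex_of_real ((norm (deriv f z))\<^sup>2)) = of_real (disc_int (\<lambda>z. (norm (deriv f z))\<^sup>2))"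
    by (intro disc_int_linear bounded_linear_of_real continuous_intros cont)
  finally have "complex_of_real (sqn f - (norm (f 0))\<^sup>2) = of_real (4 * disc_int (\<lambda>z. (norm (deriv f z))\<^sup>2))"
    by simp
  hence "sqn f - (norm (f 0))\<^sup>2 = 4 * disc_int (\<lambda>z. (norm (deriv f z))\<^sup>2)"
    unfolding of_real_eq_iff .
  thus ?thesis using zero_le_power2[of "norm (f 0)"] by linarith
qed

text \<open>The squared modulus of \<open>deriv a\<close>, with the logarithmic weight, is the
  density of a Carleson measure whose constant does not depend on \<open>a\<close>. Indeed
  \<open>deriv a * f\<close> is the derivative of \<open>a * f\<close> minus
  \<open>a * deriv f\<close>, and the Littlewood--Paley inequality bounds both.\<close>

lemma Carleson_deriv:
  assumes a: "a analytic_on cball 0 1" and f: "f analytic_on cball 0 1"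
    and le: "\<And>z. z \<in> cball 0 1 \<Longrightarrow> norm (a z) \<le> 1"
  shows "disc_int (\<lambda>z. (norm (deriv a z) * norm (f z))\<^sup>2) \<le> sqn f"
proof -
  have af: "(\<lambda>z. a z * f z) analytic_on cball 0 1" by (intro analytic_intros a f)
  note cont = continuous_on_analytic[OF f] continuous_on_analytic[OF a]
    continuous_on_analytic[OF analytic_deriv[OF f]] continuous_on_analytic[OF analytic_deriv[OF a]]
    continuous_on_analytic[OF analytic_deriv[OF af]]
  have "disc_int (\<lambda>z. (norm (deriv a z) * norm (f z))\<^sup>2) \<le>
        disc_int (\<lambda>z. 2 * (norm (deriv (\<lambda>z. a z * f z) z))\<^sup>2 + 2 * (norm (deriv f z))\<^sup>2)"
  proof (rule pos_functional_mono[OF pos_functional_disc_int])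
    fix z :: complex assume z: "z \<in> cball 0 1"
    have "deriv (\<lambda>z. a z * f z) z = a z * deriv f z + deriv a z * f z"
      using a f z analytic_on_imp_differentiable_at by (intro deriv_mult) blast+
    hence "norm (deriv a z) * norm (f z) = norm (deriv (\<lambda>z. a z * f z) z - a z * deriv f z)"
      by (simp add: norm_mult)
    also have "\<dots> \<le> norm (deriv (\<lambda>z. a z * f z) z) + norm (a z) * norm (deriv f z)"
      by (metis norm_mult norm_triangle_ineq4)
    also have "\<dots> \<le> norm (deriv (\<lambda>z. a z * f z) z) + norm (deriv f z)"
      using le[OF z] by (simp add: mult_left_le_one_le)
    finally have "(norm (deriv a z) * norm (f z))\<^sup>2 \<le> (norm (deriv (\<lambda>z. a z * f z) z) + norm (deriv f z))\<^sup>2"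
      by (intro power_mono) auto
    also have "\<dots> \<le> 2 * (norm (deriv (\<lambda>z. a z * f z) z))\<^sup>2 + 2 * (norm (deriv f z))\<^sup>2"
      using sum_squares_bound[of "norm (deriv (\<lambda>z. a z * f z) z)" "norm (deriv f z)"] by (simp add: power2_sum)
    finally show "(norm (deriv a z) * norm (f z))\<^sup>2 \<le> 2 * (norm (deriv (\<lambda>z. a z * f z) z))\<^sup>2 + 2 * (norm (deriv f z))\<^sup>2" .
  qed (intro continuous_intros cont)+
  also have "\<dots> = 2 * disc_int (\<lambda>z. (norm (deriv (\<lambda>z. a z * f z) z))\<^sup>2) + 2 * disc_int (\<lambda>z. (norm (deriv f z))\<^sup>2)"
    by (rule pos_functional_lincomb[OF pos_functional_disc_int]) (intro continuous_intros cont)+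
  also have "\<dots> \<le> sqn (\<lambda>z. a z * f z) / 2 + sqn f / 2"
    using Littlewood_Paley[OF f] Littlewood_Paley[OF af] by simp
  also have "sqn (\<lambda>z. a z * f z) \<le> sqn f"
    using le by (intro sqn_mono continuous_intros cont) (auto simp: norm_mult mult_left_le_one_le)
  finally show ?thesis by simp
qed

lemma Carleson_deriv2:
  assumes a: "a analytic_on cball 0 1" and b: "b analytic_on cball 0 1" and f: "f analytic_on cball 0 1"
    and le: "\<And>z. z \<in> cball 0 1 \<Longrightarrow> norm (a z) \<le> 1" "\<And>z. z \<in> cball 0 1 \<Longrightarrow> norm (b z) \<le> 1"
  shows "sqrt (disc_int (\<lambda>z. ((norm (deriv a z) + norm (deriv b z)) * norm (f z))\<^sup>2)) \<le> 2 * l2 f"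
proof -
  note cont = continuous_on_analytic[OF f] continuous_on_analytic[OF a] continuous_on_analytic[OF b]
    continuous_on_analytic[OF analytic_deriv[OF b]] continuous_on_analytic[OF analytic_deriv[OF a]]
  have "disc_int (\<lambda>z. ((norm (deriv a z) + norm (deriv b z)) * norm (f z))\<^sup>2) \<le>
        disc_int (\<lambda>z. 2 * (norm (deriv a z) * norm (f z))\<^sup>2 + 2 * (norm (deriv b z) * norm (f z))\<^sup>2)"
  proof (rule pos_functional_mono[OF pos_functional_disc_int])
    fix z :: complex
    show "((norm (deriv a z) + norm (deriv b z)) * norm (f z))\<^sup>2
       \<le> 2 * (norm (deriv a z) * norm (f z))\<^sup>2 + 2 * (norm (deriv b z) * norm (f z))\<^sup>2"
      using sum_squares_bound[of "norm (deriv a z) * norm (f z)" "norm (deriv b z) * norm (f z)"]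
      by (simp add: distrib_right power2_sum)
  qed (intro continuous_intros cont)+
  also have "\<dots> = 2 * disc_int (\<lambda>z. (norm (deriv a z) * norm (f z))\<^sup>2) + 2 * disc_int (\<lambda>z. (norm (deriv b z) * norm (f z))\<^sup>2)"
    by (rule pos_functional_lincomb[OF pos_functional_disc_int]) (intro continuous_intros cont)+
  also have "\<dots> \<le> 4 * sqn f"
    using Carleson_deriv[OF a f le(1)] Carleson_deriv[OF b f le(2)] by simp
  finally have "sqrt (disc_int (\<lambda>z. ((norm (deriv a z) + norm (deriv b z)) * norm (f z))\<^sup>2)) \<le> sqrt (4 * sqn f)"
    by simp
  thus ?thesis by (simp add: l2_def real_sqrt_mult)
qed

text \<open>The conjugate derivative of the quotient by \<open>D\<close> contains \<open>y\<close>
  and \<open>y'\<close> only through \<open>a * y' - b * y\<close>; this is why the norm of that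
  combination suffices on the right. Green's formula turns the mean into a disc integral, the factor
  \<open>z\<close> removing the value at 0, and the Littlewood--Paley and Carleson estimates apply
  to the resulting terms.\<close>

lemma Wolff_estimate:
  fixes a b x y y' :: "complex \<Rightarrow> complex"
  defines "D \<equiv> (\<lambda>z. a z * cnj (a z) + b z * cnj (b z))"
  assumes an: "a analytic_on cball 0 1" "b analytic_on cball 0 1" "x analytic_on cball 0 1"
     "y analytic_on cball 0 1" "y' analytic_on cball 0 1"
    and le: "\<And>z. z \<in> cball 0 1 \<Longrightarrow> norm (a z) \<le> 1" "\<And>z. z \<in> cball 0 1 \<Longrightarrow> norm (b z) \<le> 1"
    and eps: "0 < \<epsilon>" "\<epsilon> \<le> 1" "\<And>z. z \<in> cball 0 1 \<Longrightarrow> \<epsilon> \<le> (norm (a z))\<^sup>2 + (norm (b z))\<^sup>2"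
  shows "norm (cmean (\<lambda>z. x z * z * ((cnj (a z) * y z + cnj (b z) * y' z) / D z)) 1)
           \<le> 40 / \<epsilon> ^ 3 * (l2 x * l2 (\<lambda>z. z * (a z * y' z - b z * y z)))"
proof -
  define k where "k = (\<lambda>z. z * (a z * y' z - b z * y z))"
  have k: "k analytic_on cball 0 1" unfolding k_def by (intro analytic_intros an)
  \<comment> \<open>Once \<open>a * y' - b * y\<close> is taken out, the conjugate derivative of the
    quotient is \<open>N / (D * D)\<close>. As \<open>N\<close> is antianalytic, the next derivative
    falls on \<open>x * k\<close> and on \<open>D\<close> only.\<close>
  define N where "N = (\<lambda>z. cnj (a z) * cnj (deriv b z) - cnj (b z) * cnj (deriv a z))"
  define Q where "Q = (\<lambda>z. (x z * k z) * (N z / (D z * D z)))"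
  define \<kappa> where "\<kappa> = (\<lambda>z. norm (deriv a z) + norm (deriv b z))"
  define pD where "pD = (\<lambda>z. cnj (a z) * deriv a z + cnj (b z) * deriv b z)"
  note an' = an[THEN analytic_deriv] k[THEN analytic_deriv]
  note wa = an(1,2,3,4,5)[THEN wirt_analytic] an'(1,2)[THEN wirt_analytic] k[THEN wirt_analytic]
  note cont = an[THEN continuous_on_analytic] an'[THEN continuous_on_analytic] k[THEN continuous_on_analytic]
     an'(1,2)[THEN analytic_deriv, THEN continuous_on_analytic]
  have D_real: "D z = of_real ((norm (a z))\<^sup>2 + (norm (b z))\<^sup>2)" for z
    unfolding D_def by (simp flip: complex_norm_square)
  have D_ge: "\<epsilon> \<le> norm (D z)" if "z \<in> cball 0 1" for z
    unfolding D_real norm_of_real using eps(3)[OF that] by simp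
  have D0: "D z \<noteq> 0" if "z \<in> cball 0 1" for z using D_ge[OF that] eps(1) by auto
  have contD: "continuous_on (cball 0 1) D" unfolding D_def by (intro continuous_intros cont)
  have contN: "continuous_on (cball 0 1) N" unfolding N_def by (intro continuous_intros cont)
  have contpD: "continuous_on (cball 0 1) pD" unfolding pD_def by (intro continuous_intros cont)
  have wD: "wirt D (pD z) (a z * cnj (deriv a z) + b z * cnj (deriv b z)) z" if z: "z \<in> cball 0 1" for z
    using wirt_add[OF wirt_mult[OF wa(1)[OF z] wirt_cnj[OF wa(1)[OF z]]] wirt_mult[OF wa(2)[OF z] wirt_cnj[OF wa(2)[OF z]]]]
    unfolding D_def pD_def by (simp add: mult.commute)
  define p where "p = (\<lambda>z. x z * z * (((cnj (a z) * deriv y z + cnj (b z) * deriv y' z) * D z -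
         (cnj (a z) * y z + cnj (b z) * y' z) * pD z) / (D z)\<^sup>2) +
        (x z + deriv x z * z) * ((cnj (a z) * y z + cnj (b z) * y' z) / D z))"
  have wF: "wirt (\<lambda>z. x z * z * ((cnj (a z) * y z + cnj (b z) * y' z) / D z)) (p z) (Q z) z"
    if z: "z \<in> cball 0 1" for z
  proof -
    have wN: "wirt (\<lambda>z. cnj (a z) * y z + cnj (b z) * y' z)
        (cnj (a z) * deriv y z + cnj (b z) * deriv y' z) (cnj (deriv a z) * y z + cnj (deriv b z) * y' z) z"
      using wirt_add[OF wirt_mult[OF wirt_cnj[OF wa(1)[OF z]] wa(4)[OF z]]
          wirt_mult[OF wirt_cnj[OF wa(2)[OF z]] wa(5)[OF z]]] by simp
    note w = wirt_mult[OF wirt_mult[OF wa(3)[OF z] wirt_ident] wirt_divide[OF wN wD[OF z] D0[OF z]]]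
    have "(cnj (deriv a z) * y z + cnj (deriv b z) * y' z) * D z -
        (cnj (a z) * y z + cnj (b z) * y' z) * (a z * cnj (deriv a z) + b z * cnj (deriv b z))
       = (a z * y' z - b z * y z) * N z"
      unfolding D_def N_def by (simp add: algebra_simps)
    hence "x z * z * (((cnj (deriv a z) * y z + cnj (deriv b z) * y' z) * D z -
        (cnj (a z) * y z + cnj (b z) * y' z) * (a z * cnj (deriv a z) + b z * cnj (deriv b z))) / (D z)\<^sup>2) = Q z"
      by (simp add: Q_def k_def power2_eq_square)
    with w show ?thesis unfolding p_def by simp
  qed
  define qD where "qD = (\<lambda>z. a z * cnj (deriv a z) + b z * cnj (deriv b z))"
  define qN where "qN = (\<lambda>z. cnj (a z) * cnj (deriv (deriv b) z) - cnj (b z) * cnj (deriv (deriv a) z))"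
  define p' where "p' = (\<lambda>z. (x z * k z) * ((0 * (D z * D z) - N z * (D z * pD z + pD z * D z)) / (D z * D z)\<^sup>2) +
      (x z * deriv k z + deriv x z * k z) * (N z / (D z * D z)))"
  define q' where "q' = (\<lambda>z. (x z * k z) * ((qN z * (D z * D z)
       - N z * (D z * qD z + qD z * D z)) / (D z * D z)\<^sup>2) + (x z * 0 + 0 * k z) * (N z / (D z * D z)))"
  have wQ: "wirt Q (p' z) (q' z) z" if z: "z \<in> cball 0 1" for z
  proof -
    have wD': "wirt D (pD z) (qD z) z" using wD[OF z] by (simp add: qD_def)
    have "wirt N 0 (qN z) z"
      using wirt_diff[OF wirt_mult[OF wirt_cnj[OF wa(1)[OF z]] wirt_cnj[OF wa(7)[OF z]]]
          wirt_mult[OF wirt_cnj[OF wa(2)[OF z]] wirt_cnj[OF wa(6)[OF z]]]]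
      unfolding N_def qN_def by simp
    moreover have "D z * D z \<noteq> 0" using D0[OF z] by simp
    ultimately show ?thesis
      unfolding Q_def p'_def q'_def
      by (intro wirt_mult wirt_divide wD' z wa)
  qed
  have contqD: "continuous_on (cball 0 1) qD" "continuous_on (cball 0 1) qN"
    unfolding qD_def qN_def by (intro continuous_intros cont)+
  have contp: "continuous_on (cball 0 1) p" unfolding p_def
    using D0 by (intro continuous_intros cont contD contpD) auto
  have contp': "continuous_on (cball 0 1) p'" unfolding p'_def
    using D0 by (intro continuous_intros cont contD contpD contN) auto
  have contq': "continuous_on (cball 0 1) q'" unfolding q'_def
    using D0 by (intro continuous_intros cont contD contqD contN) auto
  have cont\<kappa>: "continuous_on (cball 0 1) \<kappa>" unfolding \<kappa>_def by (intro continuous_intros cont)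

  have N_le: "norm (N z) \<le> \<kappa> z" if "z \<in> cball 0 1" for z
  proof -
    have "norm (N z) \<le> norm (a z) * norm (deriv b z) + norm (b z) * norm (deriv a z)"
      unfolding N_def by (rule order.trans[OF norm_triangle_ineq4]) (simp add: norm_mult)
    also have "\<dots> \<le> 1 * norm (deriv b z) + 1 * norm (deriv a z)"
      using le that by (intro add_mono mult_right_mono) auto
    finally show ?thesis by (simp add: \<kappa>_def)
  qed
  have pD_le: "norm (pD z) \<le> \<kappa> z" if "z \<in> cball 0 1" for z
  proof -
    have "norm (pD z) \<le> norm (a z) * norm (deriv a z) + norm (b z) * norm (deriv b z)"
      unfolding pD_def by (rule order.trans[OF norm_triangle_ineq]) (simp add: norm_mult)
    also have "\<dots> \<le> 1 * norm (deriv a z) + 1 * norm (deriv b z)"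
      using le that by (intro add_mono mult_right_mono) auto
    finally show ?thesis by (simp add: \<kappa>_def)
  qed
  \<comment> \<open>\<open>T1\<close> stems from differentiating \<open>D\<close> and pairs two
    Carleson factors; \<open>T2\<close> pairs the derivative of \<open>x\<close> or \<open>k\<close>
    with one Carleson factor.\<close>
  define T1 T2 where "T1 = (\<lambda>z. (\<kappa> z * norm (x z)) * (\<kappa> z * norm (k z)))"
    "T2 = (\<lambda>z. norm (deriv x z) * (\<kappa> z * norm (k z)) + norm (deriv k z) * (\<kappa> z * norm (x z)))"
  have aux: "n * (2 * d * p) / (d * d)\<^sup>2 = 2 * (n * p) / d ^ 3" if "d \<noteq> 0" for d n p :: real
    using that by (simp add: field_simps power2_eq_square power3_eq_cube)
  have p'_le: "norm (p' z) \<le> 2 / \<epsilon> ^ 3 * T1 z + 1 / \<epsilon> ^ 3 * T2 z" if z: "z \<in> cball 0 1" for z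
  proof -
    have k0: "0 \<le> \<kappa> z" by (simp add: \<kappa>_def)
    have "norm (N z * (2 * D z * pD z) / (D z * D z)\<^sup>2) = 2 * (norm (N z) * norm (pD z)) / norm (D z) ^ 3"
      using aux[of "norm (D z)" "norm (N z)" "norm (pD z)"] D0[OF z] by (simp add: norm_mult norm_divide norm_power)
    also have "\<dots> \<le> 2 * (\<kappa> z * \<kappa> z) / \<epsilon> ^ 3"
      using N_le[OF z] pD_le[OF z] D_ge[OF z] eps k0
      by (intro frac_le mult_mono power_mono) auto
    finally have 1: "norm (N z * (2 * D z * pD z) / (D z * D z)\<^sup>2) \<le> 2 * (\<kappa> z * \<kappa> z) / \<epsilon> ^ 3" .
    have "norm (N z / (D z * D z)) = norm (N z) / norm (D z) ^ 2"
      by (simp add: norm_mult norm_divide power2_eq_square)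
    also have "\<dots> \<le> \<kappa> z / \<epsilon> ^ 3"
    proof (intro frac_le N_le z)
      \<comment> \<open>The bound \<open>\<epsilon> \<le> 1\<close> gives both kinds of terms the
        same denominator.\<close>
      have "\<epsilon> ^ 3 \<le> \<epsilon> ^ 2" using eps by (intro power_decreasing) auto
      also have "\<dots> \<le> norm (D z) ^ 2" using D_ge[OF z] eps by (intro power_mono) auto
      finally show "\<epsilon> ^ 3 \<le> norm (D z) ^ 2" .
    qed (use eps k0 in auto)
    finally have 2: "norm (N z / (D z * D z)) \<le> \<kappa> z / \<epsilon> ^ 3" .
    have p'_eq: "p' z = x z * k z * (- (N z * (2 * D z * pD z)) / (D z * D z)\<^sup>2) +
        (x z * deriv k z + deriv x z * k z) * (N z / (D z * D z))"
      unfolding p'_def by (simp add: mult.commute[of "pD z"])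
    have "norm (p' z) \<le> (norm (x z) * norm (k z)) * norm (N z * (2 * D z * pD z) / (D z * D z)\<^sup>2) +
        (norm (x z) * norm (deriv k z) + norm (deriv x z) * norm (k z)) * norm (N z / (D z * D z))"
      unfolding p'_eq
    proof (rule order.trans[OF norm_triangle_ineq] add_mono)+
      show "norm (x z * k z * (- (N z * (2 * D z * pD z)) / (D z * D z)\<^sup>2)) \<le> (norm (x z) * norm (k z)) * norm (N z * (2 * D z * pD z) / (D z * D z)\<^sup>2)"
        by (simp add: norm_mult norm_divide)
      show "norm ((x z * deriv k z + deriv x z * k z) * (N z / (D z * D z))) \<le>
        (norm (x z) * norm (deriv k z) + norm (deriv x z) * norm (k z)) * norm (N z / (D z * D z))"
        unfolding norm_mult[of "x z * deriv k z + deriv x z * k z"]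
        by (intro mult_right_mono order.trans[OF norm_triangle_ineq]) (auto simp: norm_mult)
    qed
    also have "\<dots> \<le> (norm (x z) * norm (k z)) * (2 * (\<kappa> z * \<kappa> z) / \<epsilon> ^ 3) +
        (norm (x z) * norm (deriv k z) + norm (deriv x z) * norm (k z)) * (\<kappa> z / \<epsilon> ^ 3)"
      by (intro add_mono mult_left_mono 1 2) auto
    also have "\<dots> = 2 / \<epsilon> ^ 3 * T1 z + 1 / \<epsilon> ^ 3 * T2 z"
      unfolding T1_T2_def by (simp add: field_simps)
    finally show ?thesis .
  qed
  have contT: "continuous_on (cball 0 1) T1" "continuous_on (cball 0 1) T2"
    unfolding T1_T2_def by (intro continuous_intros cont cont\<kappa>)+
  have LP: "sqrt (disc_int (\<lambda>z. (norm (deriv f z))\<^sup>2)) \<le> l2 f / 2" if "f analytic_on cball 0 1" for f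
  proof -
    have "sqrt (disc_int (\<lambda>z. (norm (deriv f z))\<^sup>2)) \<le> sqrt (sqn f / 4)"
      using Littlewood_Paley[OF that] by simp
    thus ?thesis by (simp add: l2_def real_sqrt_divide)
  qed
  have Ca: "sqrt (disc_int (\<lambda>z. (\<kappa> z * norm (f z))\<^sup>2)) \<le> 2 * l2 f" if "f analytic_on cball 0 1" for f
    unfolding \<kappa>_def by (rule Carleson_deriv2[OF an(1,2) that le])
  have l20: "0 \<le> l2 x" "0 \<le> l2 k" by (intro l2_nonneg cont)+
  have J0: "0 \<le> disc_int f" if "continuous_on (cball 0 1) f" "\<And>z. 0 \<le> f z" for f :: "complex \<Rightarrow> real"
    by (rule pos_functional_nonneg[OF pos_functional_disc_int that(1)]) (rule that(2))
  have "disc_int T1 \<le> sqrt (disc_int (\<lambda>z. (\<kappa> z * norm (x z))\<^sup>2)) * sqrt (disc_int (\<lambda>z. (\<kappa> z * norm (k z))\<^sup>2))"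
    unfolding T1_T2_def
    by (rule pos_functional_Cauchy_Schwarz[OF pos_functional_disc_int]) (intro continuous_intros cont cont\<kappa>)+
  also have "\<dots> \<le> (2 * l2 x) * (2 * l2 k)"
    using l20 by (intro mult_mono Ca an k real_sqrt_ge_zero J0 continuous_intros cont cont\<kappa>) auto
  finally have T1: "disc_int T1 \<le> 4 * (l2 x * l2 k)" by simp
  have T2': "disc_int (\<lambda>z. norm (deriv f z) * (\<kappa> z * norm (g z))) \<le> l2 f * l2 g" if fg: "f \<in> {x,k}" "g \<in> {x,k}" for f g
  proof -
    have cfg: "continuous_on (cball 0 1) (deriv f)" "continuous_on (cball 0 1) g" "f analytic_on cball 0 1" "g analytic_on cball 0 1"
      "0 \<le> l2 f" "0 \<le> l2 g"
      using fg cont an k l20 by auto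
    have "disc_int (\<lambda>z. norm (deriv f z) * (\<kappa> z * norm (g z))) \<le>
        sqrt (disc_int (\<lambda>z. (norm (deriv f z))\<^sup>2)) * sqrt (disc_int (\<lambda>z. (\<kappa> z * norm (g z))\<^sup>2))"
      by (rule pos_functional_Cauchy_Schwarz[OF pos_functional_disc_int]) (intro continuous_intros cfg cont\<kappa>)+
    also have "\<dots> \<le> (l2 f / 2) * (2 * l2 g)"
      using cfg by (intro mult_mono LP Ca real_sqrt_ge_zero J0 continuous_intros cfg cont\<kappa>) auto
    finally show ?thesis by simp
  qed
  have "disc_int T2 = disc_int (\<lambda>z. 1 * (norm (deriv x z) * (\<kappa> z * norm (k z))) + 1 * (norm (deriv k z) * (\<kappa> z * norm (x z))))"
    unfolding T1_T2_def by simp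
  also have "\<dots> = 1 * disc_int (\<lambda>z. norm (deriv x z) * (\<kappa> z * norm (k z))) + 1 * disc_int (\<lambda>z. norm (deriv k z) * (\<kappa> z * norm (x z)))"
    by (rule pos_functional_lincomb[OF pos_functional_disc_int]) (intro continuous_intros cont cont\<kappa>)+
  also have "\<dots> \<le> 2 * (l2 x * l2 k)"
    using T2'[of x k] T2'[of k x] by (simp add: mult.commute)
  finally have T2: "disc_int T2 \<le> 2 * (l2 x * l2 k)" .

  have "cmean (\<lambda>z. x z * z * ((cnj (a z) * y z + cnj (b z) * y' z) / D z)) 1 -
     x 0 * 0 * ((cnj (a 0) * y 0 + cnj (b 0) * y' 0) / D 0) = 4 * disc_int p'"
    by (rule Green_disc[OF wF wQ contp contp' contq'])
  hence "norm (cmean (\<lambda>z. x z * z * ((cnj (a z) * y z + cnj (b z) * y' z) / D z)) 1) = 4 * norm (disc_int p')"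
    by (simp add: norm_mult)
  also have "norm (disc_int p') \<le> disc_int (\<lambda>z. norm (p' z))" by (rule disc_int_norm_le[OF contp'])
  also have "\<dots> \<le> disc_int (\<lambda>z. 2 / \<epsilon> ^ 3 * T1 z + 1 / \<epsilon> ^ 3 * T2 z)"
    by (rule pos_functional_mono[OF pos_functional_disc_int _ _ p'_le]) (intro continuous_intros contp' contT)+
  also have "\<dots> = 2 / \<epsilon> ^ 3 * disc_int T1 + 1 / \<epsilon> ^ 3 * disc_int T2"
    by (rule pos_functional_lincomb[OF pos_functional_disc_int contT])
  \<comment> \<open>The constant 40 is \<open>4 * (2 * 4 + 2)\<close>: the 4 of Green's formula, and
    the bounds 4 for \<open>T1\<close> and 2 for \<open>T2\<close> with their weights.\<close>
  also have "\<dots> \<le> 2 / \<epsilon> ^ 3 * (4 * (l2 x * l2 k)) + 1 / \<epsilon> ^ 3 * (2 * (l2 x * l2 k))"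
    using eps by (intro add_mono mult_left_mono T1 T2) auto
  finally show ?thesis by (simp add: k_def)
qed

section \<open>The corona problem for two Blaschke products\<close>

text \<open>Zeros are listed with multiplicity, so that inductions can remove them one at a
  time.\<close>

definition bprod :: "complex list \<Rightarrow> complex \<Rightarrow> complex" where
  "bprod zs z = (\<Prod>a\<leftarrow>zs. blaschke a z)"

lemma bprod_Nil [simp]: "bprod [] z = 1" and bprod_Cons [simp]: "bprod (a # zs) z = blaschke a z * bprod zs z"
  and bprod_append [simp]: "bprod (zs @ ws) z = bprod zs z * bprod ws z"
  by (auto simp: bprod_def)

lemma blaschke_denom_nonzero:
  assumes "norm a < 1" "norm z \<le> 1"
  shows "1 - cnj a * z \<noteq> 0"
proof
  assume "1 - cnj a * z = 0"
  hence "norm (cnj a * z) = 1" by (metis eq_iff_diff_eq_0 norm_one)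
  moreover have "norm (cnj a * z) \<le> norm a * 1"
    unfolding norm_mult complex_mod_cnj using assms by (intro mult_left_mono) auto
  ultimately show False using assms(1) by simp
qed

lemma blaschke_analytic [analytic_intros]: "norm a < 1 \<Longrightarrow> blaschke a analytic_on cball 0 1"
  unfolding blaschke_def[abs_def] using blaschke_denom_nonzero by (intro analytic_intros) auto

lemma bprod_analytic [analytic_intros]: "set zs \<subseteq> ball 0 1 \<Longrightarrow> bprod zs analytic_on cball 0 1"
proof (induction zs)
  case Nil
  thus ?case by (simp add: bprod_def[abs_def])
next
  case (Cons a zs)
  hence "(\<lambda>z. blaschke a z * bprod zs z) analytic_on cball 0 1" by (auto intro!: analytic_intros)
  thus ?case by (simp add: bprod_def[abs_def])
qed

lemma norm_blaschke_circle:
  assumes "norm a < 1" "norm z = 1"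
  shows "norm (blaschke a z) = 1"
proof -
  have "norm (a - z) = norm (cnj (a - z) * z)" using assms by (simp only: norm_mult complex_mod_cnj)
  also have "cnj (a - z) * z = cnj a * z - z * cnj z" by (simp add: algebra_simps)
  also have "z * cnj z = 1" using assms by (simp add: complex_norm_square[symmetric])
  finally have "norm (a - z) = norm (1 - cnj a * z)" by (simp add: norm_minus_commute)
  thus ?thesis using blaschke_denom_nonzero[of a z] assms by (simp add: blaschke_def norm_divide)
qed

lemma norm_blaschke_cball: "norm a < 1 \<Longrightarrow> z \<in> cball 0 1 \<Longrightarrow> norm (blaschke a z) \<le> 1"
  using norm_blaschke_le_1[of a z] norm_blaschke_circle[of a z] by (cases "norm z = 1") auto

lemma norm_bprod_circle: "set zs \<subseteq> ball 0 1 \<Longrightarrow> norm z = 1 \<Longrightarrow> norm (bprod zs z) = 1"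
  by (induction zs) (auto simp: norm_mult norm_blaschke_circle)

lemma norm_bprod_le_1: "set zs \<subseteq> ball 0 1 \<Longrightarrow> z \<in> cball 0 1 \<Longrightarrow> norm (bprod zs z) \<le> 1"
  by (induction zs) (auto simp: norm_mult intro!: mult_le_one norm_blaschke_cball[simplified])

lemma blaschke_eq_0_iff: "norm a < 1 \<Longrightarrow> z \<in> cball 0 1 \<Longrightarrow> blaschke a z = 0 \<longleftrightarrow> z = a"
  using blaschke_denom_nonzero[of a z] by (auto simp: blaschke_def)

lemma bprod_eq_0_iff: "set zs \<subseteq> ball 0 1 \<Longrightarrow> z \<in> cball 0 1 \<Longrightarrow> bprod zs z = 0 \<longleftrightarrow> z \<in> set zs"
  by (induction zs) (auto simp: blaschke_eq_0_iff)

text \<open>The difference quotient is holomorphic across \<open>a\<close>, and \<open>z - a\<close>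
  is the Blaschke factor times \<open>- (1 - cnj a * z)\<close>. The latter has no zero in the
  closed disc but may have one in \<open>S\<close>, hence the restriction
  \<open>norm z \<le> 1\<close>.\<close>

lemma blaschke_divide:
  assumes S: "open S" "a \<in> S" and f: "f holomorphic_on S" "f a = 0" and a: "norm a < 1"
  obtains g where "g holomorphic_on S" "\<And>z. z \<in> S \<Longrightarrow> norm z \<le> 1 \<Longrightarrow> f z = blaschke a z * g z"
proof
  let ?q = "\<lambda>z. if z = a then deriv f a else (f z - f a) / (z - a)"
  have "?q holomorphic_on S"
    using f S by (intro pole_lemma_open)
  thus "(\<lambda>z. - (1 - cnj a * z) * ?q z) holomorphic_on S"
    by (intro holomorphic_intros)
  show "f z = blaschke a z * (- (1 - cnj a * z) * ?q z)" if "z \<in> S" "norm z \<le> 1" for z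
  proof (cases "z = a")
    case False
    have "blaschke a z * (- (1 - cnj a * z) * q) = (z - a) * q" for q
      using blaschke_denom_nonzero[OF a that(2)] by (simp add: blaschke_def field_simps)
    from this[of "f z / (z - a)"] show ?thesis using False f(2) by simp
  qed (use f(2) in \<open>simp add: blaschke_def\<close>)
qed

lemma blaschke_divide_analytic:
  assumes f: "f analytic_on cball 0 1" "f a = 0" and a: "norm a < 1"
  obtains g where "g analytic_on cball 0 1" "\<And>z. z \<in> cball 0 1 \<Longrightarrow> f z = blaschke a z * g z"
proof -
  obtain S where S: "open S" "cball 0 1 \<subseteq> S" "f holomorphic_on S"
    using f(1) unfolding analytic_on_holomorphic by blast
  obtain g where g: "g holomorphic_on S" "\<And>z. z \<in> S \<Longrightarrow> norm z \<le> 1 \<Longrightarrow> f z = blaschke a z * g z"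
    using blaschke_divide[OF S(1) _ S(3) f(2) a] S(2) a by (metis dist_0_norm less_imp_le mem_cball subsetD)
  have "g analytic_on cball 0 1" using g(1) S(1,2) unfolding analytic_on_holomorphic by blast
  with g(2) S(2) show ?thesis by (intro that) auto
qed

text \<open>For a single zero \<open>c\<close> the function \<open>1 - b z / b c\<close> vanishes at
  \<open>c\<close>, so it is divisible by the Blaschke factor; multiplying such identities treats
  all zeros. The solution carries no bound and serves where size does not matter.\<close>

lemma bprod_bezout:
  assumes "set zs \<subseteq> ball 0 1" and b: "b analytic_on cball 0 1" and "\<And>c. c \<in> set zs \<Longrightarrow> b c \<noteq> 0"
  shows "\<exists>\<alpha> \<beta>. \<alpha> analytic_on cball 0 1 \<and> \<beta> analytic_on cball 0 1 \<and>
     (\<forall>z\<in>cball 0 1. bprod zs z * \<alpha> z + b z * \<beta> z = 1)"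
  using assms(1,3)
proof (induction zs)
  case Nil
  show ?case by (rule exI[of _ "\<lambda>_. 1"], rule exI[of _ "\<lambda>_. 0"]) auto
next
  case (Cons c zs)
  then obtain \<alpha> \<beta> where ab: "\<alpha> analytic_on cball 0 1" "\<beta> analytic_on cball 0 1"
     "\<And>z. z \<in> cball 0 1 \<Longrightarrow> bprod zs z * \<alpha> z + b z * \<beta> z = 1" by auto
  have c: "norm c < 1" "b c \<noteq> 0" using Cons.prems by auto
  have "(\<lambda>z. 1 - b z / b c) analytic_on cball 0 1" using c by (intro analytic_intros b) auto
  then obtain g where g: "g analytic_on cball 0 1" "\<And>z. z \<in> cball 0 1 \<Longrightarrow> 1 - b z / b c = blaschke c z * g z"
    using blaschke_divide_analytic[of "\<lambda>z. 1 - b z / b c" c] c by auto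
  show ?case
  proof (intro exI conjI ballI)
    show "(\<lambda>z. \<alpha> z * g z) analytic_on cball 0 1" by (intro analytic_intros ab g)
    show "(\<lambda>z. \<beta> z + (1 / b c) * (bprod zs z * \<alpha> z)) analytic_on cball 0 1"
      using Cons.prems by (intro analytic_intros ab g) auto
    fix z :: complex assume z: "z \<in> cball 0 1"
    have 1: "blaschke c z * g z + b z * (1 / b c) = 1" by (simp add: g(2)[OF z, symmetric])
    have "bprod (c # zs) z * (\<alpha> z * g z) + b z * (\<beta> z + (1 / b c) * (bprod zs z * \<alpha> z)) =
        (bprod zs z * \<alpha> z) * (blaschke c z * g z + b z * (1 / b c)) + b z * \<beta> z"
      by (simp add: algebra_simps)
    thus "bprod (c # zs) z * (\<alpha> z * g z) + b z * (\<beta> z + (1 / b c) * (bprod zs z * \<alpha> z)) = 1"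
      using ab(3)[OF z] by (simp only: 1 mult_1_right)
  qed
qed

text \<open>Here \<open>X\<close> is the image of \<open>x\<close> under the adjoint of multiplication by \<open>bprod zs\<close> on \<open>H\<^sup>2\<close>.\<close>

lemma bprod_adjoint:
  assumes "set zs \<subseteq> ball 0 1" and x: "x analytic_on cball 0 1"
  shows "\<exists>X y. X analytic_on cball 0 1 \<and> y analytic_on cball 0 1 \<and>
     (\<forall>z. norm z = 1 \<longrightarrow> cnj (bprod zs z) * x z = X z + cnj (z * y z))"
  using assms(1)
proof (induction zs)
  case Nil
  show ?case using x by (intro exI[of _ x] exI[of _ "\<lambda>_. 0"]) auto
next
  case (Cons c zs)
  then obtain X y where Xy: "X analytic_on cball 0 1" "y analytic_on cball 0 1"
    "\<And>z. norm z = 1 \<Longrightarrow> cnj (bprod zs z) * x z = X z + cnj (z * y z)" by auto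
  have c: "norm c < 1" using Cons.prems by auto
  have dc: "1 - cnj c * c \<noteq> 0" using blaschke_denom_nonzero[of c c] c by simp
  \<comment> \<open>\<open>C / (1 - cnj c * z)\<close> is the multiple of the reproducing kernel at
    \<open>c\<close> that agrees with \<open>X\<close> there. The adjoint of the Blaschke factor
    annihilates it, and the rest of \<open>X\<close> is divisible by that factor.\<close>
  define C where "C = X c * (1 - cnj c * c)"
  have an: "(\<lambda>z. C / (1 - cnj c * z)) analytic_on cball 0 1"
     "(\<lambda>z. - cnj C / (1 - cnj c * z)) analytic_on cball 0 1"
    using blaschke_denom_nonzero[OF c] by (intro analytic_intros; simp)+
  have "(\<lambda>z. X z - C / (1 - cnj c * z)) analytic_on cball 0 1" by (intro analytic_intros Xy an)
  then obtain X2 where X2: "X2 analytic_on cball 0 1"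
     "\<And>z. z \<in> cball 0 1 \<Longrightarrow> X z - C / (1 - cnj c * z) = blaschke c z * X2 z"
    using blaschke_divide_analytic[of "\<lambda>z. X z - C / (1 - cnj c * z)" c] c dc by (auto simp: C_def)
  show ?case
  proof (intro exI conjI allI impI)
    show "X2 analytic_on cball 0 1" by fact
    show "(\<lambda>z. - cnj C / (1 - cnj c * z) + blaschke c z * y z) analytic_on cball 0 1"
      by (intro analytic_intros Xy an c)
    fix z :: complex assume z: "norm z = 1"
    have zz: "cnj z * z = 1" using z by (simp add: complex_norm_square[symmetric] mult.commute)
    have bb: "cnj (blaschke c z) * blaschke c z = 1"
      using norm_blaschke_circle[OF c z] by (simp add: complex_norm_square[symmetric] mult.commute)
    have d: "1 - cnj c * z \<noteq> 0" using blaschke_denom_nonzero[OF c] z by simp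
    \<comment> \<open>On the circle \<open>cnj c - cnj z\<close> equals
      \<open>- (1 - cnj c * z) * cnj z\<close>, so the denominator of the kernel cancels and an
      antianalytic function of mean 0 is left.\<close>
    have "cnj (blaschke c z) * (C / (1 - cnj c * z)) = cnj (z * (- cnj C / (1 - cnj c * z)))"
    proof -
      have aux: "- d * w / e * (C / d) = w * (- C / e)" if "d \<noteq> 0" for d w e :: complex
        using that by simp
      have "- (1 - cnj c * z) * cnj z = cnj c * (cnj z * z) - cnj z" by (simp add: algebra_simps)
      hence *: "cnj c - cnj z = - (1 - cnj c * z) * cnj z" using zz by simp
      have "cnj (blaschke c z) = (cnj c - cnj z) / (1 - c * cnj z)"
        by (simp add: blaschke_def)
      also have "\<dots> = - (1 - cnj c * z) * cnj z / (1 - c * cnj z)" by (subst *) simp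
      finally have "cnj (blaschke c z) * (C / (1 - cnj c * z)) =
          - (1 - cnj c * z) * cnj z / (1 - c * cnj z) * (C / (1 - cnj c * z))" by (simp only:)
      also have "\<dots> = cnj z * (- C / (1 - c * cnj z))" using d by (rule aux)
      finally show ?thesis by simp
    qed
    moreover have "cnj (blaschke c z) * X z = X2 z + cnj (blaschke c z) * (C / (1 - cnj c * z))"
    proof -
      have "X z = blaschke c z * X2 z + C / (1 - cnj c * z)" using X2(2)[of z] z by (simp add: algebra_simps)
      hence "cnj (blaschke c z) * X z = (cnj (blaschke c z) * blaschke c z) * X2 z + cnj (blaschke c z) * (C / (1 - cnj c * z))"
        by (simp add: algebra_simps)
      thus ?thesis by (simp add: bb)
    qed
    moreover have "cnj (bprod (c # zs) z) * x z = cnj (blaschke c z) * (X z + cnj (z * y z))"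
      using Xy(3)[OF z] by simp
    ultimately show "cnj (bprod (c # zs) z) * x z = X2 z + cnj (z * (- cnj C / (1 - cnj c * z) + blaschke c z * y z))"
      by (simp add: algebra_simps)
  qed
qed

lemma cmean_complex_of_real:
  assumes "continuous_on (cball 0 1) F"
  shows "cmean (\<lambda>z. complex_of_real (F z)) 1 = of_real (cmean F 1)"
  by (rule cmean_linear[OF bounded_linear_of_real assms]) simp

lemma cmean_self:
  assumes "continuous_on (cball 0 1) u"
  shows "cmean (\<lambda>z. u z * cnj (u z)) 1 = of_real (sqn u)"
  unfolding sqn_def complex_norm_square[symmetric]
  by (intro cmean_complex_of_real continuous_intros assms)

text \<open>The remainder \<open>cnj (z * y z)\<close> is orthogonal to \<open>X\<close>, because
  \<open>z * (y z * X z)\<close> has mean 0. The Cauchy-Schwarz inequality then makes the adjoint a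
  contraction, multiplication by a Blaschke product being isometric.\<close>

lemma l2_adjoint:
  assumes zs: "set zs \<subseteq> ball 0 1" and an: "x analytic_on cball 0 1" "X analytic_on cball 0 1" "y analytic_on cball 0 1"
    and eq: "\<And>z. norm z = 1 \<Longrightarrow> cnj (bprod zs z) * x z = X z + cnj (z * y z)"
  shows "cmean (\<lambda>z. x z * cnj (bprod zs z * X z)) 1 = of_real (sqn X)" and "l2 X \<le> l2 x"
proof -
  note cont = an[THEN continuous_on_analytic] bprod_analytic[OF zs, THEN continuous_on_analytic]
  have "cmean (\<lambda>z. x z * cnj (bprod zs z * X z)) 1 = cmean (\<lambda>z. X z * cnj (X z) + cnj (z * (y z * X z))) 1"
  proof (rule cmean_circle_cong)
    fix z :: complex assume "norm z = 1"
    have "x z * cnj (bprod zs z * X z) = (cnj (bprod zs z) * x z) * cnj (X z)" by simp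
    also have "\<dots> = (X z + cnj (z * y z)) * cnj (X z)" using eq[OF \<open>norm z = 1\<close>] by simp
    finally show "x z * cnj (bprod zs z * X z) = X z * cnj (X z) + cnj (z * (y z * X z))"
      by (simp add: algebra_simps)
  qed
  also have "\<dots> = of_real (sqn X) + cmean (\<lambda>z. cnj (z * (y z * X z))) 1"
    by (subst cmean_add) (intro continuous_intros cont | simp add: cmean_self cont)+
  also have "cmean (\<lambda>z. cnj (z * (y z * X z))) 1 = cnj (cmean (\<lambda>z. z * (y z * X z)) 1)"
    by (rule cmean_linear[OF bounded_linear_cnj]) (intro continuous_intros cont | simp)+
  also have "cmean (\<lambda>z. z * (y z * X z)) 1 = 0"
    by (subst cmean_analytic) (intro analytic_intros an | simp)+
  finally show *: "cmean (\<lambda>z. x z * cnj (bprod zs z * X z)) 1 = of_real (sqn X)" by simp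
  have "(l2 X)\<^sup>2 = norm (cmean (\<lambda>z. x z * cnj (bprod zs z * X z)) 1)"
    unfolding * norm_of_real using l2_power2[OF cont(2)] sqn_nonneg[OF cont(2)] by simp
  also have "\<dots> \<le> l2 x * l2 (\<lambda>z. cnj (bprod zs z * X z))"
    by (intro norm_cmean_mult_le continuous_intros cont)
  also have "l2 (\<lambda>z. cnj (bprod zs z * X z)) = l2 X"
    by (intro l2_cong) (simp add: norm_mult norm_bprod_circle[OF zs])
  finally have "l2 X * l2 X \<le> l2 x * l2 X" by (simp add: power2_eq_square)
  thus "l2 X \<le> l2 x"
    using l2_nonneg[OF cont(1)] l2_nonneg[OF cont(2)] by (cases "l2 X = 0") (auto simp: mult_le_cancel_right)
qed

text \<open>With \<open>a\<close>, \<open>b\<close> the Blaschke products and \<open>X\<close>, \<open>Y\<close> the images of \<open>x\<close> under the adjoints of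
  multiplication by them, the choice is \<open>f = X / 2\<close> and \<open>g = Y / 2\<close>. The Wolff estimate bounds
  \<open>\<parallel>X\<parallel> + \<parallel>Y\<parallel>\<close> from below by a multiple of \<open>\<parallel>x\<parallel>\<close>.\<close>

lemma corona_step:
  assumes zs: "set zs \<subseteq> ball 0 1" and ws: "set ws \<subseteq> ball 0 1" and x: "x analytic_on cball 0 1"
    and eps: "0 < \<epsilon>" "\<epsilon> \<le> 1" "\<And>z. z \<in> ball 0 1 \<Longrightarrow> \<epsilon> \<le> (norm (bprod zs z))\<^sup>2 + (norm (bprod ws z))\<^sup>2"
  obtains f g where "f analytic_on cball 0 1" "g analytic_on cball 0 1" "l2 g \<le> l2 x"
    "l2 (\<lambda>z. x z - (bprod zs z * f z + bprod ws z * g z)) \<le> sqrt (1 - 1 / (4 * (1 + 40 / \<epsilon> ^ 3)\<^sup>2)) * l2 x"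
proof -
  define a b where "a = bprod zs" "b = bprod ws"
  have an: "a analytic_on cball 0 1" "b analytic_on cball 0 1" using zs ws by (auto simp: a_b_def intro: analytic_intros)
  obtain X y where Xy: "X analytic_on cball 0 1" "y analytic_on cball 0 1"
    "\<And>z. norm z = 1 \<Longrightarrow> cnj (a z) * x z = X z + cnj (z * y z)"
    using bprod_adjoint[OF zs x] unfolding a_b_def by blast
  obtain Y y' where Yy: "Y analytic_on cball 0 1" "y' analytic_on cball 0 1"
    "\<And>z. norm z = 1 \<Longrightarrow> cnj (b z) * x z = Y z + cnj (z * y' z)"
    using bprod_adjoint[OF ws x] unfolding a_b_def by blast
  have adX: "cmean (\<lambda>z. x z * cnj (a z * X z)) 1 = of_real (sqn X)" "l2 X \<le> l2 x"
    using l2_adjoint[OF zs x Xy(1,2)] Xy(3) unfolding a_b_def by auto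
  have adY: "cmean (\<lambda>z. x z * cnj (b z * Y z)) 1 = of_real (sqn Y)" "l2 Y \<le> l2 x"
    using l2_adjoint[OF ws x Yy(1,2)] Yy(3) unfolding a_b_def by auto
  note cont = an[THEN continuous_on_analytic] Xy(1,2)[THEN continuous_on_analytic] Yy(1,2)[THEN continuous_on_analytic]
     x[THEN continuous_on_analytic]
  have norm1: "norm (a z) = 1" "norm (b z) = 1" if "norm z = 1" for z
    using that zs ws by (auto simp: a_b_def norm_bprod_circle)
  have aa: "a z * cnj (a z) = 1" "b z * cnj (b z) = 1" if "norm z = 1" for z
    using norm1[OF that] by (simp_all add: complex_norm_square[symmetric])
  define D where "D = (\<lambda>z. a z * cnj (a z) + b z * cnj (b z))"
  define k where "k = (\<lambda>z. z * (a z * y' z - b z * y z))"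
  define K where "K = 40 / \<epsilon> ^ 3"
  have K: "0 < K" using eps by (simp add: K_def)
  have l20: "0 \<le> l2 x" "0 \<le> l2 X" "0 \<le> l2 Y" by (intro l2_nonneg cont)+
  have eps': "\<epsilon> \<le> (norm (a z))\<^sup>2 + (norm (b z))\<^sup>2" if "z \<in> cball 0 1" for z
    using that eps(2,3) norm1[of z] by (cases "norm z = 1") (auto simp: a_b_def)
  have W: "norm (cmean (\<lambda>z. x z * z * ((cnj (a z) * y z + cnj (b z) * y' z) / D z)) 1) \<le> K * (l2 x * l2 k)"
    unfolding K_def k_def D_def
    by (rule Wolff_estimate[OF an x Xy(2) Yy(2) _ _ eps(1,2) eps'])
       (auto simp: a_b_def zs ws norm_bprod_le_1[simplified])
  \<comment> \<open>On the circle \<open>x\<close> cancels in \<open>a * y' - b * y\<close>, so the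
    right side of the Wolff estimate is controlled by \<open>X\<close> and \<open>Y\<close>.\<close>
  have "l2 k = l2 (\<lambda>z. b z * cnj (X z) + a z * cnj (- Y z))"
  proof (intro l2_cong arg_cong[of _ _ norm])
    fix z :: complex assume z: "norm z = 1"
    have 1: "z * y z = a z * cnj (x z) - cnj (X z)" using arg_cong[OF Xy(3)[OF z], of cnj] by simp
    have 2: "z * y' z = b z * cnj (x z) - cnj (Y z)" using arg_cong[OF Yy(3)[OF z], of cnj] by simp
    have "k z = a z * (z * y' z) - b z * (z * y z)" by (simp add: k_def algebra_simps)
    thus "k z = b z * cnj (X z) + a z * cnj (- Y z)" unfolding 1 2 by (simp add: algebra_simps)
  qed
  also have "\<dots> \<le> l2 (\<lambda>z. b z * cnj (X z)) + l2 (\<lambda>z. a z * cnj (- Y z))"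
    by (intro l2_triangle continuous_intros cont)
  also have "l2 (\<lambda>z. b z * cnj (X z)) = l2 X" by (intro l2_cong) (simp add: norm_mult norm1)
  also have "l2 (\<lambda>z. a z * cnj (- Y z)) = l2 Y" by (intro l2_cong) (simp add: norm_mult norm1)
  finally have k_le: "l2 k \<le> l2 X + l2 Y" .
  \<comment> \<open>Since \<open>D = 2\<close> on the circle, this mean is
    \<open>sqn x - (sqn X + sqn Y) / 2\<close>; the Wolff estimate thus compares the norm of
    \<open>x\<close> with those of \<open>X\<close> and \<open>Y\<close>.\<close>
  have "cmean (\<lambda>z. x z * z * ((cnj (a z) * y z + cnj (b z) * y' z) / D z)) 1
      = cmean (\<lambda>z. x z * cnj (x z) + ((- 1 / 2) * (x z * cnj (a z * X z)) + (- 1 / 2) * (x z * cnj (b z * Y z)))) 1"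
  proof (intro cmean_circle_cong)
    fix z :: complex assume z: "norm z = 1"
    have 1: "z * y z = a z * cnj (x z) - cnj (X z)" using arg_cong[OF Xy(3)[OF z], of cnj] by simp
    have 2: "z * y' z = b z * cnj (x z) - cnj (Y z)" using arg_cong[OF Yy(3)[OF z], of cnj] by simp
    have D: "D z = 2" using aa[OF z] by (simp add: D_def)
    have "x z * z * ((cnj (a z) * y z + cnj (b z) * y' z) / D z) =
        x z * (cnj (a z) * (z * y z) + cnj (b z) * (z * y' z)) / 2"
      by (simp add: D algebra_simps)
    also have "\<dots> = x z * ((a z * cnj (a z)) * cnj (x z) + (b z * cnj (b z)) * cnj (x z) - cnj (a z) * cnj (X z) - cnj (b z) * cnj (Y z)) / 2"
      unfolding 1 2 by (simp add: algebra_simps)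
    finally show "x z * z * ((cnj (a z) * y z + cnj (b z) * y' z) / D z) =
       x z * cnj (x z) + ((- 1 / 2) * (x z * cnj (a z * X z)) + (- 1 / 2) * (x z * cnj (b z * Y z)))"
      unfolding aa[OF z] by (simp add: field_simps)
  qed
  also have "\<dots> = cmean (\<lambda>z. x z * cnj (x z)) 1 +
      (cmean (\<lambda>z. (- 1 / 2) * (x z * cnj (a z * X z))) 1 + cmean (\<lambda>z. (- 1 / 2) * (x z * cnj (b z * Y z))) 1)"
    by (subst cmean_add, intro continuous_intros cont, intro continuous_intros cont, simp,
        subst cmean_add, intro continuous_intros cont, intro continuous_intros cont, simp, rule refl)
  also have "\<dots> = of_real (sqn x - (sqn X + sqn Y) / 2)"
    unfolding cmean_cmul adX adY cmean_self[OF cont(7)] by (simp add: field_simps)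
  finally have "\<bar>sqn x - (sqn X + sqn Y) / 2\<bar> \<le> K * (l2 x * l2 k)" using W by (simp only: norm_of_real)
  also have "\<dots> \<le> K * (l2 x * (l2 X + l2 Y))"
    using K l20 k_le by (intro mult_left_mono) auto
  finally have 1: "(l2 x)\<^sup>2 \<le> ((l2 X)\<^sup>2 + (l2 Y)\<^sup>2) / 2 + K * (l2 x * (l2 X + l2 Y))"
    by (simp add: l2_power2 cont)
  have "(l2 X)\<^sup>2 \<le> l2 x * l2 X" "(l2 Y)\<^sup>2 \<le> l2 x * l2 Y"
    using adX(2) adY(2) l20 by (auto simp: power2_eq_square intro: mult_right_mono)
  hence 2: "((l2 X)\<^sup>2 + (l2 Y)\<^sup>2) / 2 \<le> l2 x * (l2 X + l2 Y)"
    using mult_nonneg_nonneg[OF l20(1,2)] mult_nonneg_nonneg[OF l20(1,3)] by (simp add: algebra_simps)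
  have "(l2 x)\<^sup>2 \<le> l2 x * (l2 X + l2 Y) + K * (l2 x * (l2 X + l2 Y))" using 1 2 by linarith
  hence "l2 x * l2 x \<le> l2 x * ((1 + K) * (l2 X + l2 Y))" by (simp add: algebra_simps power2_eq_square)
  hence x_le: "l2 x \<le> (1 + K) * (l2 X + l2 Y)"
    using l20 K by (cases "l2 x = 0") (auto simp: mult_le_cancel_left)
  hence "(l2 x)\<^sup>2 \<le> (1 + K)\<^sup>2 * (l2 X + l2 Y)\<^sup>2"
    using l20 by (metis power_mono power_mult_distrib)
  also have "\<dots> \<le> (1 + K)\<^sup>2 * (2 * ((l2 X)\<^sup>2 + (l2 Y)\<^sup>2))"
  proof (rule mult_left_mono)
    show "(l2 X + l2 Y)\<^sup>2 \<le> 2 * ((l2 X)\<^sup>2 + (l2 Y)\<^sup>2)"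
      using sum_squares_bound[of "l2 X" "l2 Y"] by (simp add: power2_sum)
  qed simp
  finally have XY: "(l2 x)\<^sup>2 / (4 * (1 + K)\<^sup>2) \<le> ((l2 X)\<^sup>2 + (l2 Y)\<^sup>2) / 2"
    using K by (simp add: field_simps)

  define f g where "f = (\<lambda>z. (1 / 2) * X z)" "g = (\<lambda>z. (1 / 2) * Y z)"
  have fg: "f analytic_on cball 0 1" "g analytic_on cball 0 1"
    unfolding f_g_def by (intro analytic_intros Xy Yy)+
  note cfg = fg[THEN continuous_on_analytic]
  have "sqn (\<lambda>z. x z - (a z * f z + b z * g z)) \<le> cmean (\<lambda>z. (norm (x z))\<^sup>2 +
      (((1 / 2) * (norm (a z * X z))\<^sup>2 + (1 / 2) * (norm (b z * Y z))\<^sup>2) +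
      ((- 1) * Re (x z * cnj (a z * X z)) + (- 1) * Re (x z * cnj (b z * Y z))))) 1"
    unfolding sqn_def
  proof (rule pos_functional_mono[OF pos_functional_cmean])
    \<comment> \<open>Convexity of the square: the right side is the average of the squared
      distances from \<open>p\<close> to \<open>u\<close> and to \<open>v\<close>.\<close>
    have aux: "(norm (p - (u + v) / 2))\<^sup>2 \<le> (norm p)\<^sup>2 + (((1 / 2) * (norm u)\<^sup>2 + (1 / 2) * (norm v)\<^sup>2) +
        ((- 1) * Re (p * cnj u) + (- 1) * Re (p * cnj v)))" for p u v :: complex
    proof -
      have "(norm p)\<^sup>2 + (((1 / 2) * (norm u)\<^sup>2 + (1 / 2) * (norm v)\<^sup>2) +
        ((- 1) * Re (p * cnj u) + (- 1) * Re (p * cnj v))) - (norm (p - (u + v) / 2))\<^sup>2 = (norm ((u - v) / 2))\<^sup>2"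
        unfolding cmod_power2 by (simp add: field_simps power2_eq_square)
      thus ?thesis using zero_le_power2[of "norm ((u - v) / 2)"] by linarith
    qed
    fix z :: complex
    have eq: "a z * f z + b z * g z = (a z * X z + b z * Y z) / 2" by (simp add: f_g_def field_simps)
    show "(norm (x z - (a z * f z + b z * g z)))\<^sup>2 \<le> (norm (x z))\<^sup>2 +
      (((1 / 2) * (norm (a z * X z))\<^sup>2 + (1 / 2) * (norm (b z * Y z))\<^sup>2) +
      ((- 1) * Re (x z * cnj (a z * X z)) + (- 1) * Re (x z * cnj (b z * Y z))))"
      unfolding eq by (rule aux)
  qed (intro continuous_intros cont cfg)+
  also have "\<dots> = sqn x + ((1 / 2) * sqn (\<lambda>z. a z * X z) + (1 / 2) * sqn (\<lambda>z. b z * Y z) +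
      ((- 1) * cmean (\<lambda>z. Re (x z * cnj (a z * X z))) 1 + (- 1) * cmean (\<lambda>z. Re (x z * cnj (b z * Y z))) 1))"
  proof -
    note add = pos_functional_add[OF pos_functional_cmean] and lincomb = pos_functional_lincomb[OF pos_functional_cmean]
    have 1: "cmean (\<lambda>z. (1 / 2) * (norm (a z * X z))\<^sup>2 + (1 / 2) * (norm (b z * Y z))\<^sup>2) 1 =
        (1 / 2) * sqn (\<lambda>z. a z * X z) + (1 / 2) * sqn (\<lambda>z. b z * Y z)"
      unfolding sqn_def by (rule lincomb) (intro continuous_intros cont)+
    have 2: "cmean (\<lambda>z. (- 1) * Re (x z * cnj (a z * X z)) + (- 1) * Re (x z * cnj (b z * Y z))) 1 =
        (- 1) * cmean (\<lambda>z. Re (x z * cnj (a z * X z))) 1 + (- 1) * cmean (\<lambda>z. Re (x z * cnj (b z * Y z))) 1"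
      by (rule lincomb) (intro continuous_intros cont)+
    show ?thesis
      unfolding sqn_def[of x] 1[symmetric] 2[symmetric]
      by (rule trans[OF add arg_cong2[of _ _ _ _ "(+)", OF refl add]]) (intro continuous_intros cont)+
  qed
  also have "cmean (\<lambda>z. Re (x z * cnj (a z * X z))) 1 = Re (cmean (\<lambda>z. x z * cnj (a z * X z)) 1)"
    by (rule cmean_linear[OF bounded_linear_Re]) (intro continuous_intros cont | simp)+
  also have "cmean (\<lambda>z. Re (x z * cnj (b z * Y z))) 1 = Re (cmean (\<lambda>z. x z * cnj (b z * Y z)) 1)"
    by (rule cmean_linear[OF bounded_linear_Re]) (intro continuous_intros cont | simp)+
  also have "sqn (\<lambda>z. a z * X z) = sqn X" by (intro sqn_cong) (simp add: norm_mult norm1)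
  also have "sqn (\<lambda>z. b z * Y z) = sqn Y" by (intro sqn_cong) (simp add: norm_mult norm1)
  \<comment> \<open>The adjoint relations turn the real parts into \<open>sqn X\<close> and
    \<open>sqn Y\<close>, which is twice what the half squares add; half of it remains as
    gain.\<close>
  finally have "sqn (\<lambda>z. x z - (a z * f z + b z * g z)) \<le> (l2 x)\<^sup>2 - ((l2 X)\<^sup>2 + (l2 Y)\<^sup>2) / 2"
    unfolding adX adY by (simp add: l2_power2 cont field_simps)
  also have "\<dots> \<le> (1 - 1 / (4 * (1 + K)\<^sup>2)) * (l2 x)\<^sup>2" using XY by (simp add: algebra_simps)
  finally have "l2 (\<lambda>z. x z - (a z * f z + b z * g z)) \<le> sqrt ((1 - 1 / (4 * (1 + K)\<^sup>2)) * (l2 x)\<^sup>2)"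
    unfolding l2_def[of "\<lambda>z. x z - (a z * f z + b z * g z)"] by (rule real_sqrt_le_mono)
  also have "\<dots> = sqrt (1 - 1 / (4 * (1 + K)\<^sup>2)) * l2 x" using l20 by (simp add: real_sqrt_mult)
  finally have "l2 (\<lambda>z. x z - (a z * f z + b z * g z)) \<le> sqrt (1 - 1 / (4 * (1 + K)\<^sup>2)) * l2 x" .
  moreover have "l2 g \<le> l2 x" using adY(2) l20 unfolding f_g_def l2_cmul by simp
  ultimately show ?thesis using fg that unfolding a_b_def K_def by blast
qed

text \<open>\<open>corona_step\<close> is iterated on the residual, which decays geometrically, so
  the functions \<open>g\<close> add up to at most \<open>1 / (1 - \<gamma>)\<close> times the norm
  of \<open>x\<close>. Instead of a passage to the limit, the iteration stops and the uncontrolled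
  Bezout solution absorbs the residual, at the cost of one more norm of \<open>x\<close>. A bound on
  \<open>g\<close> alone is what the action of the idempotents requires.\<close>

lemma H2_corona:
  assumes eps: "0 < \<epsilon>" "\<epsilon> \<le> 1"
  obtains C where "0 < C" "\<And>zs ws x. set zs \<subseteq> ball 0 1 \<Longrightarrow> set ws \<subseteq> ball 0 1 \<Longrightarrow> x analytic_on cball 0 1 \<Longrightarrow>
    (\<And>z. z \<in> ball 0 1 \<Longrightarrow> \<epsilon> \<le> (norm (bprod zs z))\<^sup>2 + (norm (bprod ws z))\<^sup>2) \<Longrightarrow>
    \<exists>f g. f analytic_on cball 0 1 \<and> g analytic_on cball 0 1 \<and> l2 g \<le> C * l2 x \<and>
      (\<forall>z\<in>cball 0 1. x z = bprod zs z * f z + bprod ws z * g z)"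
proof -
  define \<gamma> where "\<gamma> = sqrt (1 - 1 / (4 * (1 + 40 / \<epsilon> ^ 3)\<^sup>2))"
  have K: "1 \<le> 1 + 40 / \<epsilon> ^ 3" using eps by simp
  define q where "q = (1 + 40 / \<epsilon> ^ 3)\<^sup>2"
  have "1 \<le> q" using K unfolding q_def by (rule one_le_power)
  hence "0 < 1 / (4 * q)" "1 / (4 * q) \<le> 1" by (auto simp: divide_le_eq)
  hence \<gamma>: "0 \<le> \<gamma>" "\<gamma> < 1" unfolding \<gamma>_def q_def[symmetric] by auto
  show ?thesis
  proof (rule that)
    show "0 < 1 / (1 - \<gamma>) + 1" using \<gamma> by (intro add_pos_pos) auto
    fix zs ws :: "complex list" and x
    assume zs: "set zs \<subseteq> ball 0 1" and ws: "set ws \<subseteq> ball 0 1" and x: "x analytic_on cball 0 1"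
     and sep: "\<And>z. z \<in> ball 0 1 \<Longrightarrow> \<epsilon> \<le> (norm (bprod zs z))\<^sup>2 + (norm (bprod ws z))\<^sup>2"
    define a b where "a = bprod zs" "b = bprod ws"
    have an: "a analytic_on cball 0 1" "b analytic_on cball 0 1" using zs ws by (auto simp: a_b_def intro: analytic_intros)
    have l2x: "0 \<le> l2 x" by (intro l2_nonneg continuous_on_analytic x)
    have iter: "\<exists>f g. f analytic_on cball 0 1 \<and> g analytic_on cball 0 1 \<and> l2 g \<le> (\<Sum>i<n. \<gamma> ^ i) * l2 x \<and>
       l2 (\<lambda>z. x z - (a z * f z + b z * g z)) \<le> \<gamma> ^ n * l2 x" for n
    proof (induction n)
      case 0
      show ?case by (rule exI[of _ "\<lambda>_. 0"], rule exI[of _ "\<lambda>_. 0"]) (auto simp: l2_def sqn_def cmean_def)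
    next
      case (Suc n)
      then obtain f g where fg: "f analytic_on cball 0 1" "g analytic_on cball 0 1" "l2 g \<le> (\<Sum>i<n. \<gamma> ^ i) * l2 x"
        "l2 (\<lambda>z. x z - (a z * f z + b z * g z)) \<le> \<gamma> ^ n * l2 x" by blast
      define r where "r = (\<lambda>z. x z - (a z * f z + b z * g z))"
      have r: "r analytic_on cball 0 1" unfolding r_def by (intro analytic_intros x an fg)
      obtain f' g' where fg': "f' analytic_on cball 0 1" "g' analytic_on cball 0 1" "l2 g' \<le> l2 r"
         "l2 (\<lambda>z. r z - (a z * f' z + b z * g' z)) \<le> \<gamma> * l2 r"
        using corona_step[OF zs ws r eps sep] unfolding a_b_def \<gamma>_def by blast
      show ?case
      proof (intro exI conjI)
        show "(\<lambda>z. f z + f' z) analytic_on cball 0 1" "(\<lambda>z. g z + g' z) analytic_on cball 0 1"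
          by (intro analytic_intros fg fg')+
        have "l2 (\<lambda>z. g z + g' z) \<le> l2 g + l2 g'" by (intro l2_triangle continuous_on_analytic fg fg')
        also have "\<dots> \<le> (\<Sum>i<n. \<gamma> ^ i) * l2 x + \<gamma> ^ n * l2 x" using fg fg' by (simp add: r_def)
        finally show "l2 (\<lambda>z. g z + g' z) \<le> (\<Sum>i<Suc n. \<gamma> ^ i) * l2 x" by (simp add: algebra_simps)
        have "(\<lambda>z. x z - (a z * (f z + f' z) + b z * (g z + g' z))) = (\<lambda>z. r z - (a z * f' z + b z * g' z))"
          by (auto simp: r_def algebra_simps)
        hence "l2 (\<lambda>z. x z - (a z * (f z + f' z) + b z * (g z + g' z))) \<le> \<gamma> * l2 r" using fg' by simp
        also have "\<dots> \<le> \<gamma> * (\<gamma> ^ n * l2 x)" using fg \<gamma> by (intro mult_left_mono) (auto simp: r_def)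
        finally show "l2 (\<lambda>z. x z - (a z * (f z + f' z) + b z * (g z + g' z))) \<le> \<gamma> ^ Suc n * l2 x" by (simp add: mult_ac)
      qed
    qed
    have "b c \<noteq> 0" if c: "c \<in> set zs" for c
    proof -
      have "bprod zs c = 0" using bprod_eq_0_iff[OF zs, of c] c zs by auto
      with sep[of c] c zs eps show ?thesis by (auto simp: a_b_def)
    qed
    then obtain \<alpha> \<beta> where ab: "\<alpha> analytic_on cball 0 1" "\<beta> analytic_on cball 0 1"
      "\<And>z. z \<in> cball 0 1 \<Longrightarrow> a z * \<alpha> z + b z * \<beta> z = 1"
      using bprod_bezout[OF zs an(2)] unfolding a_b_def by blast
    have "compact (\<beta> ` cball 0 1)" by (intro compact_continuous_image continuous_on_analytic ab) auto
    from compact_imp_bounded[OF this] obtain B where B: "0 < B" "\<And>z. z \<in> cball 0 1 \<Longrightarrow> norm (\<beta> z) \<le> B"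
      unfolding bounded_pos by blast
    \<comment> \<open>The number of steps may depend on the Bezout solution, because the bound for
      the geometric sum is the same for all \<open>n\<close>.\<close>
    obtain n where n: "\<gamma> ^ n < 1 / B" using real_arch_pow_inv[of "1 / B" \<gamma>] \<gamma> B by auto
    obtain f g where fg: "f analytic_on cball 0 1" "g analytic_on cball 0 1" "l2 g \<le> (\<Sum>i<n. \<gamma> ^ i) * l2 x"
        "l2 (\<lambda>z. x z - (a z * f z + b z * g z)) \<le> \<gamma> ^ n * l2 x" using iter by blast
    define r where "r = (\<lambda>z. x z - (a z * f z + b z * g z))"
    have r: "r analytic_on cball 0 1" unfolding r_def by (intro analytic_intros x an fg)
    show "\<exists>f g. f analytic_on cball 0 1 \<and> g analytic_on cball 0 1 \<and> l2 g \<le> (1 / (1 - \<gamma>) + 1) * l2 x \<and>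
      (\<forall>z\<in>cball 0 1. x z = bprod zs z * f z + bprod ws z * g z)"
    proof (intro exI conjI ballI)
      show "(\<lambda>z. f z + \<alpha> z * r z) analytic_on cball 0 1" "(\<lambda>z. g z + \<beta> z * r z) analytic_on cball 0 1"
        by (intro analytic_intros fg ab r)+
      show "x z = bprod zs z * (f z + \<alpha> z * r z) + bprod ws z * (g z + \<beta> z * r z)" if z: "z \<in> cball 0 1" for z
      proof -
        have "a z * (f z + \<alpha> z * r z) + b z * (g z + \<beta> z * r z) =
            (a z * \<alpha> z + b z * \<beta> z) * r z + (a z * f z + b z * g z)"
          by (simp add: algebra_simps)
        also have "\<dots> = x z" unfolding ab(3)[OF z] by (simp add: r_def)
        finally show ?thesis by (simp add: a_b_def)
      qed
      have "l2 (\<lambda>z. g z + \<beta> z * r z) \<le> l2 g + l2 (\<lambda>z. \<beta> z * r z)"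
        by (intro l2_triangle continuous_intros continuous_on_analytic fg ab r)
      also have "l2 (\<lambda>z. \<beta> z * r z) \<le> l2 (\<lambda>z. of_real B * r z)"
        unfolding l2_def using B
        by (intro real_sqrt_le_mono sqn_mono continuous_intros continuous_on_analytic ab r)
           (auto simp: norm_mult intro!: mult_right_mono)
      also have "\<dots> = B * l2 r" using B by (simp add: l2_cmul)
      also have "\<dots> \<le> B * (\<gamma> ^ n * l2 x)" using fg B unfolding r_def by (intro mult_left_mono) auto
      also have "\<dots> \<le> B * (1 / B * l2 x)" using n B l2x by (intro mult_left_mono mult_right_mono) auto
      also have "\<dots> = l2 x" using B by simp
      also have "l2 g \<le> 1 / (1 - \<gamma>) * l2 x"
      proof -
        have "(\<Sum>i<n. \<gamma> ^ i) = (1 - \<gamma> ^ n) / (1 - \<gamma>)" using \<gamma> by (simp add: sum_gp_strict)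
        also have "\<dots> \<le> 1 / (1 - \<gamma>)" using \<gamma> by (intro divide_right_mono) auto
        finally show ?thesis using fg(3) l2x by (meson mult_right_mono order.trans)
      qed
      finally show "l2 (\<lambda>z. g z + \<beta> z * r z) \<le> (1 / (1 - \<gamma>) + 1) * l2 x" by (simp add: algebra_simps)
    qed
  qed
qed

section \<open>Quotient norms and the Schur algorithm\<close>

abbreviation disc_analytic :: "(complex \<Rightarrow> complex) \<Rightarrow> bool" where
  "disc_analytic f \<equiv> f analytic_on cball 0 1"

text \<open>The square of the norm of the class of \<open>x\<close> in \<open>H\<^sup>2 / \<Theta>H\<^sup>2\<close>.\<close>

definition qn :: "(complex \<Rightarrow> complex) \<Rightarrow> (complex \<Rightarrow> complex) \<Rightarrow> real" where
  "qn \<Theta> x = (INF g\<in>{g. disc_analytic g}. sqn (\<lambda>z. x z + \<Theta> z * g z))"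

definition cgr :: "(complex \<Rightarrow> complex) \<Rightarrow> (complex \<Rightarrow> complex) \<Rightarrow> (complex \<Rightarrow> complex) \<Rightarrow> bool" where
  "cgr \<Theta> x y \<longleftrightarrow> (\<exists>g. disc_analytic g \<and> (\<forall>z\<in>cball 0 1. x z = y z + \<Theta> z * g z))"

section \<open>Congruences modulo an analytic function\<close>

lemma cgrI: "disc_analytic g \<Longrightarrow> (\<And>z. z \<in> cball 0 1 \<Longrightarrow> x z = y z + \<Theta> z * g z) \<Longrightarrow> cgr \<Theta> x y"
  unfolding cgr_def by blast

lemma cgr_refl: "(\<And>z. z \<in> cball 0 1 \<Longrightarrow> x z = y z) \<Longrightarrow> cgr \<Theta> x y"
  by (rule cgrI[of "\<lambda>_. 0"]) auto

lemma cgr_sym: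
  assumes "cgr \<Theta> x y"
  shows "cgr \<Theta> y x"
proof -
  obtain g where g: "disc_analytic g" "\<And>z. z \<in> cball 0 1 \<Longrightarrow> x z = y z + \<Theta> z * g z"
    using assms unfolding cgr_def by blast
  show ?thesis by (rule cgrI[of "\<lambda>z. - g z"]) (auto intro!: analytic_intros g(1) simp: g(2))
qed

lemma cgr_trans:
  assumes "cgr \<Theta> x y" "cgr \<Theta> y w"
  shows "cgr \<Theta> x w"
proof -
  obtain g where g: "disc_analytic g" "\<And>z. z \<in> cball 0 1 \<Longrightarrow> x z = y z + \<Theta> z * g z"
    using assms(1) unfolding cgr_def by blast
  obtain h where h: "disc_analytic h" "\<And>z. z \<in> cball 0 1 \<Longrightarrow> y z = w z + \<Theta> z * h z"
    using assms(2) unfolding cgr_def by blast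
  show ?thesis
    by (rule cgrI[of "\<lambda>z. g z + h z"]) (intro analytic_intros g h, simp add: g(2) h(2) algebra_simps)
qed

lemma cgr_add:
  assumes "cgr \<Theta> x y" "cgr \<Theta> x' y'"
  shows "cgr \<Theta> (\<lambda>z. x z + x' z) (\<lambda>z. y z + y' z)"
proof -
  obtain g where g: "disc_analytic g" "\<And>z. z \<in> cball 0 1 \<Longrightarrow> x z = y z + \<Theta> z * g z"
    using assms(1) unfolding cgr_def by blast
  obtain h where h: "disc_analytic h" "\<And>z. z \<in> cball 0 1 \<Longrightarrow> x' z = y' z + \<Theta> z * h z"
    using assms(2) unfolding cgr_def by blast
  show ?thesis
    by (rule cgrI[of "\<lambda>z. g z + h z"]) (intro analytic_intros g h, simp add: g(2) h(2) algebra_simps)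
qed

lemma cgr_mult:
  assumes "cgr \<Theta> x y" "disc_analytic w"
  shows "cgr \<Theta> (\<lambda>z. w z * x z) (\<lambda>z. w z * y z)"
proof -
  obtain g where g: "disc_analytic g" "\<And>z. z \<in> cball 0 1 \<Longrightarrow> x z = y z + \<Theta> z * g z"
    using assms(1) unfolding cgr_def by blast
  show ?thesis
    by (rule cgrI[of "\<lambda>z. w z * g z"]) (intro analytic_intros g assms, simp add: g(2) algebra_simps)
qed

lemma cgr_sum:
  assumes "\<And>i. i \<in> I \<Longrightarrow> cgr \<Theta> (x i) (y i)"
  shows "cgr \<Theta> (\<lambda>z. \<Sum>i\<in>I. x i z) (\<lambda>z. \<Sum>i\<in>I. y i z)"
  using assms
proof (induction I rule: infinite_finite_induct)
  case (insert i I)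
  thus ?case by (simp add: cgr_add)
qed (auto intro: cgr_refl)

section \<open>Quotient norms and their Hilbert space identities\<close>

context
  fixes \<Theta> :: "complex \<Rightarrow> complex"
  assumes \<Theta>: "disc_analytic \<Theta>"
begin

lemma qn_bdd_below:
  assumes "disc_analytic x"
  shows "bdd_below ((\<lambda>g. sqn (\<lambda>z. x z + \<Theta> z * g z)) ` {g. disc_analytic g})"
  by (rule bdd_belowI[of _ 0])
     (auto intro!: sqn_nonneg continuous_on_analytic analytic_intros \<Theta> assms)

lemma qn_le:
  assumes "disc_analytic x" "disc_analytic g"
  shows "qn \<Theta> x \<le> sqn (\<lambda>z. x z + \<Theta> z * g z)"
  unfolding qn_def using assms by (intro cINF_lower qn_bdd_below) auto

lemma qn_le_sqn: "disc_analytic x \<Longrightarrow> qn \<Theta> x \<le> sqn x"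
  using qn_le[of x "\<lambda>_. 0"] by simp

text \<open>Stands in for a minimiser: estimates are made for a representative within
  \<open>\<eta>\<close> of the infimum, and \<open>\<eta>\<close> is arbitrary.\<close>

lemma qn_approx:
  assumes "disc_analytic x" "0 < \<eta>"
  obtains g where "disc_analytic g" "sqn (\<lambda>z. x z + \<Theta> z * g z) < qn \<Theta> x + \<eta>"
proof -
  have "\<exists>g\<in>{g. disc_analytic g}. sqn (\<lambda>z. x z + \<Theta> z * g z) < qn \<Theta> x + \<eta>"
    using assms analytic_on_const unfolding qn_def
    by (subst cINF_less_iff[symmetric]) (auto intro!: qn_bdd_below)
  thus ?thesis using that by blast
qed

lemma qn_nonneg: "disc_analytic x \<Longrightarrow> 0 \<le> qn \<Theta> x"
  unfolding qn_def using analytic_on_const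
  by (intro cINF_greatest) (auto intro!: sqn_nonneg continuous_on_analytic analytic_intros \<Theta>)

lemma qn_mono_cgr:
  assumes an: "disc_analytic x" "disc_analytic y" and "cgr \<Theta> x y"
  shows "qn \<Theta> x \<le> qn \<Theta> y"
proof (rule field_le_epsilon)
  fix \<eta> :: real assume "0 < \<eta>"
  then obtain g where g: "disc_analytic g" "sqn (\<lambda>z. y z + \<Theta> z * g z) < qn \<Theta> y + \<eta>"
    using qn_approx an by blast
  obtain h where h: "disc_analytic h" "\<And>z. z \<in> cball 0 1 \<Longrightarrow> x z = y z + \<Theta> z * h z"
    using assms(3) unfolding cgr_def by blast
  have "qn \<Theta> x \<le> sqn (\<lambda>z. x z + \<Theta> z * (g z - h z))" by (intro qn_le analytic_intros g h an)
  also have "\<dots> = sqn (\<lambda>z. y z + \<Theta> z * g z)"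
    by (intro sqn_cong) (simp add: h algebra_simps)
  finally show "qn \<Theta> x \<le> qn \<Theta> y + \<eta>" using g by linarith
qed

lemma qn_cgr:
  assumes "disc_analytic x" "disc_analytic y" "cgr \<Theta> x y"
  shows "qn \<Theta> x = qn \<Theta> y"
  using qn_mono_cgr[OF assms] qn_mono_cgr[OF assms(2,1) cgr_sym[OF assms(3)]] by simp

lemma qn_mult_le:
  assumes an: "disc_analytic w" "disc_analytic x" and M: "\<And>z. norm z = 1 \<Longrightarrow> norm (w z) \<le> M"
  shows "qn \<Theta> (\<lambda>z. w z * x z) \<le> M\<^sup>2 * qn \<Theta> x"
proof (rule field_le_epsilon)
  fix \<eta> :: real assume \<eta>: "0 < \<eta>"
  \<comment> \<open>\<open>M\<close> may be 0, hence the added 1 in the denominator.\<close>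
  have "0 < \<eta> / (M\<^sup>2 + 1)" using \<eta> by (intro divide_pos_pos) (auto intro: add_nonneg_pos)
  then obtain g where g: "disc_analytic g" "sqn (\<lambda>z. x z + \<Theta> z * g z) < qn \<Theta> x + \<eta> / (M\<^sup>2 + 1)"
    using qn_approx an by blast
  note cont = an[THEN continuous_on_analytic] g(1)[THEN continuous_on_analytic] \<Theta>[THEN continuous_on_analytic]
  have "qn \<Theta> (\<lambda>z. w z * x z) \<le> sqn (\<lambda>z. w z * x z + \<Theta> z * (w z * g z))"
    by (intro qn_le analytic_intros g an)
  also have "\<dots> \<le> cmean (\<lambda>z. M\<^sup>2 * (norm (x z + \<Theta> z * g z))\<^sup>2) 1"
    unfolding sqn_def cmean_def
  proof (rule integral_le)
    fix t :: real
    let ?z = "of_real 1 * cis (2 * pi * t)"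
    have "(norm (w ?z * x ?z + \<Theta> ?z * (w ?z * g ?z)))\<^sup>2 = (norm (w ?z) * norm (x ?z + \<Theta> ?z * g ?z))\<^sup>2"
      by (simp add: algebra_simps flip: norm_mult)
    also have "\<dots> \<le> (M * norm (x ?z + \<Theta> ?z * g ?z))\<^sup>2"
      using M[of ?z] by (intro power_mono mult_right_mono) (auto simp: norm_mult)
    finally show "(norm (w ?z * x ?z + \<Theta> ?z * (w ?z * g ?z)))\<^sup>2 \<le> M\<^sup>2 * (norm (x ?z + \<Theta> ?z * g ?z))\<^sup>2"
      by (simp add: power_mult_distrib)
  qed (intro integrable_circle[where F="\<lambda>z. (norm (w z * x z + \<Theta> z * (w z * g z)))\<^sup>2"]
      integrable_circle[where F="\<lambda>z. M\<^sup>2 * (norm (x z + \<Theta> z * g z))\<^sup>2"] continuous_intros cont; simp)+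
  also have "\<dots> = M\<^sup>2 * sqn (\<lambda>z. x z + \<Theta> z * g z)" by (simp add: sqn_def cmean_cmul)
  also have "\<dots> \<le> M\<^sup>2 * (qn \<Theta> x + \<eta> / (M\<^sup>2 + 1))" using g by (intro mult_left_mono) auto
  also have "\<dots> \<le> M\<^sup>2 * qn \<Theta> x + \<eta>"
  proof -
    have pos: "0 < M\<^sup>2 + 1" by (simp add: add_nonneg_pos)
    have "M\<^sup>2 * (\<eta> / (M\<^sup>2 + 1)) \<le> (M\<^sup>2 + 1) * (\<eta> / (M\<^sup>2 + 1))"
      using \<eta> pos by (intro mult_right_mono divide_nonneg_pos) auto
    hence "M\<^sup>2 * (\<eta> / (M\<^sup>2 + 1)) \<le> \<eta>" using pos by simp
    thus ?thesis by (simp add: algebra_simps)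
  qed
  finally show "qn \<Theta> (\<lambda>z. w z * x z) \<le> M\<^sup>2 * qn \<Theta> x + \<eta>" .
qed

lemma qn_cmul_le: "disc_analytic x \<Longrightarrow> qn \<Theta> (\<lambda>z. c * x z) \<le> (norm c)\<^sup>2 * qn \<Theta> x"
  by (rule qn_mult_le) auto

text \<open>Quadratic identities pass to the quotient as inequalities, so its inner product is not needed;
  the parallelogram law follows by applying this twice.\<close>

lemma qn_quadratic:
  assumes an: "disc_analytic x" "disc_analytic y"
    and id: "\<And>p q. k1 * (norm (\<alpha> * p + \<beta> * q))\<^sup>2 + k2 * (norm (\<gamma> * p + \<delta> * q))\<^sup>2 = l1 * (norm p)\<^sup>2 + l2' * (norm q)\<^sup>2"
    and k: "0 \<le> k1" "0 \<le> k2" and l: "0 \<le> l1" "0 \<le> l2'"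
  shows "k1 * qn \<Theta> (\<lambda>z. \<alpha> * x z + \<beta> * y z) + k2 * qn \<Theta> (\<lambda>z. \<gamma> * x z + \<delta> * y z) \<le> l1 * qn \<Theta> x + l2' * qn \<Theta> y"
proof (rule field_le_epsilon)
  fix \<eta> :: real assume \<eta>: "0 < \<eta>"
  define e where "e = \<eta> / (l1 + l2' + 1)"
  have e: "0 < e" using \<eta> l by (auto simp: e_def intro!: divide_pos_pos)
  obtain g where g: "disc_analytic g" "sqn (\<lambda>z. x z + \<Theta> z * g z) < qn \<Theta> x + e"
    using qn_approx[OF an(1) e] by blast
  obtain h where h: "disc_analytic h" "sqn (\<lambda>z. y z + \<Theta> z * h z) < qn \<Theta> y + e"
    using qn_approx[OF an(2) e] by blast
  define X Y where "X = (\<lambda>z. x z + \<Theta> z * g z)" "Y = (\<lambda>z. y z + \<Theta> z * h z)"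
  have XY: "disc_analytic X" "disc_analytic Y"
    unfolding X_Y_def by (intro analytic_intros an g h \<Theta>)+
  note cont = XY[THEN continuous_on_analytic]
  have comb: "qn \<Theta> (\<lambda>z. c * x z + d * y z) \<le> sqn (\<lambda>z. c * X z + d * Y z)" for c d
  proof -
    have "qn \<Theta> (\<lambda>z. c * x z + d * y z) \<le> sqn (\<lambda>z. c * x z + d * y z + \<Theta> z * (c * g z + d * h z))"
      by (intro qn_le analytic_intros an g h)
    thus ?thesis by (simp add: X_Y_def algebra_simps)
  qed
  have lincomb: "cmean (\<lambda>z. a * (norm (u z))\<^sup>2 + b * (norm (v z))\<^sup>2) 1 = a * sqn u + b * sqn v"
    if "disc_analytic u" "disc_analytic v" for a b u v
    unfolding sqn_def using that
    by (intro pos_functional_lincomb[OF pos_functional_cmean] continuous_intros continuous_on_analytic)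
  have "k1 * qn \<Theta> (\<lambda>z. \<alpha> * x z + \<beta> * y z) + k2 * qn \<Theta> (\<lambda>z. \<gamma> * x z + \<delta> * y z) \<le>
        k1 * sqn (\<lambda>z. \<alpha> * X z + \<beta> * Y z) + k2 * sqn (\<lambda>z. \<gamma> * X z + \<delta> * Y z)"
    using k by (intro add_mono mult_left_mono comb)
  also have "\<dots> = cmean (\<lambda>z. k1 * (norm (\<alpha> * X z + \<beta> * Y z))\<^sup>2 + k2 * (norm (\<gamma> * X z + \<delta> * Y z))\<^sup>2) 1"
    by (intro lincomb[symmetric] analytic_intros XY)
  also have "\<dots> = l1 * sqn X + l2' * sqn Y"
    unfolding id by (intro lincomb XY)
  also have "\<dots> \<le> l1 * (qn \<Theta> x + e) + l2' * (qn \<Theta> y + e)"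
    using g h l unfolding X_Y_def by (intro add_mono mult_left_mono) auto
  also have "\<dots> = l1 * qn \<Theta> x + l2' * qn \<Theta> y + e * (l1 + l2')" by (simp add: algebra_simps)
  also have "e * (l1 + l2') \<le> e * (l1 + l2' + 1)" using e by (intro mult_left_mono) auto
  also have "\<dots> = \<eta>" using l by (simp add: e_def add_nonneg_pos)
  finally show "k1 * qn \<Theta> (\<lambda>z. \<alpha> * x z + \<beta> * y z) + k2 * qn \<Theta> (\<lambda>z. \<gamma> * x z + \<delta> * y z)
    \<le> l1 * qn \<Theta> x + l2' * qn \<Theta> y + \<eta>" by simp
qed

lemma qn_parallelogram:
  assumes an: "disc_analytic x" "disc_analytic y"
  shows "qn \<Theta> (\<lambda>z. x z + y z) + qn \<Theta> (\<lambda>z. x z - y z) = 2 * qn \<Theta> x + 2 * qn \<Theta> y"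
proof (rule antisym)
  have "1 * qn \<Theta> (\<lambda>z. 1 * x z + 1 * y z) + 1 * qn \<Theta> (\<lambda>z. 1 * x z + (- 1) * y z) \<le> 2 * qn \<Theta> x + 2 * qn \<Theta> y"
    by (rule qn_quadratic[OF an]) (auto simp: cmod_power2 power2_sum power2_diff)
  thus "qn \<Theta> (\<lambda>z. x z + y z) + qn \<Theta> (\<lambda>z. x z - y z) \<le> 2 * qn \<Theta> x + 2 * qn \<Theta> y" by simp
  have "2 * qn \<Theta> (\<lambda>z. (1/2) * (x z + y z) + (1/2) * (x z - y z)) + 2 * qn \<Theta> (\<lambda>z. (1/2) * (x z + y z) + (- 1/2) * (x z - y z))
    \<le> 1 * qn \<Theta> (\<lambda>z. x z + y z) + 1 * qn \<Theta> (\<lambda>z. x z - y z)"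
  proof (rule qn_quadratic)
    show "2 * (norm ((1/2) * p + (1/2) * q))\<^sup>2 + 2 * (norm ((1/2) * p + (- 1/2) * q))\<^sup>2 = 1 * (norm p)\<^sup>2 + 1 * (norm q)\<^sup>2"
      for p q :: complex
      by (simp add: cmod_power2) (simp add: power2_eq_square field_simps)
  qed (auto intro!: analytic_intros an)
  moreover have "(\<lambda>z. (1/2) * (x z + y z) + (1/2) * (x z - y z)) = x" "(\<lambda>z. (1/2) * (x z + y z) + (- 1/2) * (x z - y z)) = y"
    by (auto simp: fun_eq_iff field_simps)
  ultimately show "2 * qn \<Theta> x + 2 * qn \<Theta> y \<le> qn \<Theta> (\<lambda>z. x z + y z) + qn \<Theta> (\<lambda>z. x z - y z)" by simp
qed

text \<open>The pointwise version is an identity, obtained by writing \<open>u - c * v\<close> and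
  \<open>v\<close> as combinations of \<open>v - cnj c * u\<close> and \<open>u\<close>. With
  \<open>u = f * k\<close> and \<open>v = k\<close> it expresses that the Moebius transform of a
  contraction is a contraction.\<close>

lemma qn_Moebius:
  assumes an: "disc_analytic u" "disc_analytic v" and c: "norm c \<le> 1"
  shows "qn \<Theta> (\<lambda>z. u z - c * v z) + (1 - (norm c)\<^sup>2) * qn \<Theta> v
     \<le> qn \<Theta> (\<lambda>z. v z - cnj c * u z) + (1 - (norm c)\<^sup>2) * qn \<Theta> u"
proof -
  have "1 * qn \<Theta> (\<lambda>z. (- c) * (v z - cnj c * u z) + (1 - c * cnj c) * u z) +
     (1 - (norm c)\<^sup>2) * qn \<Theta> (\<lambda>z. 1 * (v z - cnj c * u z) + cnj c * u z)
   \<le> 1 * qn \<Theta> (\<lambda>z. v z - cnj c * u z) + (1 - (norm c)\<^sup>2) * qn \<Theta> u"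
  proof (rule qn_quadratic)
    fix p q :: complex
    have "complex_of_real (1 * (norm ((- c) * p + (1 - c * cnj c) * q))\<^sup>2 + (1 - (norm c)\<^sup>2) * (norm (1 * p + cnj c * q))\<^sup>2)
       = of_real (1 * (norm p)\<^sup>2 + (1 - (norm c)\<^sup>2) * (norm q)\<^sup>2)"
      unfolding of_real_add of_real_mult of_real_diff of_real_1 complex_norm_square
      by (simp add: algebra_simps)
    thus "1 * (norm ((- c) * p + (1 - c * cnj c) * q))\<^sup>2 + (1 - (norm c)\<^sup>2) * (norm (1 * p + cnj c * q))\<^sup>2
       = 1 * (norm p)\<^sup>2 + (1 - (norm c)\<^sup>2) * (norm q)\<^sup>2"
      unfolding of_real_eq_iff .
  qed (use c in \<open>auto intro!: analytic_intros an simp: abs_square_le_1 power_le_one\<close>)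
  thus ?thesis by (simp add: algebra_simps)
qed

text \<open>Changing the representative of \<open>h\<close> changes \<open>f * h\<close> by a
  multiple of \<open>\<Theta>\<close>, so a bound against the plain norm for all \<open>h\<close>
  improves itself to one against the quotient norm.\<close>

lemma qn_contraction:
  assumes f: "disc_analytic f" and le: "\<And>h. disc_analytic h \<Longrightarrow> qn \<Theta> (\<lambda>z. f z * h z) \<le> \<rho> * sqn h"
    and h: "disc_analytic h" and \<rho>: "0 \<le> \<rho>"
  shows "qn \<Theta> (\<lambda>z. f z * h z) \<le> \<rho> * qn \<Theta> h"
proof (rule field_le_epsilon)
  fix \<eta> :: real assume \<eta>: "0 < \<eta>"
  hence "0 < \<eta> / (\<rho> + 1)" using \<rho> by simp
  then obtain g where g: "disc_analytic g" "sqn (\<lambda>z. h z + \<Theta> z * g z) < qn \<Theta> h + \<eta> / (\<rho> + 1)"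
    using qn_approx h by blast
  have "qn \<Theta> (\<lambda>z. f z * h z) = qn \<Theta> (\<lambda>z. f z * (h z + \<Theta> z * g z))"
    by (intro qn_cgr analytic_intros f h g \<Theta> cgrI[of "\<lambda>z. - f z * g z"]) (simp add: algebra_simps)
  also have "\<dots> \<le> \<rho> * sqn (\<lambda>z. h z + \<Theta> z * g z)"
    by (intro le analytic_intros f h g \<Theta>)
  also have "\<dots> \<le> \<rho> * (qn \<Theta> h + \<eta> / (\<rho> + 1))" using g \<rho> by (intro mult_left_mono) auto
  also have "\<dots> = \<rho> * qn \<Theta> h + \<rho> * (\<eta> / (\<rho> + 1))" by (simp add: algebra_simps)
  also have "\<rho> * (\<eta> / (\<rho> + 1)) \<le> \<eta>" using \<eta> \<rho> by (simp add: field_simps)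
  finally show "qn \<Theta> (\<lambda>z. f z * h z) \<le> \<rho> * qn \<Theta> h + \<eta>" by simp
qed

text \<open>Signs are chosen one after another. By the parallelogram law the two values for the next
  sign average to the squared norm so far plus that of the new term, so one value does not exceed
  this and one does not fall below it. This replaces averaging over random signs.\<close>

lemma qn_choose_signs:
  fixes N :: nat
  assumes y: "\<And>n. disc_analytic (y n)"
  shows "\<exists>s. (\<forall>n. s n \<in> {1, - 1 :: complex}) \<and> qn \<Theta> (\<lambda>z. \<Sum>n<N. s n * y n z) \<le> (\<Sum>n<N. qn \<Theta> (y n))"
    and "\<exists>s. (\<forall>n. s n \<in> {1, - 1 :: complex}) \<and> (\<Sum>n<N. qn \<Theta> (y n)) \<le> qn \<Theta> (\<lambda>z. \<Sum>n<N. s n * y n z)"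
proof -
  have zero: "qn \<Theta> (\<lambda>_. 0) = 0"
  proof (rule antisym)
    show "qn \<Theta> (\<lambda>_. 0) \<le> 0" using qn_le_sqn[of "\<lambda>_. 0"] by (simp add: sqn_def cmean_def)
  qed (simp add: qn_nonneg)
  have step: "qn \<Theta> (\<lambda>z. (\<Sum>n<N. s n * y n z) + y N z) + qn \<Theta> (\<lambda>z. (\<Sum>n<N. s n * y n z) - y N z) =
      2 * qn \<Theta> (\<lambda>z. \<Sum>n<N. s n * y n z) + 2 * qn \<Theta> (y N)" for s N
    by (intro qn_parallelogram analytic_intros y)
  have upd: "(\<Sum>n<Suc N. (s(N := c)) n * y n z) = (\<Sum>n<N. s n * y n z) + c * y N z" for s N c z
    by (simp add: lessThan_Suc)
  show "\<exists>s. (\<forall>n. s n \<in> {1, - 1 :: complex}) \<and> qn \<Theta> (\<lambda>z. \<Sum>n<N. s n * y n z) \<le> (\<Sum>n<N. qn \<Theta> (y n))"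
  proof (induction N)
    case 0
    show ?case by (rule exI[of _ "\<lambda>_. 1"]) (simp add: zero)
  next
    case (Suc N)
    then obtain s where s: "\<forall>n. s n \<in> {1, - 1 :: complex}" "qn \<Theta> (\<lambda>z. \<Sum>n<N. s n * y n z) \<le> (\<Sum>n<N. qn \<Theta> (y n))"
      by blast
    have "qn \<Theta> (\<lambda>z. (\<Sum>n<N. s n * y n z) + y N z) \<le> (\<Sum>n<Suc N. qn \<Theta> (y n)) \<or>
          qn \<Theta> (\<lambda>z. (\<Sum>n<N. s n * y n z) - y N z) \<le> (\<Sum>n<Suc N. qn \<Theta> (y n))"
      using step[of s N] s(2) by (simp add: lessThan_Suc) linarith
    thus ?case
      using s(1) upd[of s N 1] upd[of s N "-1"]
      by (elim disjE) (rule exI[of _ "s(N := 1)"], simp, rule exI[of _ "s(N := - 1)"], simp)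
  qed
  show "\<exists>s. (\<forall>n. s n \<in> {1, - 1 :: complex}) \<and> (\<Sum>n<N. qn \<Theta> (y n)) \<le> qn \<Theta> (\<lambda>z. \<Sum>n<N. s n * y n z)"
  proof (induction N)
    case 0
    show ?case by (rule exI[of _ "\<lambda>_. 1"]) (simp add: zero)
  next
    case (Suc N)
    then obtain s where s: "\<forall>n. s n \<in> {1, - 1 :: complex}" "(\<Sum>n<N. qn \<Theta> (y n)) \<le> qn \<Theta> (\<lambda>z. \<Sum>n<N. s n * y n z)"
      by blast
    have "(\<Sum>n<Suc N. qn \<Theta> (y n)) \<le> qn \<Theta> (\<lambda>z. (\<Sum>n<N. s n * y n z) + y N z) \<or>
          (\<Sum>n<Suc N. qn \<Theta> (y n)) \<le> qn \<Theta> (\<lambda>z. (\<Sum>n<N. s n * y n z) - y N z)"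
      using step[of s N] s(2) by (simp add: lessThan_Suc) linarith
    thus ?case
      using s(1) upd[of s N 1] upd[of s N "-1"]
      by (elim disjE) (rule exI[of _ "s(N := 1)"], simp, rule exI[of _ "s(N := - 1)"], simp)
  qed
qed

end

text \<open>\<open>u z - u c\<close> is divisible by the Blaschke factor at \<open>c\<close>, which
  on the circle turns the conjugate kernel into \<open>- z\<close> times the kernel. The product is
  analytic and vanishes at 0, so its mean is 0.\<close>

lemma reproducing_kernel:
  assumes u: "disc_analytic u" and c: "norm c < 1"
  shows "cmean (\<lambda>z. u z * cnj (1 / (1 - cnj c * z))) 1 = u c"
proof -
  have ker: "disc_analytic (\<lambda>z. 1 / (1 - cnj c * z))"
    using blaschke_denom_nonzero[OF c] by (intro analytic_intros) auto
  have "disc_analytic (\<lambda>z. u z - u c)" by (intro analytic_intros u)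
  then obtain v where v: "disc_analytic v" "\<And>z. z \<in> cball 0 1 \<Longrightarrow> u z - u c = blaschke c z * v z"
    using blaschke_divide_analytic[of "\<lambda>z. u z - u c" c] c by auto
  have an: "disc_analytic (\<lambda>z. z * (- v z * (1 / (1 - cnj c * z))))"
    by (intro analytic_intros v ker)
  have "cmean (\<lambda>z. u z * cnj (1 / (1 - cnj c * z))) 1 =
      cmean (\<lambda>z. z * (- v z * (1 / (1 - cnj c * z))) + u c * cnj (1 / (1 - cnj c * z))) 1"
  proof (rule cmean_circle_cong)
    fix z :: complex assume z: "norm z = 1"
    have zz: "z * cnj z = 1" using z by (simp add: complex_norm_square[symmetric])
    have d: "1 - c * cnj z \<noteq> 0" using blaschke_denom_nonzero[of "cnj c" "cnj z"] c z by simp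
    have "c - z = - z * (1 - c * cnj z)" using zz by (simp add: algebra_simps)
    hence bk: "blaschke c z * (1 / (1 - c * cnj z)) = - z * (1 / (1 - cnj c * z))"
      unfolding blaschke_def using d by simp
    have "(blaschke c z * v z + u c) * (1 / (1 - c * cnj z)) =
        v z * (blaschke c z * (1 / (1 - c * cnj z))) + u c * (1 / (1 - c * cnj z))"
      by (simp only: algebra_simps)
    hence "(blaschke c z * v z + u c) * (1 / (1 - c * cnj z)) =
      z * (- v z * (1 / (1 - cnj c * z))) + u c * (1 / (1 - c * cnj z))"
      unfolding bk by simp
    moreover have "u z = blaschke c z * v z + u c" using v(2)[of z] z by (simp add: algebra_simps)
    ultimately show "u z * cnj (1 / (1 - cnj c * z)) = z * (- v z * (1 / (1 - cnj c * z))) + u c * cnj (1 / (1 - cnj c * z))"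
      by simp
  qed
  also have "\<dots> = cmean (\<lambda>z. z * (- v z * (1 / (1 - cnj c * z)))) 1 + cmean (\<lambda>z. u c * cnj (1 / (1 - cnj c * z))) 1"
    by (rule cmean_add) (intro continuous_intros continuous_on_analytic[OF an] continuous_on_analytic[OF ker] | simp)+
  also have "cmean (\<lambda>z. z * (- v z * (1 / (1 - cnj c * z)))) 1 = 0"
    using cmean_analytic[OF an] by simp
  also have "cmean (\<lambda>z. u c * cnj (1 / (1 - cnj c * z))) 1 = u c * cmean (\<lambda>z. cnj (1 / (1 - cnj c * z))) 1"
    by (rule cmean_cmul)
  also have "cmean (\<lambda>z. cnj (1 / (1 - cnj c * z))) 1 = cnj (cmean (\<lambda>z. 1 / (1 - cnj c * z)) 1)"
    by (rule cmean_linear[OF bounded_linear_cnj continuous_on_analytic[OF ker]]) simp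
  also have "cmean (\<lambda>z. 1 / (1 - cnj c * z)) 1 = 1"
    using cmean_analytic[OF ker] by simp
  finally show ?thesis by simp
qed

text \<open>Evaluation at a zero \<open>c\<close> of \<open>bprod zs\<close> is well defined on the
  quotient. The contraction is tested on the reproducing kernel \<open>k\<close> at
  \<open>c\<close>: all representatives of \<open>f * k\<close> take the value
  \<open>f c * k c\<close> there, which bounds their norms from below.\<close>

lemma norm_at_zero_le:
  assumes zs: "set zs \<subseteq> ball 0 1" and f: "disc_analytic f"
    and contr: "\<And>h. disc_analytic h \<Longrightarrow> qn (bprod zs) (\<lambda>z. f z * h z) \<le> \<rho> * qn (bprod zs) h"
    and c: "c \<in> set zs" and \<rho>: "0 \<le> \<rho>"
  shows "(norm (f c))\<^sup>2 \<le> \<rho>"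
proof -
  have c1: "norm c < 1" using zs c by auto
  define k where "k = (\<lambda>z. 1 / (1 - cnj c * z))"
  have k: "disc_analytic k"
    unfolding k_def using blaschke_denom_nonzero[OF c1] by (intro analytic_intros) auto
  note \<Theta> = bprod_analytic[OF zs]
  define \<kappa> where "\<kappa> = 1 / (1 - (norm c)\<^sup>2)"
  have \<kappa>: "0 < \<kappa>" using c1 by (simp add: \<kappa>_def power_less_one_iff abs_square_less_1)
  have kc: "k c = of_real \<kappa>"
  proof -
    have "cnj c * c = of_real ((norm c)\<^sup>2)" by (simp only: complex_norm_square mult.commute)
    thus ?thesis by (simp add: k_def \<kappa>_def)
  qed
  have "complex_of_real (sqn k) = cmean (\<lambda>z. k z * cnj (k z)) 1" by (rule cmean_self[symmetric]) (rule continuous_on_analytic[OF k])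
  also have "\<dots> = k c" unfolding k_def by (rule reproducing_kernel[OF k[unfolded k_def] c1])
  finally have sk: "sqn k = \<kappa>" unfolding kc of_real_eq_iff .
  have point: "(norm (u c))\<^sup>2 \<le> sqn u * \<kappa>" if u: "disc_analytic u" for u
  proof -
    have "norm (u c) = norm (cmean (\<lambda>z. u z * cnj (k z)) 1)"
      unfolding k_def by (simp only: reproducing_kernel[OF u c1])
    also have "\<dots> \<le> l2 u * l2 (\<lambda>z. cnj (k z))"
      by (intro norm_cmean_mult_le continuous_intros continuous_on_analytic u k)
    also have "l2 (\<lambda>z. cnj (k z)) = l2 k" by (rule l2_cong) simp
    finally have "(norm (u c))\<^sup>2 \<le> (l2 u * l2 k)\<^sup>2" by (intro power_mono) auto
    thus ?thesis by (simp add: power_mult_distrib l2_power2 continuous_on_analytic u k sk)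
  qed
  have "(norm (f c))\<^sup>2 * \<kappa> \<le> qn (bprod zs) (\<lambda>z. f z * k z)"
    unfolding qn_def
  proof (rule cINF_greatest)
    fix g assume "g \<in> {g. disc_analytic g}"
    hence g: "disc_analytic g" by simp
    have "bprod zs c = 0" using bprod_eq_0_iff[OF zs, of c] c c1 by simp
    hence "(norm (f c))\<^sup>2 * \<kappa>\<^sup>2 = (norm (f c * k c + bprod zs c * g c))\<^sup>2"
      using \<kappa> by (simp add: norm_mult power_mult_distrib kc)
    also have "\<dots> \<le> sqn (\<lambda>z. f z * k z + bprod zs z * g z) * \<kappa>"
      by (rule point[of "\<lambda>z. f z * k z + bprod zs z * g z"]) (intro analytic_intros f k g \<Theta>)
    finally show "(norm (f c))\<^sup>2 * \<kappa> \<le> sqn (\<lambda>z. f z * k z + bprod zs z * g z)"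
      using \<kappa> by (simp add: power2_eq_square mult.assoc[symmetric])
  qed (auto intro: exI[of _ "\<lambda>_. 0"])
  also have "\<dots> \<le> \<rho> * qn (bprod zs) k" by (rule contr[OF k])
  also have "\<dots> \<le> \<rho> * \<kappa>" using qn_le_sqn[OF \<Theta> k] \<rho> unfolding sk by (intro mult_left_mono)
  finally show ?thesis using \<kappa> by simp
qed

lemma norm_Moebius_le:
  assumes "norm w \<le> 1" "norm c < 1"
  shows "norm ((w + c) / (1 + cnj c * w)) \<le> 1" and "1 + cnj c * w \<noteq> 0"
proof -
  show *: "1 + cnj c * w \<noteq> 0"
    using blaschke_denom_nonzero[of "- c" w] assms by simp
  have "complex_of_real ((norm (1 + cnj c * w))\<^sup>2 - (norm (w + c))\<^sup>2) = of_real ((1 - (norm c)\<^sup>2) * (1 - (norm w)\<^sup>2))"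
    unfolding of_real_add of_real_mult of_real_diff of_real_1 complex_norm_square by (simp add: algebra_simps)
  hence "(norm (1 + cnj c * w))\<^sup>2 - (norm (w + c))\<^sup>2 = (1 - (norm c)\<^sup>2) * (1 - (norm w)\<^sup>2)"
    unfolding of_real_eq_iff .
  moreover have "0 \<le> (1 - (norm c)\<^sup>2) * (1 - (norm w)\<^sup>2)"
    using assms by (intro mult_nonneg_nonneg) (auto simp: power_le_one)
  ultimately have "(norm (w + c))\<^sup>2 \<le> (norm (1 + cnj c * w))\<^sup>2" by linarith
  hence "norm (w + c) \<le> norm (1 + cnj c * w)" by (rule power2_le_imp_le) simp
  thus "norm ((w + c) / (1 + cnj c * w)) \<le> 1" using * by (simp add: norm_divide)
qed

text \<open>At the zero \<open>\<nu>\<close> the function is replaced by \<open>(f - c) / (1 - cnj c * f)\<close> modulo \<open>\<Theta>\<close> with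
  \<open>c = f \<nu>\<close>, which is still a strict contraction and can be divided by \<open>blaschke \<nu>\<close>.\<close>

lemma Schur_algorithm:
  assumes "set zs \<subseteq> ball 0 1" "disc_analytic f" "0 \<le> \<rho>" "\<rho> < 1"
    and "\<And>h. disc_analytic h \<Longrightarrow> qn (bprod zs) (\<lambda>z. f z * h z) \<le> \<rho> * qn (bprod zs) h"
  shows "\<exists>F q. F holomorphic_on ball 0 1 \<and> q holomorphic_on ball 0 1 \<and>
           (\<forall>z\<in>ball 0 1. norm (F z) \<le> 1 \<and> F z = f z + bprod zs z * q z)"
  using assms
proof (induction zs arbitrary: f \<rho>)
  case Nil
  have "f holomorphic_on ball 0 1"
    using Nil.prems(2) by (meson analytic_imp_holomorphic ball_subset_cball holomorphic_on_subset)
  thus ?case by (intro exI[of _ "\<lambda>_. 0"] exI[of _ "\<lambda>z. - f z"]) (auto intro!: holomorphic_intros)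
next
  case (Cons \<nu> zs)
  define \<Theta> where "\<Theta> = bprod (\<nu> # zs)"
  note f = Cons.prems(2) and contr = Cons.prems(5)[folded \<Theta>_def]
  have zs: "set zs \<subseteq> ball 0 1" and l1: "norm \<nu> < 1" using Cons.prems(1) by auto
  have \<Theta>: "disc_analytic \<Theta>" unfolding \<Theta>_def by (rule bprod_analytic[OF Cons.prems(1)])
  have \<Theta>1: "disc_analytic (bprod zs)" by (rule bprod_analytic[OF zs])
  have b: "disc_analytic (blaschke \<nu>)" using l1 by (rule blaschke_analytic)
  have f_le: "(norm (f \<mu>))\<^sup>2 \<le> \<rho>" if "\<mu> \<in> set (\<nu> # zs)" for \<mu>
    using norm_at_zero_le[OF Cons.prems(1) f Cons.prems(5) that Cons.prems(3)] by simp
  have f_less: "norm (f \<mu>) < 1" if "\<mu> \<in> set (\<nu> # zs)" for \<mu>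
    using f_le[OF that] Cons.prems(4) by (metis le_less_trans norm_ge_zero one_le_power linorder_not_le)
  define c where "c = f \<nu>"
  have c1: "norm c < 1" using f_less[of \<nu>] by (simp add: c_def)
  \<comment> \<open>\<open>1 - cnj c * f\<close> may vanish elsewhere in the disc, but not at the
    zeros of \<open>\<Theta>\<close>; hence it is invertible modulo \<open>\<Theta>\<close>, with
    inverse \<open>\<beta>\<close> below.\<close>
  have nz: "1 - cnj c * f \<mu> \<noteq> 0" if "\<mu> \<in> set (\<nu> # zs)" for \<mu>
    using blaschke_denom_nonzero[OF c1, of "f \<mu>"] f_less[OF that] by simp
  have "disc_analytic (\<lambda>z. 1 - cnj c * f z)" by (intro analytic_intros f)
  then obtain \<alpha> \<beta> where ab: "disc_analytic \<alpha>" "disc_analytic \<beta>"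
      "\<And>z. z \<in> cball 0 1 \<Longrightarrow> \<Theta> z * \<alpha> z + (1 - cnj c * f z) * \<beta> z = 1"
    using bprod_bezout[where b = "\<lambda>z. 1 - cnj c * f z", OF Cons.prems(1) _ nz] unfolding \<Theta>_def by blast
  define f2 where "f2 = (\<lambda>z. (f z - c) * \<beta> z)"
  have f2: "disc_analytic f2" unfolding f2_def by (intro analytic_intros f ab)
  define s where "s = 1 - (norm c)\<^sup>2"
  have s: "0 < s" "s \<le> 1" using c1 by (auto simp: s_def power_less_one_iff abs_square_less_1)
  \<comment> \<open>The Moebius inequality gains \<open>s * (1 - \<rho>)\<close> times the quotient
    norm of \<open>\<beta> * h\<close>, and that of \<open>h\<close> is at most 4 times as large,
    both norms being squared.\<close>
  define \<rho>' where "\<rho>' = 1 - s * (1 - \<rho>) / 4"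
  have s\<rho>: "0 < s * (1 - \<rho>)" "s * (1 - \<rho>) \<le> 1"
    using s Cons.prems(3,4) by (auto intro!: mult_le_one)
  hence \<rho>': "0 \<le> \<rho>'" "\<rho>' < 1" by (auto simp: \<rho>'_def)
  have contr2: "qn \<Theta> (\<lambda>z. f2 z * h z) \<le> \<rho>' * qn \<Theta> h" if h: "disc_analytic h" for h
  proof -
    define k where "k = (\<lambda>z. \<beta> z * h z)"
    have k: "disc_analytic k" unfolding k_def by (intro analytic_intros ab h)
    have fk: "disc_analytic (\<lambda>z. f z * k z)" by (intro analytic_intros f k)
    have eq: "qn \<Theta> h = qn \<Theta> (\<lambda>z. k z - cnj c * (f z * k z))"
    proof (rule qn_cgr[OF \<Theta> h _ cgrI])
      show "disc_analytic (\<lambda>z. k z - cnj c * (f z * k z))" by (intro analytic_intros f k)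
      show "disc_analytic (\<lambda>z. \<alpha> z * h z)" by (intro analytic_intros ab h)
      fix z :: complex assume z: "z \<in> cball 0 1"
      have "h z = (\<Theta> z * \<alpha> z + (1 - cnj c * f z) * \<beta> z) * h z" using ab(3)[OF z] by simp
      also have "\<dots> = k z - cnj c * (f z * k z) + \<Theta> z * (\<alpha> z * h z)" by (simp add: k_def algebra_simps)
      finally show "h z = k z - cnj c * (f z * k z) + \<Theta> z * (\<alpha> z * h z)" .
    qed
    have "qn \<Theta> (\<lambda>z. k z + cnj c * (f z * k z)) + qn \<Theta> (\<lambda>z. k z - cnj c * (f z * k z))
        = 2 * qn \<Theta> k + 2 * qn \<Theta> (\<lambda>z. cnj c * (f z * k z))"
      by (intro qn_parallelogram[OF \<Theta>] analytic_intros f k)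
    moreover have "0 \<le> qn \<Theta> (\<lambda>z. k z + cnj c * (f z * k z))"
      by (intro qn_nonneg[OF \<Theta>] analytic_intros f k)
    moreover have "qn \<Theta> (\<lambda>z. cnj c * (f z * k z)) \<le> qn \<Theta> k"
    proof -
      have "qn \<Theta> (\<lambda>z. cnj c * (f z * k z)) \<le> (norm (cnj c))\<^sup>2 * qn \<Theta> (\<lambda>z. f z * k z)"
        by (rule qn_cmul_le[OF \<Theta> fk])
      also have "\<dots> \<le> 1 * qn \<Theta> (\<lambda>z. f z * k z)"
        using c1 by (intro mult_right_mono qn_nonneg[OF \<Theta> fk]) (auto simp: power_le_one)
      also have "\<dots> \<le> \<rho> * qn \<Theta> k" using contr[OF k] by simp
      also have "\<dots> \<le> 1 * qn \<Theta> k" using Cons.prems(4) by (intro mult_right_mono qn_nonneg[OF \<Theta> k]) auto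
      finally show ?thesis by simp
    qed
    ultimately have hk: "qn \<Theta> h \<le> 4 * qn \<Theta> k" unfolding eq by linarith
    have "qn \<Theta> (\<lambda>z. f2 z * h z) = qn \<Theta> (\<lambda>z. f z * k z - c * k z)"
      by (simp add: f2_def k_def algebra_simps)
    moreover have "qn \<Theta> (\<lambda>z. f z * k z - c * k z) + s * qn \<Theta> k \<le> qn \<Theta> h + s * qn \<Theta> (\<lambda>z. f z * k z)"
      unfolding s_def eq using c1 by (intro qn_Moebius[OF \<Theta>] fk k) auto
    moreover have "s * qn \<Theta> (\<lambda>z. f z * k z) \<le> s * (\<rho> * qn \<Theta> k)"
      using s contr[OF k] by (intro mult_left_mono) auto
    ultimately have "qn \<Theta> (\<lambda>z. f2 z * h z) \<le> qn \<Theta> h - s * (1 - \<rho>) * qn \<Theta> k"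
      by (simp add: algebra_simps)
    moreover have "s * (1 - \<rho>) * qn \<Theta> h \<le> s * (1 - \<rho>) * (4 * qn \<Theta> k)"
      using hk s\<rho> by (intro mult_left_mono) auto
    moreover have "\<rho>' * qn \<Theta> h = qn \<Theta> h - s * (1 - \<rho>) * qn \<Theta> h / 4"
      by (simp add: \<rho>'_def left_diff_distrib)
    moreover have "s * (1 - \<rho>) * (4 * qn \<Theta> k) = 4 * (s * (1 - \<rho>) * qn \<Theta> k)" by simp
    ultimately show ?thesis by linarith
  qed
  have "f2 \<nu> = 0" by (simp add: f2_def c_def)
  then obtain f3 where f3: "disc_analytic f3" "\<And>z. z \<in> cball 0 1 \<Longrightarrow> f2 z = blaschke \<nu> z * f3 z"
    using blaschke_divide_analytic[OF f2 _ l1] by blast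
  have contr3: "qn (bprod zs) (\<lambda>z. f3 z * h z) \<le> \<rho>' * qn (bprod zs) h" if h: "disc_analytic h" for h
  proof (rule qn_contraction[OF \<Theta>1 f3(1) _ h \<rho>'(1)])
    fix h assume h: "disc_analytic h"
    \<comment> \<open>Multiplication by the Blaschke factor preserves norms on the circle and
      carries the class of \<open>f3 * h\<close> modulo \<open>bprod zs\<close> to that of
      \<open>f2 * h\<close> modulo \<open>\<Theta>\<close>.\<close>
    have "qn (bprod zs) (\<lambda>z. f3 z * h z) = qn \<Theta> (\<lambda>z. f2 z * h z)"
      unfolding qn_def
    proof (intro INF_cong refl sqn_cong)
      fix g and z :: complex assume z: "norm z = 1"
      have "f2 z * h z + \<Theta> z * g z = blaschke \<nu> z * (f3 z * h z + bprod zs z * g z)"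
        using f3(2)[of z] z by (simp add: \<Theta>_def algebra_simps)
      thus "norm (f3 z * h z + bprod zs z * g z) = norm (f2 z * h z + \<Theta> z * g z)"
        using norm_blaschke_circle[OF l1 z] by (simp add: norm_mult)
    qed
    also have "\<dots> \<le> \<rho>' * qn \<Theta> h" by (rule contr2[OF h])
    also have "\<dots> \<le> \<rho>' * sqn h" using qn_le_sqn[OF \<Theta> h] \<rho>' by (intro mult_left_mono)
    finally show "qn (bprod zs) (\<lambda>z. f3 z * h z) \<le> \<rho>' * sqn h" .
  qed
  obtain F3 q3 where F3: "F3 holomorphic_on ball 0 1" "q3 holomorphic_on ball 0 1"
    "\<And>z. z \<in> ball 0 1 \<Longrightarrow> norm (F3 z) \<le> 1" "\<And>z. z \<in> ball 0 1 \<Longrightarrow> F3 z = f3 z + bprod zs z * q3 z"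
    using Cons.IH[OF zs f3(1) \<rho>' contr3] by blast
  have hol: "w holomorphic_on ball 0 1" if "disc_analytic w" for w
    using that by (meson analytic_imp_holomorphic ball_subset_cball holomorphic_on_subset)
  define F2 where "F2 = (\<lambda>z. blaschke \<nu> z * F3 z)"
  have F2: "F2 holomorphic_on ball 0 1" unfolding F2_def by (intro holomorphic_intros F3 hol b)
  have F2_le: "norm (F2 z) \<le> 1" if "z \<in> ball 0 1" for z
    unfolding F2_def norm_mult using F3(3)[OF that] norm_blaschke_cball[OF l1, of z] that by (intro mult_le_one) auto
  have F2_eq: "F2 z = f2 z + \<Theta> z * q3 z" if "z \<in> ball 0 1" for z
    using F3(4)[OF that] f3(2)[of z] that by (simp add: F2_def \<Theta>_def algebra_simps)
  note Moeb = norm_Moebius_le[OF F2_le c1]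
  show ?case
  proof (intro exI conjI ballI)
    show "(\<lambda>z. (F2 z + c) / (1 + cnj c * F2 z)) holomorphic_on ball 0 1"
      using Moeb(2) by (intro holomorphic_intros F2) auto
    show "(\<lambda>z. (q3 z * (1 - cnj c * f z) - (f z - c) * \<alpha> z) / (1 + cnj c * F2 z)) holomorphic_on ball 0 1"
      using Moeb(2) by (intro holomorphic_intros F2 F3 hol[OF f] hol[OF ab(1)]) auto
    fix z :: complex assume z: "z \<in> ball 0 1"
    show "norm ((F2 z + c) / (1 + cnj c * F2 z)) \<le> 1" by (rule Moeb(1)[OF z])
    have ab': "(1 - cnj c * f z) * \<beta> z = 1 - \<Theta> z * \<alpha> z" using ab(3)[of z] z by (simp add: algebra_simps)
    \<comment> \<open>Modulo \<open>\<Theta>\<close>, \<open>F2\<close> is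
      \<open>(f - c) * \<beta>\<close> and \<open>(1 - cnj c * f) * \<beta>\<close> is 1, so undoing
      the Moebius transform leads back to \<open>f\<close>; the computation makes the multiple of
      \<open>\<Theta>\<close> explicit.\<close>
    have "F2 z + c - f z * (1 + cnj c * F2 z) = F2 z * (1 - cnj c * f z) - (f z - c)" by (simp add: algebra_simps)
    also have "\<dots> = (f z - c) * ((1 - cnj c * f z) * \<beta> z) + \<Theta> z * q3 z * (1 - cnj c * f z) - (f z - c)"
      unfolding F2_eq[OF z] f2_def by (simp add: algebra_simps)
    also have "\<dots> = \<Theta> z * (q3 z * (1 - cnj c * f z) - (f z - c) * \<alpha> z)"
      unfolding ab' by (simp add: algebra_simps)
    finally show "(F2 z + c) / (1 + cnj c * F2 z) = f z + bprod (\<nu> # zs) z * ((q3 z * (1 - cnj c * f z) - (f z - c) * \<alpha> z) / (1 + cnj c * F2 z))"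
      using Moeb(2)[OF z] unfolding \<Theta>_def[symmetric] by (simp add: divide_simps) (simp add: algebra_simps)
  qed
qed

section \<open>Finitely many nodes with uniform bounds\<close>

text \<open>For an infinite index set the value is 1 by default; thus the bounds 0 and 1 for its
  modulus hold for all sets, as \<open>gliding_hump\<close> demands, and multiplicativity is used
  for finite ones.\<close>

definition Bp :: "(nat \<Rightarrow> complex list) \<Rightarrow> nat set \<Rightarrow> complex \<Rightarrow> complex" where
  "Bp Z S z = (\<Prod>n\<in>S. bprod (Z n) z)"

lemma Bp_union_disjoint: "finite S \<Longrightarrow> finite T \<Longrightarrow> S \<inter> T = {} \<Longrightarrow> Bp Z (S \<union> T) z = Bp Z S z * Bp Z T z"
  unfolding Bp_def by (rule prod.union_disjoint)

lemma Bp_remove: "finite S \<Longrightarrow> n \<in> S \<Longrightarrow> Bp Z S z = bprod (Z n) z * Bp Z (S - {n}) z"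
  unfolding Bp_def by (rule prod.remove)

lemma Bp_eq_bprod:
  assumes "finite S" "\<And>n. set (Z n) \<subseteq> ball 0 1"
  obtains zs where "set zs \<subseteq> ball 0 1" "bprod zs = Bp Z S" "set zs = (\<Union>n\<in>S. set (Z n))"
proof -
  have "\<exists>zs. set zs \<subseteq> ball 0 1 \<and> bprod zs = Bp Z S \<and> set zs = (\<Union>n\<in>S. set (Z n))"
    using assms(1)
  proof induction
    case empty
    show ?case by (rule exI[of _ "[]"]) (auto simp: Bp_def)
  next
    case (insert n S)
    then obtain zs where zs: "set zs \<subseteq> ball 0 1" "bprod zs = Bp Z S" "set zs = (\<Union>n\<in>S. set (Z n))" by blast
    show ?case
      by (rule exI[of _ "Z n @ zs"]) (use zs insert.hyps assms(2) in \<open>auto simp: Bp_def\<close>)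
  qed
  thus ?thesis using that by blast
qed

section \<open>Idempotents modulo a product of Blaschke products\<close>

context
  fixes Z :: "nat \<Rightarrow> complex list" and N :: nat and \<alpha> \<beta> :: "nat \<Rightarrow> complex \<Rightarrow> complex"
  assumes Z: "\<And>n. set (Z n) \<subseteq> ball 0 1"
    and ab: "\<And>n. n < N \<Longrightarrow> disc_analytic (\<alpha> n)" "\<And>n. n < N \<Longrightarrow> disc_analytic (\<beta> n)"
    and bezout: "\<And>n z. n < N \<Longrightarrow> z \<in> cball 0 1 \<Longrightarrow>
      bprod (Z n) z * \<alpha> n z + Bp Z ({..<N} - {n}) z * \<beta> n z = 1"
begin

text \<open>Congruent to 1 modulo the factor of index \<open>n\<close> and to 0 modulo the other
  factors, as in the Chinese remainder theorem.\<close>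

definition idem :: "nat \<Rightarrow> complex \<Rightarrow> complex" where
  "idem n z = Bp Z ({..<N} - {n}) z * \<beta> n z"

abbreviation (input) "\<Theta> \<equiv> Bp Z {..<N}"

lemma Bp_analytic: "disc_analytic (Bp Z S)"
  unfolding Bp_def[abs_def] by (intro analytic_intros Z)

lemma idem_analytic: "n < N \<Longrightarrow> disc_analytic (idem n)"
  unfolding idem_def[abs_def] by (intro analytic_intros Bp_analytic ab)

lemma sum_idem_analytic: "S \<subseteq> {..<N} \<Longrightarrow> disc_analytic (\<lambda>z. \<Sum>n\<in>S. idem n z)"
  by (intro analytic_intros idem_analytic) auto

lemma one_minus_idem: "n < N \<Longrightarrow> z \<in> cball 0 1 \<Longrightarrow> 1 - idem n z = bprod (Z n) z * \<alpha> n z"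
  using bezout[of n z] by (simp add: idem_def algebra_simps)

lemma idem_orthogonal:
  assumes "n < N" "m < N" "n \<noteq> m"
  shows "cgr \<Theta> (\<lambda>z. idem n z * idem m z) (\<lambda>_. 0)"
proof (rule cgrI)
  show "disc_analytic (\<lambda>z. Bp Z ({..<N} - {m} - {n}) z * \<beta> n z * \<beta> m z)"
    by (intro analytic_intros Bp_analytic ab assms)
  fix z :: complex
  have "Bp Z ({..<N} - {m}) z = bprod (Z n) z * Bp Z ({..<N} - {m} - {n}) z"
    using assms by (intro Bp_remove) auto
  moreover have "\<Theta> z = bprod (Z n) z * Bp Z ({..<N} - {n}) z"
    using assms by (intro Bp_remove) auto
  ultimately show "idem n z * idem m z = 0 + \<Theta> z * (Bp Z ({..<N} - {m} - {n}) z * \<beta> n z * \<beta> m z)"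
    by (simp add: idem_def)
qed

lemma idem_idem:
  assumes "n < N"
  shows "cgr \<Theta> (\<lambda>z. idem n z * idem n z) (idem n)"
proof (rule cgrI)
  show "disc_analytic (\<lambda>z. - \<alpha> n z * \<beta> n z)" by (intro analytic_intros ab assms)
  fix z :: complex assume z: "z \<in> cball 0 1"
  have "\<Theta> z = bprod (Z n) z * Bp Z ({..<N} - {n}) z"
    using assms by (intro Bp_remove) auto
  hence "idem n z * (1 - idem n z) = \<Theta> z * (\<alpha> n z * \<beta> n z)"
    unfolding one_minus_idem[OF assms z] by (simp add: idem_def)
  thus "idem n z * idem n z = idem n z + \<Theta> z * (- \<alpha> n z * \<beta> n z)" by (simp add: algebra_simps)
qed

text \<open>Orthogonality removes the mixed products. The point of the product form is that each
  \<open>1 - idem n\<close> is divisible by \<open>bprod (Z n)\<close>; hence \<open>1\<close> minus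
  the sum is divisible by \<open>Bp Z S\<close>, which \<open>sum_idem_one\<close> extracts.\<close>

lemma prod_one_minus_idem:
  assumes "S \<subseteq> {..<N}"
  shows "cgr \<Theta> (\<lambda>z. \<Prod>n\<in>S. 1 - idem n z) (\<lambda>z. 1 - (\<Sum>n\<in>S. idem n z))"
proof -
  have "finite S" using assms finite_subset by blast
  thus ?thesis using assms
  proof induction
    case empty
    show ?case by (rule cgr_refl) simp
  next
    case (insert m S)
    hence mS: "m < N" "S \<subseteq> {..<N}" "m \<notin> S" by auto
    have 1: "cgr \<Theta> (\<lambda>z. (1 - idem m z) * (\<Prod>n\<in>S. 1 - idem n z)) (\<lambda>z. (1 - idem m z) * (1 - (\<Sum>n\<in>S. idem n z)))"
      using insert.IH[OF mS(2)] by (rule cgr_mult) (intro analytic_intros idem_analytic mS)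
    have 2: "cgr \<Theta> (\<lambda>z. 1 - (\<Sum>n\<in>insert m S. idem n z) + (\<Sum>n\<in>S. idem m z * idem n z))
        (\<lambda>z. 1 - (\<Sum>n\<in>insert m S. idem n z) + (\<Sum>n\<in>S. 0))"
      using mS by (intro cgr_add cgr_sum idem_orthogonal) (auto intro: cgr_refl)
    have eq: "(1 - a) * (1 - s) = 1 - (a + s) + a * s" for a s :: complex by (simp add: algebra_simps)
    have 3: "(1 - idem m z) * (1 - (\<Sum>n\<in>S. idem n z)) =
        1 - (\<Sum>n\<in>insert m S. idem n z) + (\<Sum>n\<in>S. idem m z * idem n z)" for z
      unfolding eq sum_distrib_left[symmetric] using insert.hyps by simp
    have "cgr \<Theta> (\<lambda>z. (1 - idem m z) * (\<Prod>n\<in>S. 1 - idem n z)) (\<lambda>z. 1 - (\<Sum>n\<in>insert m S. idem n z) + (\<Sum>n\<in>S. 0))"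
      using 1 unfolding 3 by (rule cgr_trans[OF _ 2])
    thus ?case using insert.hyps by simp
  qed
qed

lemma sum_idem_divisible:
  assumes S: "S \<subseteq> {..<N}"
  obtains v where "disc_analytic v" "\<And>z. z \<in> cball 0 1 \<Longrightarrow> (\<Sum>n\<in>S. idem n z) = Bp Z ({..<N} - S) z * v z"
proof
  show "disc_analytic (\<lambda>z. \<Sum>n\<in>S. Bp Z (S - {n}) z * \<beta> n z)"
    using S by (intro analytic_intros Bp_analytic ab) auto
  fix z :: complex
  have fin: "finite S" using S finite_subset by blast
  have "idem n z = Bp Z ({..<N} - S) z * (Bp Z (S - {n}) z * \<beta> n z)" if "n \<in> S" for n
  proof -
    have "{..<N} - {n} = ({..<N} - S) \<union> (S - {n})" using that S by auto
    hence "Bp Z ({..<N} - {n}) z = Bp Z ({..<N} - S) z * Bp Z (S - {n}) z"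
      using fin by (simp only:) (rule Bp_union_disjoint, auto)
    thus ?thesis by (simp add: idem_def)
  qed
  thus "(\<Sum>n\<in>S. idem n z) = Bp Z ({..<N} - S) z * (\<Sum>n\<in>S. Bp Z (S - {n}) z * \<beta> n z)"
    unfolding sum_distrib_left by (intro sum.cong) auto
qed

lemma sum_idem_one:
  assumes S: "S \<subseteq> {..<N}"
  obtains u where "disc_analytic u" "\<And>z. z \<in> cball 0 1 \<Longrightarrow> (\<Sum>n\<in>S. idem n z) = 1 + Bp Z S z * u z"
proof -
  obtain r where r: "disc_analytic r" "\<And>z. z \<in> cball 0 1 \<Longrightarrow> (\<Prod>n\<in>S. 1 - idem n z) = 1 - (\<Sum>n\<in>S. idem n z) + \<Theta> z * r z"
    using prod_one_minus_idem[OF S] unfolding cgr_def by blast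
  have fin: "finite S" using S finite_subset by blast
  show ?thesis
  proof
    show "disc_analytic (\<lambda>z. Bp Z ({..<N} - S) z * r z - (\<Prod>n\<in>S. \<alpha> n z))"
      using S by (intro analytic_intros Bp_analytic r ab) auto
    fix z :: complex assume z: "z \<in> cball 0 1"
    have "(\<Prod>n\<in>S. 1 - idem n z) = (\<Prod>n\<in>S. bprod (Z n) z * \<alpha> n z)"
      using S z by (intro prod.cong one_minus_idem) auto
    also have "\<dots> = Bp Z S z * (\<Prod>n\<in>S. \<alpha> n z)" by (simp add: Bp_def prod.distrib)
    finally have 1: "(\<Prod>n\<in>S. 1 - idem n z) = Bp Z S z * (\<Prod>n\<in>S. \<alpha> n z)" .
    have "S \<union> ({..<N} - S) = {..<N}" using S by auto
    hence "\<Theta> z = Bp Z S z * Bp Z ({..<N} - S) z"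
      using Bp_union_disjoint[OF fin, of "{..<N} - S" Z z] by auto
    thus "(\<Sum>n\<in>S. idem n z) = 1 + Bp Z S z * (Bp Z ({..<N} - S) z * r z - (\<Prod>n\<in>S. \<alpha> n z))"
      using r(2)[OF z] unfolding 1 by (simp add: algebra_simps)
  qed
qed

text \<open>Modulo \<open>\<Theta>\<close> the sum over \<open>S\<close> annihilates multiples of
  \<open>Bp Z S\<close> and fixes multiples of the complementary product. Applied to the corona
  decomposition of \<open>x\<close> it leaves the second term, whose norm is that of
  \<open>g\<close>.\<close>

lemma qn_sum_idem_le:
  assumes C: "0 \<le> C" and corona: "\<And>S x. S \<subseteq> {..<N} \<Longrightarrow> disc_analytic x \<Longrightarrow>
      \<exists>f g. disc_analytic f \<and> disc_analytic g \<and> l2 g \<le> C * l2 x \<and>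
        (\<forall>z\<in>cball 0 1. x z = Bp Z S z * f z + Bp Z ({..<N} - S) z * g z)"
    and S: "S \<subseteq> {..<N}" and h: "disc_analytic h"
  shows "qn \<Theta> (\<lambda>z. (\<Sum>n\<in>S. idem n z) * h z) \<le> C\<^sup>2 * qn \<Theta> h"
proof (rule qn_contraction[OF Bp_analytic sum_idem_analytic[OF S] _ h])
  fix x assume x: "disc_analytic x"
  obtain f g where fg: "disc_analytic f" "disc_analytic g" "l2 g \<le> C * l2 x"
     "\<And>z. z \<in> cball 0 1 \<Longrightarrow> x z = Bp Z S z * f z + Bp Z ({..<N} - S) z * g z"
    using corona[OF S x] by blast
  obtain v where v: "disc_analytic v" "\<And>z. z \<in> cball 0 1 \<Longrightarrow> (\<Sum>n\<in>S. idem n z) = Bp Z ({..<N} - S) z * v z"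
    using sum_idem_divisible[OF S] by blast
  obtain u where u: "disc_analytic u" "\<And>z. z \<in> cball 0 1 \<Longrightarrow> (\<Sum>n\<in>S. idem n z) = 1 + Bp Z S z * u z"
    using sum_idem_one[OF S] by blast
  have fin: "finite S" using S finite_subset by blast
  have US: "S \<union> ({..<N} - S) = {..<N}" using S by auto
  have bg: "disc_analytic (\<lambda>z. Bp Z ({..<N} - S) z * g z)" by (intro analytic_intros Bp_analytic fg)
  have "qn \<Theta> (\<lambda>z. (\<Sum>n\<in>S. idem n z) * x z) = qn \<Theta> (\<lambda>z. Bp Z ({..<N} - S) z * g z)"
  proof (rule qn_cgr[OF Bp_analytic _ bg cgrI])
    show "disc_analytic (\<lambda>z. (\<Sum>n\<in>S. idem n z) * x z)"
      by (intro analytic_on_mult sum_idem_analytic S x)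
    show "disc_analytic (\<lambda>z. v z * f z + u z * g z)" by (intro analytic_intros u v fg)
    fix z :: complex assume z: "z \<in> cball 0 1"
    have \<Theta>: "\<Theta> z = Bp Z S z * Bp Z ({..<N} - S) z"
      using Bp_union_disjoint[OF fin, of "{..<N} - S" Z z] US by auto
    have "(\<Sum>n\<in>S. idem n z) * x z = (\<Sum>n\<in>S. idem n z) * (Bp Z S z * f z) + (\<Sum>n\<in>S. idem n z) * (Bp Z ({..<N} - S) z * g z)"
      unfolding fg(4)[OF z] by (simp add: algebra_simps)
    also have "(\<Sum>n\<in>S. idem n z) * (Bp Z S z * f z) = Bp Z ({..<N} - S) z * v z * (Bp Z S z * f z)"
      by (simp only: v(2)[OF z])
    also have "(\<Sum>n\<in>S. idem n z) * (Bp Z ({..<N} - S) z * g z) = (1 + Bp Z S z * u z) * (Bp Z ({..<N} - S) z * g z)"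
      by (simp only: u(2)[OF z])
    finally show "(\<Sum>n\<in>S. idem n z) * x z = Bp Z ({..<N} - S) z * g z + \<Theta> z * (v z * f z + u z * g z)"
      unfolding \<Theta> by (simp add: algebra_simps)
  qed
  also have "\<dots> \<le> sqn (\<lambda>z. Bp Z ({..<N} - S) z * g z)" by (rule qn_le_sqn[OF Bp_analytic bg])
  also have "\<dots> = sqn g"
    by (intro sqn_cong) (simp add: Bp_def norm_mult norm_bprod_circle[OF Z] flip: prod_norm)
  also have "\<dots> = (l2 g)\<^sup>2" by (simp add: l2_power2 continuous_on_analytic fg)
  also have "\<dots> \<le> (C * l2 x)\<^sup>2"
    using fg(3) by (intro power_mono l2_nonneg continuous_on_analytic fg)
  also have "\<dots> = C\<^sup>2 * sqn x" by (simp add: power_mult_distrib l2_power2 continuous_on_analytic x)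
  finally show "qn \<Theta> (\<lambda>z. (\<Sum>n\<in>S. idem n z) * x z) \<le> C\<^sup>2 * sqn x" .
qed simp

text \<open>A signed sum is the difference of the idempotents of two complementary sets; the
  parallelogram law bounds its square by twice the sum of theirs.\<close>

lemma qn_signs_idem_le:
  assumes C: "0 \<le> C" and corona: "\<And>S x. S \<subseteq> {..<N} \<Longrightarrow> disc_analytic x \<Longrightarrow>
      \<exists>f g. disc_analytic f \<and> disc_analytic g \<and> l2 g \<le> C * l2 x \<and>
        (\<forall>z\<in>cball 0 1. x z = Bp Z S z * f z + Bp Z ({..<N} - S) z * g z)"
    and s: "\<And>n. s n \<in> {1, - 1}" and h: "disc_analytic h"
  shows "qn \<Theta> (\<lambda>z. (\<Sum>n<N. s n * idem n z) * h z) \<le> 4 * C\<^sup>2 * qn \<Theta> h"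
proof -
  define S where "S = {n. n < N \<and> s n = 1}"
  have S: "S \<subseteq> {..<N}" "{..<N} - S \<subseteq> {..<N}" by (auto simp: S_def)
  define E where "E = (\<lambda>S z. (\<Sum>n\<in>S. idem n z) * h z)"
  have E: "disc_analytic (E T)" if "T \<subseteq> {..<N}" for T
    unfolding E_def by (intro analytic_on_mult sum_idem_analytic that h)
  have "(\<Sum>n<N. s n * idem n z) * h z = E S z - E ({..<N} - S) z" for z
  proof -
    have "(\<Sum>n<N. s n * idem n z) = (\<Sum>n\<in>{..<N} - S. s n * idem n z) + (\<Sum>n\<in>S. s n * idem n z)"
      using S by (intro sum.subset_diff) auto
    also have "(\<Sum>n\<in>S. s n * idem n z) = (\<Sum>n\<in>S. idem n z)" by (intro sum.cong) (auto simp: S_def)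
    also have "(\<Sum>n\<in>{..<N} - S. s n * idem n z) = - (\<Sum>n\<in>{..<N} - S. idem n z)"
      unfolding sum_negf[symmetric]
    proof (intro sum.cong refl)
      fix n assume "n \<in> {..<N} - S"
      hence "s n = - 1" using s[of n] by (auto simp: S_def)
      thus "s n * idem n z = - idem n z" by simp
    qed
    finally have sum: "(\<Sum>n<N. s n * idem n z) = (\<Sum>n\<in>S. idem n z) - (\<Sum>n\<in>{..<N} - S. idem n z)" by simp
    show ?thesis unfolding E_def sum by (rule left_diff_distrib)
  qed
  hence "qn \<Theta> (\<lambda>z. (\<Sum>n<N. s n * idem n z) * h z) = qn \<Theta> (\<lambda>z. E S z - E ({..<N} - S) z)" by simp
  moreover have "0 \<le> qn \<Theta> (\<lambda>z. E S z + E ({..<N} - S) z)"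
    by (intro qn_nonneg[OF Bp_analytic] analytic_intros E S)
  ultimately have "qn \<Theta> (\<lambda>z. (\<Sum>n<N. s n * idem n z) * h z) \<le> 2 * qn \<Theta> (E S) + 2 * qn \<Theta> (E ({..<N} - S))"
    using qn_parallelogram[OF Bp_analytic[of "{..<N}"] E[OF S(1)] E[OF S(2)]] by linarith
  also have "\<dots> \<le> 2 * (C\<^sup>2 * qn \<Theta> h) + 2 * (C\<^sup>2 * qn \<Theta> h)"
    unfolding E_def by (intro add_mono mult_left_mono qn_sum_idem_le[OF C corona] S h) auto
  finally show ?thesis by simp
qed

text \<open>Modulo \<open>\<Theta>\<close> the interpolant times \<open>h\<close> is \<open>(\<Sum>n<N. s n * idem n) * (\<Sum>n<N. s n * \<phi> n * idem n * h)\<close>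
  for all signs \<open>s\<close>. By the parallelogram law a suitable \<open>s\<close> makes the norm of the second factor at
  most the square sum of the norms of its terms.\<close>

lemma qn_interpolant_le:
  assumes C: "0 \<le> C" and corona: "\<And>S x. S \<subseteq> {..<N} \<Longrightarrow> disc_analytic x \<Longrightarrow>
      \<exists>f g. disc_analytic f \<and> disc_analytic g \<and> l2 g \<le> C * l2 x \<and>
        (\<forall>z\<in>cball 0 1. x z = Bp Z S z * f z + Bp Z ({..<N} - S) z * g z)"
    and \<phi>: "\<And>n. disc_analytic (\<phi> n)" "\<And>n z. z \<in> cball 0 1 \<Longrightarrow> norm (\<phi> n z) \<le> 1" and h: "disc_analytic h"
  shows "qn \<Theta> (\<lambda>z. (\<Sum>n<N. idem n z * \<phi> n z) * h z) \<le> (4 * C\<^sup>2)\<^sup>2 * qn \<Theta> h"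
proof -
  \<comment> \<open>Extended by 0 beyond \<open>N\<close>, because \<open>qn_choose_signs\<close>
    expects analytic functions at all indices.\<close>
  define e where "e n = (if n < N then idem n else (\<lambda>_. 0))" for n
  have e: "disc_analytic (e n)" for n by (auto simp: e_def idem_analytic)
  have e_eq: "e n = idem n" if "n < N" for n using that by (simp add: e_def)
  define x where "x = (\<lambda>n z. e n z * h z)"
  define y where "y = (\<lambda>n z. \<phi> n z * x n z)"
  have x: "disc_analytic (x n)" for n unfolding x_def by (intro analytic_intros e h)
  have y: "disc_analytic (y n)" for n unfolding y_def by (intro analytic_intros \<phi> x)
  obtain s where s0: "(\<forall>n. s n \<in> {1, - 1 :: complex}) \<and> qn \<Theta> (\<lambda>z. \<Sum>n<N. s n * y n z) \<le> (\<Sum>n<N. qn \<Theta> (y n))"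
    using qn_choose_signs(1)[OF Bp_analytic y] by (rule exE)
  obtain t where t0: "(\<forall>n. t n \<in> {1, - 1 :: complex}) \<and> (\<Sum>n<N. qn \<Theta> (x n)) \<le> qn \<Theta> (\<lambda>z. \<Sum>n<N. t n * x n z)"
    using qn_choose_signs(2)[OF Bp_analytic x] by (rule exE)
  note s = s0[THEN conjunct1, THEN spec] s0[THEN conjunct2]
  note t = t0[THEN conjunct1, THEN spec] t0[THEN conjunct2]
  have ss: "s n * s n = 1" for n using s(1)[of n] by auto
  have y_le: "qn \<Theta> (y n) \<le> qn \<Theta> (x n)" for n
    using qn_mult_le[OF Bp_analytic[of "{..<N}"] \<phi>(1)[of n] x[of n], of 1] \<phi>(2) unfolding y_def by simp
  have sy: "disc_analytic (\<lambda>z. \<Sum>n<N. s n * y n z)" by (intro analytic_intros y)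
  have "cgr \<Theta> (\<lambda>z. \<Sum>n<N. \<Sum>m<N. (s n * s m * (\<phi> m z * h z)) * (e n z * e m z))
      (\<lambda>z. \<Sum>n<N. \<Sum>m<N. (s n * s m * (\<phi> m z * h z)) * (if n = m then e n z else 0))"
  proof (intro cgr_sum)
    fix n m assume nm: "n \<in> {..<N}" "m \<in> {..<N}"
    show "cgr \<Theta> (\<lambda>z. (s n * s m * (\<phi> m z * h z)) * (e n z * e m z))
        (\<lambda>z. (s n * s m * (\<phi> m z * h z)) * (if n = m then e n z else 0))"
    proof (rule cgr_mult)
      show "cgr \<Theta> (\<lambda>z. e n z * e m z) (\<lambda>z. if n = m then e n z else 0)"
        using nm idem_idem[of n] idem_orthogonal[of n m] by (cases "n = m") (auto simp: e_eq)
    qed (intro analytic_intros \<phi> h)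
  qed
  moreover have "(\<lambda>z. \<Sum>n<N. \<Sum>m<N. (s n * s m * (\<phi> m z * h z)) * (e n z * e m z)) =
      (\<lambda>z. (\<Sum>n<N. s n * e n z) * (\<Sum>n<N. s n * y n z))"
    by (auto simp: sum_product y_def x_def mult_ac intro!: sum.cong)
  moreover have "(\<lambda>z. \<Sum>n<N. \<Sum>m<N. (s n * s m * (\<phi> m z * h z)) * (if n = m then e n z else 0)) = (\<lambda>z. \<Sum>n<N. y n z)"
    by (auto simp: y_def x_def if_distrib ss mult_ac cong: if_cong intro!: sum.cong)
  ultimately have cg: "cgr \<Theta> (\<lambda>z. (\<Sum>n<N. s n * e n z) * (\<Sum>n<N. s n * y n z)) (\<lambda>z. \<Sum>n<N. y n z)" by simp
  have "(\<lambda>z. (\<Sum>n<N. idem n z * \<phi> n z) * h z) = (\<lambda>z. \<Sum>n<N. y n z)"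
    unfolding sum_distrib_right y_def x_def by (intro ext sum.cong) (auto simp: e_eq)
  hence "qn \<Theta> (\<lambda>z. (\<Sum>n<N. idem n z * \<phi> n z) * h z) = qn \<Theta> (\<lambda>z. \<Sum>n<N. y n z)" by simp
  also have "\<dots> = qn \<Theta> (\<lambda>z. (\<Sum>n<N. s n * e n z) * (\<Sum>n<N. s n * y n z))"
    by (rule qn_cgr[OF Bp_analytic _ _ cgr_sym[OF cg]]) (intro analytic_intros y e)+
  also have "\<dots> = qn \<Theta> (\<lambda>z. (\<Sum>n<N. s n * idem n z) * (\<Sum>n<N. s n * y n z))" by (simp add: e_eq)
  also have "\<dots> \<le> 4 * C\<^sup>2 * qn \<Theta> (\<lambda>z. \<Sum>n<N. s n * y n z)"
    by (rule qn_signs_idem_le[OF C corona s(1) sy])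
  also have "\<dots> \<le> 4 * C\<^sup>2 * (4 * C\<^sup>2 * qn \<Theta> h)"
  proof (rule mult_left_mono)
    \<comment> \<open>Multiplication by \<open>\<phi> n\<close> increases no single term, so the
      data disappear from the square sum; other signs \<open>t\<close> turn the remaining sum back
      into a signed sum of idempotents.\<close>
    have "qn \<Theta> (\<lambda>z. \<Sum>n<N. s n * y n z) \<le> (\<Sum>n<N. qn \<Theta> (x n))"
      using s(2) sum_mono[of "{..<N}" "\<lambda>n. qn \<Theta> (y n)" "\<lambda>n. qn \<Theta> (x n)"] y_le by force
    also have "\<dots> \<le> qn \<Theta> (\<lambda>z. \<Sum>n<N. t n * x n z)" by (rule t(2))
    also have "(\<lambda>z. \<Sum>n<N. t n * x n z) = (\<lambda>z. (\<Sum>n<N. t n * idem n z) * h z)"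
      unfolding sum_distrib_right x_def by (intro ext sum.cong) (auto simp: e_eq)
    also have "qn \<Theta> \<dots> \<le> 4 * C\<^sup>2 * qn \<Theta> h" by (rule qn_signs_idem_le[OF C corona t(1) h])
    finally show "qn \<Theta> (\<lambda>z. \<Sum>n<N. s n * y n z) \<le> 4 * C\<^sup>2 * qn \<Theta> h" .
  qed simp
  finally show ?thesis by (simp add: power2_eq_square)
qed

lemma interpolant_divisible:
  assumes \<phi>: "\<And>n. disc_analytic (\<phi> n)" and n: "n < N"
  shows "\<exists>q. disc_analytic q \<and> (\<forall>z\<in>cball 0 1. (\<Sum>m<N. idem m z * \<phi> m z) = \<phi> n z + bprod (Z n) z * q z)"
proof (intro exI conjI ballI)
  show "disc_analytic (\<lambda>z. (\<Sum>m\<in>{..<N} - {n}. Bp Z ({..<N} - {m} - {n}) z * \<beta> m z * \<phi> m z) - \<alpha> n z * \<phi> n z)"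
    using n by (intro analytic_intros Bp_analytic \<phi> ab) auto
  fix z :: complex assume z: "z \<in> cball 0 1"
  have "(\<Sum>m<N. idem m z * \<phi> m z) = idem n z * \<phi> n z + (\<Sum>m\<in>{..<N} - {n}. idem m z * \<phi> m z)"
    using n by (intro sum.remove) auto
  also have "(\<Sum>m\<in>{..<N} - {n}. idem m z * \<phi> m z) =
      (\<Sum>m\<in>{..<N} - {n}. bprod (Z n) z * (Bp Z ({..<N} - {m} - {n}) z * \<beta> m z * \<phi> m z))"
  proof (intro sum.cong refl)
    fix m assume m: "m \<in> {..<N} - {n}"
    have "Bp Z ({..<N} - {m}) z = bprod (Z n) z * Bp Z ({..<N} - {m} - {n}) z"
      using m n by (intro Bp_remove) auto
    thus "idem m z * \<phi> m z = bprod (Z n) z * (Bp Z ({..<N} - {m} - {n}) z * \<beta> m z * \<phi> m z)"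
      by (simp add: idem_def)
  qed
  also have "idem n z * \<phi> n z = \<phi> n z - bprod (Z n) z * \<alpha> n z * \<phi> n z"
  proof -
    have eq: "idem n z = 1 - bprod (Z n) z * \<alpha> n z"
      using one_minus_idem[OF n z] by (simp add: algebra_simps)
    show ?thesis unfolding eq by (simp add: left_diff_distrib)
  qed
  finally show "(\<Sum>m<N. idem m z * \<phi> m z) = \<phi> n z + bprod (Z n) z *
     ((\<Sum>m\<in>{..<N} - {n}. Bp Z ({..<N} - {m} - {n}) z * \<beta> m z * \<phi> m z) - \<alpha> n z * \<phi> n z)"
    by (simp add: sum_distrib_left algebra_simps)
qed

end

text \<open>The constant is chosen before the number of nodes, the zeros and the data. The
  interpolant built from idempotents comes without a supremum bound, but its action on the quotient
  is bounded, and the lifting alters it only by a multiple of the full product.\<close>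

lemma finite_interpolation:
  assumes \<delta>: "0 < \<delta>" "\<delta> \<le> 1"
  shows "\<exists>C>0. \<forall>N Z \<phi>. (\<forall>n. set (Z n) \<subseteq> ball 0 1) \<and> (\<forall>n. disc_analytic (\<phi> n)) \<and>
      (\<forall>n. \<forall>z\<in>cball 0 1. norm (\<phi> n z) \<le> 1) \<and>
      (\<forall>z\<in>ball 0 1. \<exists>n. \<delta> \<le> norm (Bp Z ({..<N} - {n}) z)) \<longrightarrow>
      (\<exists>F. F holomorphic_on ball 0 1 \<and> (\<forall>z\<in>ball 0 1. norm (F z) \<le> C) \<and>
        (\<forall>n<N. \<exists>q. q holomorphic_on ball 0 1 \<and> (\<forall>z\<in>ball 0 1. F z = \<phi> n z + bprod (Z n) z * q z)))"
proof -
  have "0 < \<delta>\<^sup>2" "\<delta>\<^sup>2 \<le> 1" using \<delta> by (auto simp: power_le_one)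
  from H2_corona[OF this] obtain C0 where C0: "0 < C0"
    "\<And>zs ws x. set zs \<subseteq> ball 0 1 \<Longrightarrow> set ws \<subseteq> ball 0 1 \<Longrightarrow> disc_analytic x \<Longrightarrow>
    (\<And>z. z \<in> ball 0 1 \<Longrightarrow> \<delta>\<^sup>2 \<le> (norm (bprod zs z))\<^sup>2 + (norm (bprod ws z))\<^sup>2) \<Longrightarrow>
    \<exists>f g. disc_analytic f \<and> disc_analytic g \<and> l2 g \<le> C0 * l2 x \<and>
      (\<forall>z\<in>cball 0 1. x z = bprod zs z * f z + bprod ws z * g z)" by metis
  \<comment> \<open>The interpolant acts on the quotient with norm at most \<open>4 * C0^2\<close>;
    the added 1 makes the scaled function a strict contraction, as the Schur algorithm
    requires.\<close>
  define M where "M = 4 * C0\<^sup>2 + 1"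
  have M: "0 < M" "4 * C0\<^sup>2 < M" by (auto simp: M_def add_nonneg_pos)
  show ?thesis
  proof (intro exI[of _ M] conjI allI impI)
    show "0 < M" by fact
    fix N Z and \<phi> :: "nat \<Rightarrow> complex \<Rightarrow> complex"
    assume hyps: "(\<forall>n. set (Z n) \<subseteq> ball 0 1) \<and> (\<forall>n. disc_analytic (\<phi> n)) \<and>
      (\<forall>n. \<forall>z\<in>cball 0 1. norm (\<phi> n z) \<le> 1) \<and>
      (\<forall>z\<in>ball 0 1. \<exists>n. \<delta> \<le> norm (Bp Z ({..<N} - {n}) z))"
    have Z: "\<And>n. set (Z n) \<subseteq> ball 0 1" and \<phi>: "\<And>n. disc_analytic (\<phi> n)" "\<And>n z. z \<in> cball 0 1 \<Longrightarrow> norm (\<phi> n z) \<le> 1"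
      and sep: "\<And>z. z \<in> ball 0 1 \<Longrightarrow> \<exists>n. \<delta> \<le> norm (Bp Z ({..<N} - {n}) z)"
      using hyps by blast+
    have Bp_an: "disc_analytic (Bp Z S)" for S unfolding Bp_def[abs_def] by (intro analytic_intros Z)
    \<comment> \<open>The exceptional index \<open>n\<close> belongs to at most one of
      \<open>S\<close> and its complement. The product over the other one consists of factors of the
      product without \<open>n\<close> and dominates it.\<close>
    have sep2: "\<delta> \<le> norm (Bp Z S z) \<or> \<delta> \<le> norm (Bp Z ({..<N} - S) z)" if S: "S \<subseteq> {..<N}" and z: "z \<in> ball 0 1" for S z
    proof -
      obtain n where n: "\<delta> \<le> norm (Bp Z ({..<N} - {n}) z)" using sep[OF z] by blast
      have mono: "norm (Bp Z ({..<N} - {n}) z) \<le> norm (Bp Z T z)" if T: "T \<subseteq> {..<N} - {n}" for T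
      proof -
        have "norm (Bp Z ({..<N} - {n}) z) = norm (Bp Z ({..<N} - {n} - T) z) * norm (Bp Z T z)"
          unfolding Bp_def using T by (simp add: prod.subset_diff[OF T] norm_mult)
        also have "norm (Bp Z ({..<N} - {n} - T) z) \<le> 1"
          unfolding Bp_def prod_norm[symmetric] using norm_bprod_le_1[OF Z, of z] z by (intro prod_le_1) auto
        finally show ?thesis by (simp add: mult_right_mono mult_left_le_one_le)
      qed
      show ?thesis
      proof (cases "n \<in> S")
        case True
        hence "{..<N} - S \<subseteq> {..<N} - {n}" by auto
        from mono[OF this] n show ?thesis by auto
      next
        case False
        hence "S \<subseteq> {..<N} - {n}" using S by auto
        from mono[OF this] n show ?thesis by auto
      qed
    qed
    have corona: "\<exists>f g. disc_analytic f \<and> disc_analytic g \<and> l2 g \<le> C0 * l2 x \<and>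
        (\<forall>z\<in>cball 0 1. x z = Bp Z S z * f z + Bp Z ({..<N} - S) z * g z)"
      if S: "S \<subseteq> {..<N}" and x: "disc_analytic x" for S x
    proof -
      have fin: "finite S" "finite ({..<N} - S)" using S finite_subset by auto
      obtain zs where zs: "set zs \<subseteq> ball 0 1" "bprod zs = Bp Z S" by (rule Bp_eq_bprod[OF fin(1) Z])
      obtain ws where ws: "set ws \<subseteq> ball 0 1" "bprod ws = Bp Z ({..<N} - S)" by (rule Bp_eq_bprod[OF fin(2) Z])
      have "\<delta>\<^sup>2 \<le> (norm (Bp Z S z))\<^sup>2 + (norm (Bp Z ({..<N} - S) z))\<^sup>2" if "z \<in> ball 0 1" for z
        using sep2[OF S that]
      proof
        assume "\<delta> \<le> norm (Bp Z S z)"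
        hence "\<delta>\<^sup>2 \<le> (norm (Bp Z S z))\<^sup>2" using \<delta> by (intro power_mono) auto
        thus ?thesis by (simp add: add_increasing2)
      next
        assume "\<delta> \<le> norm (Bp Z ({..<N} - S) z)"
        hence "\<delta>\<^sup>2 \<le> (norm (Bp Z ({..<N} - S) z))\<^sup>2" using \<delta> by (intro power_mono) auto
        thus ?thesis by (simp add: add_increasing)
      qed
      thus ?thesis using C0(2)[OF zs(1) ws(1) x] unfolding zs(2) ws(2) by blast
    qed
    have "\<exists>\<alpha> \<beta>. disc_analytic \<alpha> \<and> disc_analytic \<beta> \<and>
       (\<forall>z\<in>cball 0 1. bprod (Z n) z * \<alpha> z + Bp Z ({..<N} - {n}) z * \<beta> z = 1)" if n: "n < N" for n
    proof (rule bprod_bezout[OF Z Bp_an])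
      \<comment> \<open>At a zero of \<open>bprod (Z n)\<close> the lower bound must come from the
        complementary product: separation forces the zeros of different indices below
        \<open>N\<close> to be disjoint.\<close>
      fix c assume c: "c \<in> set (Z n)"
      hence c1: "c \<in> ball 0 1" using Z[of n] by auto
      have "bprod (Z n) c = 0" using bprod_eq_0_iff[OF Z, of c n] c c1 by auto
      hence "Bp Z {n} c = 0" by (simp add: Bp_def)
      with sep2[of "{n}" c] n c1 \<delta> show "Bp Z ({..<N} - {n}) c \<noteq> 0" by auto
    qed
    then obtain \<alpha> \<beta> where ab: "\<And>n. n < N \<Longrightarrow> disc_analytic (\<alpha> n)" "\<And>n. n < N \<Longrightarrow> disc_analytic (\<beta> n)"
       "\<And>n z. n < N \<Longrightarrow> z \<in> cball 0 1 \<Longrightarrow> bprod (Z n) z * \<alpha> n z + Bp Z ({..<N} - {n}) z * \<beta> n z = 1"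
      by metis
    note ctxt = Z ab
    define f where "f = (\<lambda>z. \<Sum>n<N. idem Z N \<beta> n z * \<phi> n z)"
    have f: "disc_analytic f" unfolding f_def
      by (intro analytic_intros \<phi> idem_analytic[OF ctxt]) auto
    obtain zs where zs: "set zs \<subseteq> ball 0 1" "bprod zs = Bp Z {..<N}"
      by (rule Bp_eq_bprod[OF finite_lessThan Z])
    have "\<exists>F q. F holomorphic_on ball 0 1 \<and> q holomorphic_on ball 0 1 \<and>
           (\<forall>z\<in>ball 0 1. norm (F z) \<le> 1 \<and> F z = of_real (1 / M) * f z + bprod zs z * q z)"
    proof (rule Schur_algorithm[OF zs(1)])
      show "disc_analytic (\<lambda>z. of_real (1 / M) * f z)" by (intro analytic_intros f)
      show "0 \<le> (4 * C0\<^sup>2 / M)\<^sup>2" by simp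
      show "(4 * C0\<^sup>2 / M)\<^sup>2 < 1" using M by (simp add: power_less_one_iff abs_square_less_1)
      fix h assume h: "disc_analytic h"
      have "qn (bprod zs) (\<lambda>z. of_real (1 / M) * f z * h z) = qn (bprod zs) (\<lambda>z. of_real (1 / M) * (f z * h z))"
        by (simp add: mult.assoc)
      also have "\<dots> \<le> (norm (complex_of_real (1 / M)))\<^sup>2 * qn (bprod zs) (\<lambda>z. f z * h z)"
        unfolding zs by (intro qn_cmul_le Bp_an analytic_intros f h)
      also have "\<dots> \<le> (norm (complex_of_real (1 / M)))\<^sup>2 * ((4 * C0\<^sup>2)\<^sup>2 * qn (bprod zs) h)"
        unfolding zs f_def using C0(1)
        by (intro mult_left_mono qn_interpolant_le[OF ctxt _ corona \<phi> h]) auto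
      also have "\<dots> = (4 * C0\<^sup>2 / M)\<^sup>2 * qn (bprod zs) h"
        using M by (simp add: power_divide norm_divide)
      finally show "qn (bprod zs) (\<lambda>z. of_real (1 / M) * f z * h z) \<le> (4 * C0\<^sup>2 / M)\<^sup>2 * qn (bprod zs) h" .
    qed
    then obtain F q where F: "F holomorphic_on ball 0 1" "q holomorphic_on ball 0 1"
      "\<And>z. z \<in> ball 0 1 \<Longrightarrow> norm (F z) \<le> 1" "\<And>z. z \<in> ball 0 1 \<Longrightarrow> F z = of_real (1 / M) * f z + bprod zs z * q z" by blast
    have hol: "w holomorphic_on ball 0 1" if "disc_analytic w" for w
      using that by (meson analytic_imp_holomorphic ball_subset_cball holomorphic_on_subset)
    show "\<exists>F. F holomorphic_on ball 0 1 \<and> (\<forall>z\<in>ball 0 1. norm (F z) \<le> M) \<and>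
        (\<forall>n<N. \<exists>q. q holomorphic_on ball 0 1 \<and> (\<forall>z\<in>ball 0 1. F z = \<phi> n z + bprod (Z n) z * q z))"
    proof (rule exI[of _ "\<lambda>z. of_real M * F z"], intro conjI ballI allI impI)
      show "(\<lambda>z. of_real M * F z) holomorphic_on ball 0 1" by (intro holomorphic_intros F)
      show "norm (of_real M * F z) \<le> M" if "z \<in> ball 0 1" for z
        using F(3)[OF that] M by (simp add: norm_mult mult_left_le)
      fix n assume n: "n < N"
      have "\<exists>r. disc_analytic r \<and> (\<forall>z\<in>cball 0 1. f z = \<phi> n z + bprod (Z n) z * r z)"
        unfolding f_def
        by (rule interpolant_divisible[where \<phi> = \<phi>, OF ctxt \<phi>(1) n])
      then obtain r where r: "disc_analytic r" "\<And>z. z \<in> cball 0 1 \<Longrightarrow> f z = \<phi> n z + bprod (Z n) z * r z"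
        by blast
      show "\<exists>q. q holomorphic_on ball 0 1 \<and> (\<forall>z\<in>ball 0 1. of_real M * F z = \<phi> n z + bprod (Z n) z * q z)"
      proof (intro exI conjI ballI)
        show "(\<lambda>z. r z + of_real M * (Bp Z ({..<N} - {n}) z * q z)) holomorphic_on ball 0 1"
          by (intro holomorphic_intros hol Bp_an r F)
        fix z :: complex assume z: "z \<in> ball 0 1"
        have "of_real M * F z = f z + of_real M * (Bp Z {..<N} z * q z)"
          using M unfolding F(4)[OF z] zs by (simp add: algebra_simps)
        also have "Bp Z {..<N} z = bprod (Z n) z * Bp Z ({..<N} - {n}) z"
          using n by (intro Bp_remove) auto
        finally show "of_real M * F z = \<phi> n z + bprod (Z n) z * (r z + of_real M * (Bp Z ({..<N} - {n}) z * q z))"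
          using r(2)[of z] z by (simp add: algebra_simps)
      qed
    qed
  qed
qed

section \<open>Functions of matrices\<close>

lemma bprod_replicate: "bprod (replicate m a) z = blaschke a z ^ m"
  by (induction m) auto

lemma bprod_holomorphic: "set zs \<subseteq> ball 0 1 \<Longrightarrow> bprod zs holomorphic_on ball 0 1"
  using bprod_analytic[of zs] by (meson analytic_imp_holomorphic ball_subset_cball holomorphic_on_subset)

text \<open>Away from \<open>w\<close> the factor can be divided out; at \<open>w\<close>, where it
  vanishes, continuity gives the equality.\<close>

lemma blaschke_cancel:
  assumes x: "x holomorphic_on ball 0 1" and y: "y holomorphic_on ball 0 1" and w: "norm w < 1"
    and eq: "\<And>z. z \<in> ball 0 1 \<Longrightarrow> blaschke w z * x z = blaschke w z * y z" and z: "z \<in> ball 0 1"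
  shows "x z = y z"
proof (cases "z = w")
  case False
  hence "blaschke w z \<noteq> 0" using blaschke_eq_0_iff[OF w, of z] z by auto
  thus ?thesis using eq[OF z] by simp
next
  case True
  have "(x \<longlongrightarrow> x w) (at w)" "(y \<longlongrightarrow> y w) (at w)"
    using x y w by (auto simp: isCont_def[symmetric] intro!: holomorphic_on_imp_continuous_on
         continuous_on_interior[of "ball 0 1"])
  moreover have "eventually (\<lambda>z. x z = y z) (at w)"
  proof -
    have "eventually (\<lambda>z. z \<in> ball 0 1) (at w)" using w by (intro eventually_at_in_open') auto
    moreover have "eventually (\<lambda>z. z \<noteq> w) (at w)" by (simp add: eventually_at_filter)
    ultimately show ?thesis
    proof eventually_elim
      case (elim u)
      hence "blaschke w u \<noteq> 0" using blaschke_eq_0_iff[OF w, of u] by auto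
      thus ?case using eq[of u] elim by simp
    qed
  qed
  ultimately have "x w = y w"
    by (metis tendsto_unique at_neq_bot tendsto_cong)
  thus ?thesis using True by simp
qed

text \<open>Each zero of \<open>ws\<close> is a zero of \<open>q\<close>, because
  \<open>bprod zs\<close> does not vanish there; it is split off from \<open>q\<close> and cancelled
  from both sides.\<close>

lemma bprod_coprime_divide:
  assumes "set zs \<subseteq> ball 0 1" "set ws \<subseteq> ball 0 1" "set zs \<inter> set ws = {}"
    and "q holomorphic_on ball 0 1" "p holomorphic_on ball 0 1"
    and "\<And>z. z \<in> ball 0 1 \<Longrightarrow> bprod zs z * q z = bprod ws z * p z"
  shows "\<exists>r. r holomorphic_on ball 0 1 \<and> (\<forall>z\<in>ball 0 1. q z = bprod ws z * r z)"
  using assms(2-)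
proof (induction ws arbitrary: q p)
  case Nil
  thus ?case by auto
next
  case (Cons w ws)
  have w: "norm w < 1" "w \<notin> set zs" using Cons.prems by auto
  have "bprod zs w \<noteq> 0" using bprod_eq_0_iff[OF assms(1), of w] w by auto
  moreover have "bprod (w # ws) w = 0" using w by (simp add: blaschke_def)
  ultimately have "q w = 0" using Cons.prems(5)[of w] w by auto
  then obtain q' where q': "q' holomorphic_on ball 0 1" "\<And>z. z \<in> ball 0 1 \<Longrightarrow> q z = blaschke w z * q' z"
    using blaschke_divide[of "ball 0 1" w q] w Cons.prems(3) by (metis dist_0_norm less_imp_le mem_ball open_ball)
  have "bprod zs z * q' z = bprod ws z * p z" if z: "z \<in> ball 0 1" for z
  proof (rule blaschke_cancel[OF _ _ w(1) _ z])
    show "(\<lambda>z. bprod zs z * q' z) holomorphic_on ball 0 1" "(\<lambda>z. bprod ws z * p z) holomorphic_on ball 0 1"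
      using Cons.prems assms(1) by (auto intro!: holomorphic_intros bprod_holomorphic q')
    show "blaschke w z * (bprod zs z * q' z) = blaschke w z * (bprod ws z * p z)" if "z \<in> ball 0 1" for z
      using Cons.prems(5)[OF that] q'(2)[OF that] by (simp add: mult_ac)
  qed
  then obtain r where r: "r holomorphic_on ball 0 1" "\<And>z. z \<in> ball 0 1 \<Longrightarrow> q' z = bprod ws z * r z"
    using Cons.IH[OF _ _ q'(1) Cons.prems(4)] Cons.prems by auto
  show ?case using r q'(2) by (intro exI[of _ r]) (auto simp: mult_ac)
qed

lemma higher_deriv_times_linear:
  assumes k: "k holomorphic_on S" "open S" "\<mu> \<in> S"
  shows "(deriv ^^ Suc l) (\<lambda>z. (z - \<mu>) * k z) \<mu> = of_nat (Suc l) * (deriv ^^ l) k \<mu>"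
proof -
  have lin: "(deriv ^^ i) (\<lambda>z. z - \<mu>) = (\<lambda>z. if i = 0 then z - \<mu> else if i = 1 then 1 else 0)" for i
  proof (induction i)
    case (Suc i)
    have "(deriv ^^ Suc i) (\<lambda>z. z - \<mu>) = deriv ((deriv ^^ i) (\<lambda>z. z - \<mu>))" by simp
    also have "\<dots> = deriv (\<lambda>z. if i = 0 then z - \<mu> else if i = 1 then 1 else 0)" by (simp only: Suc)
    finally show ?case by (cases "i = 0"; cases "i = 1") (auto simp: fun_eq_iff)
  qed simp
  have "(deriv ^^ Suc l) (\<lambda>z. (z - \<mu>) * k z) \<mu> =
      (\<Sum>i = 0..Suc l. of_nat (Suc l choose i) * (deriv ^^ i) (\<lambda>z. z - \<mu>) \<mu> * (deriv ^^ (Suc l - i)) k \<mu>)"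
    using k by (intro higher_deriv_mult holomorphic_intros)
  also have "\<dots> = (\<Sum>i\<in>{1}. of_nat (Suc l choose i) * (deriv ^^ i) (\<lambda>z. z - \<mu>) \<mu> * (deriv ^^ (Suc l - i)) k \<mu>)"
    unfolding lin by (rule sum.mono_neutral_right) auto
  finally show ?thesis by (simp add: lin)
qed

text \<open>A factor \<open>z - \<mu>\<close> shifts the order of derivatives by one, by
  \<open>higher_deriv_times_linear\<close>, and \<open>blaschke \<mu>\<close> differs from it by a
  function without zeros in the disc.\<close>

lemma vanishing_order_iff:
  assumes "norm \<mu> < 1" "h holomorphic_on ball 0 1"
  shows "(\<forall>l<m. (deriv ^^ l) h \<mu> = 0) \<longleftrightarrow>
     (\<exists>q. q holomorphic_on ball 0 1 \<and> (\<forall>z\<in>ball 0 1. h z = blaschke \<mu> z ^ m * q z))"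
  using assms(2)
proof (induction m arbitrary: h)
  case 0
  thus ?case by auto
next
  case (Suc m)
  have d: "1 - cnj \<mu> * z \<noteq> 0" if "z \<in> ball 0 1" for z
    using blaschke_denom_nonzero[OF assms(1), of z] that by auto
  have shift: "(\<forall>l<Suc m. (deriv ^^ l) h \<mu> = 0) \<longleftrightarrow> (\<forall>l<m. (deriv ^^ l) k \<mu> = 0)"
    if k: "k holomorphic_on ball 0 1" and hk: "\<And>z. z \<in> ball 0 1 \<Longrightarrow> h z = (z - \<mu>) * k z" for k
  proof -
    have "(deriv ^^ Suc l) h \<mu> = of_nat (Suc l) * (deriv ^^ l) k \<mu>" for l
    proof -
      have "(deriv ^^ Suc l) h \<mu> = (deriv ^^ Suc l) (\<lambda>z. (z - \<mu>) * k z) \<mu>"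
        using assms(1) hk by (intro higher_deriv_transform_within_open[of _ "ball 0 1"] Suc.prems holomorphic_intros k) auto
      thus ?thesis using higher_deriv_times_linear[OF k, of \<mu> l] assms(1) by simp
    qed
    moreover have "h \<mu> = 0" using hk[of \<mu>] assms(1) by simp
    ultimately show ?thesis
      by (simp only: All_less_Suc2 funpow_0) (simp del: of_nat_Suc)
  qed
  show ?case
  proof
    assume *: "\<forall>l<Suc m. (deriv ^^ l) h \<mu> = 0"
    hence "h \<mu> = 0" by (metis funpow_0 zero_less_Suc)
    then obtain g where g: "g holomorphic_on ball 0 1" "\<And>z. z \<in> ball 0 1 \<Longrightarrow> h z = blaschke \<mu> z * g z"
      using blaschke_divide[of "ball 0 1" \<mu> h] assms(1) Suc.prems by (metis dist_0_norm less_imp_le mem_ball open_ball)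
    define k where "k = (\<lambda>z. - g z / (1 - cnj \<mu> * z))"
    have k: "k holomorphic_on ball 0 1" unfolding k_def using d by (intro holomorphic_intros g) auto
    have "h z = (z - \<mu>) * k z" if "z \<in> ball 0 1" for z
      using g(2)[OF that] d[OF that] by (simp add: k_def blaschke_def field_simps)
    from shift[OF k this] * have "\<forall>l<m. (deriv ^^ l) k \<mu> = 0" by blast
    then obtain q where q: "q holomorphic_on ball 0 1" "\<And>z. z \<in> ball 0 1 \<Longrightarrow> k z = blaschke \<mu> z ^ m * q z"
      using Suc.IH[OF k] by blast
    show "\<exists>q. q holomorphic_on ball 0 1 \<and> (\<forall>z\<in>ball 0 1. h z = blaschke \<mu> z ^ Suc m * q z)"
    proof (intro exI conjI ballI)
      show "(\<lambda>z. - (1 - cnj \<mu> * z) * q z) holomorphic_on ball 0 1" by (intro holomorphic_intros q)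
      fix z :: complex assume z: "z \<in> ball 0 1"
      have "x = - e * (- x / e)" if "e \<noteq> 0" for x e :: complex using that by simp
      from this[OF d[OF z]] have "g z = - (1 - cnj \<mu> * z) * k z" unfolding k_def .
      thus "h z = blaschke \<mu> z ^ Suc m * (- (1 - cnj \<mu> * z) * q z)"
        unfolding g(2)[OF z] q(2)[OF z] by (simp add: mult_ac)
    qed
  next
    assume "\<exists>q. q holomorphic_on ball 0 1 \<and> (\<forall>z\<in>ball 0 1. h z = blaschke \<mu> z ^ Suc m * q z)"
    then obtain q where q: "q holomorphic_on ball 0 1" "\<And>z. z \<in> ball 0 1 \<Longrightarrow> h z = blaschke \<mu> z ^ Suc m * q z" by blast
    define r where "r = (\<lambda>z. - q z / (1 - cnj \<mu> * z))"
    have r: "r holomorphic_on ball 0 1" unfolding r_def using d by (intro holomorphic_intros q) auto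
    have b: "blaschke \<mu> holomorphic_on ball 0 1"
      using blaschke_analytic[OF assms(1)] by (meson analytic_imp_holomorphic ball_subset_cball holomorphic_on_subset)
    define k where "k = (\<lambda>z. blaschke \<mu> z ^ m * r z)"
    have k: "k holomorphic_on ball 0 1" unfolding k_def by (intro holomorphic_intros b r)
    have "h z = (z - \<mu>) * k z" if "z \<in> ball 0 1" for z
    proof -
      have "blaschke \<mu> z * q z = (z - \<mu>) * r z" using d[OF that] by (simp add: r_def blaschke_def field_simps)
      thus ?thesis unfolding q(2)[OF that] k_def by (simp add: mult_ac)
    qed
    from shift[OF k this] Suc.IH[OF k] r show "\<forall>l<Suc m. (deriv ^^ l) h \<mu> = 0" unfolding k_def by blast
  qed
qed

text \<open>Conditions at several points combine into one divisibility, because Blaschke products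
  with disjoint zeros are coprime.\<close>

lemma vanishing_orders_list:
  assumes "finite T" "T \<subseteq> ball 0 1"
  shows "\<exists>zs. set zs \<subseteq> T \<and> (\<forall>z. bprod zs z = (\<Prod>\<mu>\<in>T. blaschke \<mu> z ^ m \<mu>)) \<and>
     (\<forall>h. h holomorphic_on ball 0 1 \<longrightarrow> ((\<forall>\<mu>\<in>T. \<forall>l<m \<mu>. (deriv ^^ l) h \<mu> = 0) \<longleftrightarrow>
        (\<exists>q. q holomorphic_on ball 0 1 \<and> (\<forall>z\<in>ball 0 1. h z = bprod zs z * q z))))"
  using assms
proof induction
  case empty
  show ?case by (intro exI[of _ "[]"]) auto
next
  case (insert \<mu> T)
  then obtain zs where zs: "set zs \<subseteq> T" "\<And>z. bprod zs z = (\<Prod>\<mu>\<in>T. blaschke \<mu> z ^ m \<mu>)"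
     "\<And>h. h holomorphic_on ball 0 1 \<Longrightarrow> ((\<forall>\<mu>\<in>T. \<forall>l<m \<mu>. (deriv ^^ l) h \<mu> = 0) \<longleftrightarrow>
        (\<exists>q. q holomorphic_on ball 0 1 \<and> (\<forall>z\<in>ball 0 1. h z = bprod zs z * q z)))"
    by auto
  have \<mu>: "norm \<mu> < 1" and zs1: "set zs \<subseteq> ball 0 1" using insert.prems zs(1) by auto
  let ?rs = "replicate (m \<mu>) \<mu>"
  have rs: "set ?rs \<subseteq> ball 0 1" "set ?rs \<inter> set zs = {}" using \<mu> insert.hyps zs(1) by auto
  have iff: "(\<forall>\<mu>\<in>insert \<mu> T. \<forall>l<m \<mu>. (deriv ^^ l) h \<mu> = 0) \<longleftrightarrow>
        (\<exists>q. q holomorphic_on ball 0 1 \<and> (\<forall>z\<in>ball 0 1. h z = bprod (?rs @ zs) z * q z))" (is "?L \<longleftrightarrow> ?R")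
    if h: "h holomorphic_on ball 0 1" for h
  proof
    assume ?L
    then obtain q p where qp: "q holomorphic_on ball 0 1" "p holomorphic_on ball 0 1"
      "\<And>z. z \<in> ball 0 1 \<Longrightarrow> h z = blaschke \<mu> z ^ m \<mu> * q z" "\<And>z. z \<in> ball 0 1 \<Longrightarrow> h z = bprod zs z * p z"
      using vanishing_order_iff[OF \<mu> h, of "m \<mu>"] zs(3)[OF h] by auto
    have "bprod ?rs z * q z = bprod zs z * p z" if "z \<in> ball 0 1" for z
      using qp(3,4)[OF that] by (simp add: bprod_replicate)
    then obtain r where "r holomorphic_on ball 0 1" "\<And>z. z \<in> ball 0 1 \<Longrightarrow> q z = bprod zs z * r z"
      using bprod_coprime_divide[OF rs(1) zs1 rs(2) qp(1,2)] by blast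
    thus ?R using qp(3) by (intro exI[of _ r]) (auto simp: bprod_replicate)
  next
    assume ?R
    then obtain q where q: "q holomorphic_on ball 0 1" "\<And>z. z \<in> ball 0 1 \<Longrightarrow> h z = bprod (?rs @ zs) z * q z" by blast
    have "\<exists>p. p holomorphic_on ball 0 1 \<and> (\<forall>z\<in>ball 0 1. h z = blaschke \<mu> z ^ m \<mu> * p z)"
      by (intro exI[of _ "\<lambda>z. bprod zs z * q z"] conjI holomorphic_intros bprod_holomorphic zs1 q)
         (auto simp: q(2) bprod_replicate)
    moreover have "\<exists>p. p holomorphic_on ball 0 1 \<and> (\<forall>z\<in>ball 0 1. h z = bprod zs z * p z)"
      by (intro exI[of _ "\<lambda>z. bprod ?rs z * q z"] conjI holomorphic_intros bprod_holomorphic rs q)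
         (auto simp: q(2))
    ultimately show ?L using vanishing_order_iff[OF \<mu> h, of "m \<mu>"] zs(3)[OF h] by auto
  qed
  show ?case
  proof (intro exI[of _ "?rs @ zs"] conjI allI impI iff)
    show "set (?rs @ zs) \<subseteq> insert \<mu> T" using zs(1) by auto
    show "bprod (?rs @ zs) z = (\<Prod>\<mu>\<in>insert \<mu> T. blaschke \<mu> z ^ m \<mu>)" for z
      using insert.hyps zs(2) by (simp add: bprod_replicate)
  qed
qed

text \<open>The Taylor series of the \<open>l\<close>-th derivative about 0, evaluated at
  \<open>\<mu>\<close> and rewritten so that its weights are the entries of powers of Jordan
  blocks.\<close>

lemma higher_deriv_Taylor_sums:
  assumes f: "f holomorphic_on ball 0 1" and \<mu>: "norm \<mu> < 1"
  shows "(\<lambda>r. (deriv ^^ r) f 0 / fact r * (of_nat (r choose l) * \<mu> ^ (r - l))) sums ((deriv ^^ l) f \<mu> / fact l)"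
proof -
  have "(deriv ^^ l) f holomorphic_on ball 0 1" using f by (intro holomorphic_higher_deriv) auto
  from holomorphic_power_series[OF this, of \<mu>] \<mu>
  have "(\<lambda>n. (deriv ^^ n) ((deriv ^^ l) f) 0 / fact n * \<mu> ^ n) sums (deriv ^^ l) f \<mu>" by simp
  from sums_divide[OF this, of "fact l"]
  have "(\<lambda>n. (deriv ^^ (n + l)) f 0 / fact n * \<mu> ^ n / fact l) sums ((deriv ^^ l) f \<mu> / fact l)"
    by (simp add: funpow_add)
  also have "(\<lambda>n. (deriv ^^ (n + l)) f 0 / fact n * \<mu> ^ n / fact l) =
      (\<lambda>n. (deriv ^^ (n + l)) f 0 / fact (n + l) * (of_nat ((n + l) choose l) * \<mu> ^ (n + l - l)))"
  proof
    fix n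
    have "complex_of_nat ((n + l) choose l) = fact (n + l) / (fact l * fact n)"
      using binomial_fact[of l "n + l", where 'a = complex] by simp
    thus "(deriv ^^ (n + l)) f 0 / fact n * \<mu> ^ n / fact l =
      (deriv ^^ (n + l)) f 0 / fact (n + l) * (of_nat ((n + l) choose l) * \<mu> ^ (n + l - l))"
      by simp
  qed
  finally show ?thesis
    \<comment> \<open>The terms with \<open>r < l\<close> vanish with their binomial
      coefficient.\<close>
    by (subst (asm) sums_zero_iff_shift) auto
qed

section \<open>Matrix functions in Jordan normal form\<close>

lemma jordan_block_pow_entry:
  fixes a :: complex
  assumes "i < m" "j < m"
  shows "((jordan_block m a) ^\<^sub>m r) $$ (i, j) = (if i \<le> j then of_nat (r choose (j - i)) * a ^ (r - (j - i)) else 0)"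
  using assms unfolding jordan_block_pow by (auto simp: diff_diff_right)

text \<open>The block data attached to a position do not depend on the exponent \<open>r\<close>, so
  a power series can be summed at that position. The second half is needed to recover derivatives
  from the matrix function.\<close>

lemma jordan_matrix_pow_entries:
  fixes n_as :: "(nat \<times> complex) list"
  shows "\<And>i j. i < sum_list (map fst n_as) \<Longrightarrow> j < sum_list (map fst n_as) \<Longrightarrow>
      (\<forall>r. (jordan_matrix n_as ^\<^sub>m r) $$ (i, j) = 0) \<or>
      (\<exists>m a l. (m, a) \<in> set n_as \<and> l < m \<and> (\<forall>r. (jordan_matrix n_as ^\<^sub>m r) $$ (i, j) = of_nat (r choose l) * a ^ (r - l)))"
    and "\<And>m a l. (m, a) \<in> set n_as \<Longrightarrow> l < m \<Longrightarrow>
      \<exists>i j. i < sum_list (map fst n_as) \<and> j < sum_list (map fst n_as) \<and>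
       (\<forall>r. (jordan_matrix n_as ^\<^sub>m r) $$ (i, j) = of_nat (r choose l) * a ^ (r - l))"
proof (induction n_as)
  case Nil
  {
    case 1
    thus ?case by simp
  next
    case 2
    thus ?case by simp
  }
next
  case (Cons na n_as)
  obtain n b where na: "na = (n, b)" by force
  let ?d = "sum_list (map fst n_as)"
  have pow: "jordan_matrix (na # n_as) ^\<^sub>m r = four_block_mat (jordan_block n b ^\<^sub>m r) (0\<^sub>m n ?d) (0\<^sub>m ?d n) (jordan_matrix n_as ^\<^sub>m r)" for r
  proof -
    have dims: "dim_row (diag_block_mat (map (\<lambda>(n, a). jordan_block n a ^\<^sub>m r) n_as)) = ?d"
      "dim_col (diag_block_mat (map (\<lambda>(n, a). jordan_block n a ^\<^sub>m r) n_as)) = ?d"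
      using pow_carrier_mat[OF jordan_matrix_carrier, of n_as r] unfolding jordan_matrix_pow by auto
    show ?thesis
      unfolding jordan_matrix_pow na by (simp add: Let_def dims)
  qed
  have dims: "dim_row (jordan_matrix n_as ^\<^sub>m r) = ?d" "dim_col (jordan_matrix n_as ^\<^sub>m r) = ?d" for r
    using pow_carrier_mat[OF jordan_matrix_carrier, of n_as r] by auto
  have entry: "(jordan_matrix (na # n_as) ^\<^sub>m r) $$ (i, j) =
     (if i < n then if j < n then (jordan_block n b ^\<^sub>m r) $$ (i, j) else 0
      else if j < n then 0 else (jordan_matrix n_as ^\<^sub>m r) $$ (i - n, j - n))"
    if "i < n + ?d" "j < n + ?d" for i j r
    unfolding pow using that by (auto simp: dims)
  {
    case (1 i j)
    hence ij: "i < n + ?d" "j < n + ?d" by (auto simp: na)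
    consider "i < n" "j < n" "i \<le> j" | "i < n" "j < n" "j < i" | "i < n" "\<not> j < n" | "\<not> i < n" "j < n" | "\<not> i < n" "\<not> j < n"
      by linarith
    thus ?case
    proof cases
      case 1
      have "\<forall>r. (jordan_matrix (na # n_as) ^\<^sub>m r) $$ (i, j) = of_nat (r choose (j - i)) * b ^ (r - (j - i))"
        using 1 by (simp add: entry[OF ij] jordan_block_pow_entry)
      moreover have "j - i < n" "(n, b) \<in> set (na # n_as)" using 1 na by auto
      ultimately show ?thesis by blast
    next
      case 5
      hence "i - n < ?d" "j - n < ?d" using ij by auto
      from Cons.IH(1)[OF this] show ?thesis
        using 5 by (simp only: entry[OF ij] if_False) (auto simp: na)
    qed (auto simp: entry[OF ij] jordan_block_pow_entry)
  next
    case (2 m a l)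
    show ?case
    proof (cases "(m, a) = na")
      case True
      hence "0 < n + ?d" "l < n + ?d" "l < n" using 2 na by auto
      \<comment> \<open>The first row of a block contains all offsets from the diagonal.\<close>
      thus ?thesis using True na
        by - (rule exI[of _ 0], rule exI[of _ l], simp add: entry[unfolded na] jordan_block_pow_entry)
    next
      case False
      hence "(m, a) \<in> set n_as" using 2 by auto
      from Cons.IH(2)[OF this 2(2)] obtain i j where ij: "i < ?d" "j < ?d"
        "\<And>r. (jordan_matrix n_as ^\<^sub>m r) $$ (i, j) = of_nat (r choose l) * a ^ (r - l)" by blast
      thus ?thesis
        by - (rule exI[of _ "n + i"], rule exI[of _ "n + j"], simp add: na entry[unfolded na])
    qed
  }
qed

text \<open>Used for a similarity in both directions: from the Jordan form to the matrix and
  back.\<close>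

lemma conjugated_entries_sums:
  fixes X Y :: "nat \<Rightarrow> complex mat"
  assumes car: "P \<in> carrier_mat n n" "Q \<in> carrier_mat n n" "\<And>k. Y k \<in> carrier_mat n n"
    and X: "\<And>k. X k = P * Y k * Q"
    and sums: "\<And>i j. i < n \<Longrightarrow> j < n \<Longrightarrow> (\<lambda>k. c k * Y k $$ (i, j)) sums S i j"
    and ij: "i < n" "j < n"
  shows "(\<lambda>k. c k * X k $$ (i, j)) sums (\<Sum>b<n. \<Sum>a<n. P $$ (i, a) * Q $$ (b, j) * S a b)"
proof -
  note dims = carrier_matD[OF car(1)] carrier_matD[OF car(2)] carrier_matD[OF car(3)]
  have "X k $$ (i, j) = (\<Sum>b<n. \<Sum>a<n. P $$ (i, a) * Y k $$ (a, b) * Q $$ (b, j))" for k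
  proof -
    have "X k $$ (i, j) = (\<Sum>b<n. (P * Y k) $$ (i, b) * Q $$ (b, j))"
      unfolding X using ij by (auto simp: dims scalar_prod_def lessThan_atLeast0 intro!: sum.cong)
    also have "\<dots> = (\<Sum>b<n. (\<Sum>a<n. P $$ (i, a) * Y k $$ (a, b)) * Q $$ (b, j))"
      using ij by (intro sum.cong refl) (auto simp: dims scalar_prod_def lessThan_atLeast0 intro!: sum.cong)
    finally show ?thesis by (simp add: sum_distrib_right)
  qed
  hence eq: "c k * X k $$ (i, j) = (\<Sum>b<n. \<Sum>a<n. P $$ (i, a) * Q $$ (b, j) * (c k * Y k $$ (a, b)))" for k
    by (simp add: sum_distrib_left mult_ac)
  show ?thesis unfolding eq by (intro sums_sum sums_mult sums) auto
qed

lemma spectrum_jordan_nf: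
  fixes A :: "complex mat"
  assumes A: "A \<in> carrier_mat n n" and jnf: "jordan_nf A n_as"
  shows "spectrum A = snd ` set n_as"
proof -
  have "0 \<notin> fst ` set n_as" using jnf by (simp add: jordan_nf_def)
  moreover have "poly (\<Prod>(n, a)\<leftarrow>n_as. [:- a, 1:] ^ n) x = 0 \<longleftrightarrow> (\<exists>(n, a)\<in>set n_as. n \<noteq> 0 \<and> x = a)" for x
    by (induction n_as) (auto simp: poly_mult)
  ultimately show ?thesis
    unfolding spectrum_root_char_poly[OF A] jordan_nf_char_poly[OF jnf] by (force simp: image_iff)
qed

text \<open>On a Jordan block the entry at offset \<open>l\<close> is the \<open>l\<close>-th Taylor
  coefficient at the eigenvalue, and the offsets that occur for an eigenvalue are those below its
  largest block size.\<close>

lemma mat_fun_eq_iff: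
  fixes A :: "complex mat"
  assumes A: "A \<in> carrier_mat n n" and spec: "spectrum A \<subseteq> ball 0 1"
    and f: "f holomorphic_on ball 0 1" and g: "g holomorphic_on ball 0 1"
  shows "mat_fun f A = mat_fun g A \<longleftrightarrow>
    (\<forall>\<mu>\<in>spectrum A. \<forall>l<eigenvalue_order A \<mu>. (deriv ^^ l) f \<mu> = (deriv ^^ l) g \<mu>)"
proof -
  obtain n_as where jnf: "jordan_nf A n_as"
    using jordan_nf_ex[of A] A by auto
  define J where "J = jordan_matrix n_as"
  obtain P Q where "similar_mat_wit A J P Q"
    using jnf unfolding jordan_nf_def similar_mat_def J_def by blast
  note wit = this similar_mat_wit_sym[OF this]
  have car: "J \<in> carrier_mat n n" "P \<in> carrier_mat n n" "Q \<in> carrier_mat n n"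
    using similar_mat_witD2[OF A wit(1)] by auto
  have dim: "sum_list (map fst n_as) = n" using car(1) unfolding J_def carrier_mat_def by simp
  note entries = jordan_matrix_pow_entries[where n_as = n_as, unfolded dim, folded J_def]
  have sp: "spectrum A = snd ` set n_as" by (rule spectrum_jordan_nf[OF A jnf])
  have order: "(\<exists>m. (m, \<mu>) \<in> set n_as \<and> l < m) \<longleftrightarrow> l < eigenvalue_order A \<mu>" if "\<mu> \<in> spectrum A" for \<mu> l
  proof -
    have "finite {m. (m, \<mu>) \<in> set n_as}"
      by (rule finite_subset[of _ "fst ` set n_as"]) force+
    moreover have "{m. (m, \<mu>) \<in> set n_as} \<noteq> {}" using that unfolding sp by auto
    ultimately show ?thesis
      unfolding eigenvalue_order_jordan_nf[OF jnf] by (subst Max_gr_iff) auto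
  qed
  have mu1: "norm a < 1" if "(m, a) \<in> set n_as" for m a
    using spec that unfolding sp by force
  define S where "S f i j = (\<Sum>k. (deriv ^^ k) f 0 / fact k * (J ^\<^sub>m k) $$ (i, j))" for f i j
  have Ssums: "(\<lambda>k. (deriv ^^ k) f 0 / fact k * (J ^\<^sub>m k) $$ (i, j)) sums S f i j"
    if "f holomorphic_on ball 0 1" "i < n" "j < n" for f i j
  proof -
    have "summable (\<lambda>k. (deriv ^^ k) f 0 / fact k * (J ^\<^sub>m k) $$ (i, j))"
      using entries(1)[OF that(2,3)]
    proof (elim disjE exE conjE)
      fix m a l assume *: "(m, a) \<in> set n_as" "l < m" "\<forall>r. (J ^\<^sub>m r) $$ (i, j) = of_nat (r choose l) * a ^ (r - l)"
      show ?thesis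
        using higher_deriv_Taylor_sums[OF that(1) mu1[OF *(1)], of l] *(3) by (simp add: sums_iff)
    qed simp
    thus ?thesis unfolding S_def by (rule summable_sums)
  qed
  have S_entry: "S f i j = (deriv ^^ l) f a / fact l"
    if "f holomorphic_on ball 0 1" "norm a < 1" "\<forall>r. (J ^\<^sub>m r) $$ (i, j) = of_nat (r choose l) * a ^ (r - l)" for f i j l a
    using higher_deriv_Taylor_sums[OF that(1,2), of l] that(3) unfolding S_def by (simp add: sums_iff)
  have powA: "A ^\<^sub>m k = P * J ^\<^sub>m k * Q" "J ^\<^sub>m k = Q * A ^\<^sub>m k * P" for k
    using similar_mat_wit_pow_id[OF wit(1)] similar_mat_wit_pow_id[OF wit(2)] by auto
  have Asums: "(\<lambda>k. (deriv ^^ k) f 0 / fact k * (A ^\<^sub>m k) $$ (i, j)) sums (\<Sum>b<n. \<Sum>a<n. P $$ (i, a) * Q $$ (b, j) * S f a b)"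
    if "f holomorphic_on ball 0 1" "i < n" "j < n" for f i j
    by (rule conjugated_entries_sums[OF car(2,3) pow_carrier_mat[OF car(1)] powA(1) Ssums[OF that(1)] that(2,3)])
  have mf: "mat_fun f A $$ (i, j) = (\<Sum>b<n. \<Sum>a<n. P $$ (i, a) * Q $$ (b, j) * S f a b)"
    if "f holomorphic_on ball 0 1" "i < n" "j < n" for f i j
    using Asums[OF that] that A by (simp add: mat_fun_def sums_iff)
  have Asums': "(\<lambda>k. (deriv ^^ k) f 0 / fact k * (A ^\<^sub>m k) $$ (i, j)) sums (mat_fun f A $$ (i, j))"
    if "f holomorphic_on ball 0 1" "i < n" "j < n" for f i j
    using Asums[OF that] by (simp only: mf[OF that])
  \<comment> \<open>The inverse similarity recovers the entries on the Jordan form, so the entries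
    on \<open>A\<close> determine them.\<close>
  have SA: "S f i j = (\<Sum>b<n. \<Sum>a<n. Q $$ (i, a) * P $$ (b, j) * mat_fun f A $$ (a, b))"
    if "f holomorphic_on ball 0 1" "i < n" "j < n" for f i j
    using sums_unique2[OF Ssums[OF that] conjugated_entries_sums[OF car(3,2) pow_carrier_mat[OF A] powA(2) Asums'[OF that(1)] that(2,3)]] .
  have "mat_fun f A = mat_fun g A \<longleftrightarrow> (\<forall>i<n. \<forall>j<n. S f i j = S g i j)"
  proof
    assume "mat_fun f A = mat_fun g A"
    thus "\<forall>i<n. \<forall>j<n. S f i j = S g i j" using SA[OF f] SA[OF g] by simp
  next
    assume *: "\<forall>i<n. \<forall>j<n. S f i j = S g i j"
    show "mat_fun f A = mat_fun g A"
    proof (rule eq_matI)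
      fix i j assume "i < dim_row (mat_fun g A)" "j < dim_col (mat_fun g A)"
      hence ij: "i < n" "j < n" using A by (auto simp: mat_fun_def)
      show "mat_fun f A $$ (i, j) = mat_fun g A $$ (i, j)"
        unfolding mf[OF f ij] mf[OF g ij] using * by (intro sum.cong) auto
    qed (auto simp: mat_fun_def)
  qed
  also have "\<dots> \<longleftrightarrow> (\<forall>(m, a)\<in>set n_as. \<forall>l<m. (deriv ^^ l) f a = (deriv ^^ l) g a)"
  proof (intro iffI)
    assume *: "\<forall>i<n. \<forall>j<n. S f i j = S g i j"
    show "\<forall>(m, a)\<in>set n_as. \<forall>l<m. (deriv ^^ l) f a = (deriv ^^ l) g a"
    proof (clarify)
      fix m a l assume ma: "(m, a) \<in> set n_as" "l < m"
      obtain i j where ij: "i < n" "j < n" "\<forall>r. (J ^\<^sub>m r) $$ (i, j) = of_nat (r choose l) * a ^ (r - l)"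
        using entries(2)[OF ma] by blast
      show "(deriv ^^ l) f a = (deriv ^^ l) g a"
        using S_entry[OF f mu1[OF ma(1)] ij(3)] S_entry[OF g mu1[OF ma(1)] ij(3)] * ij by simp
    qed
  next
    assume *: "\<forall>(m, a)\<in>set n_as. \<forall>l<m. (deriv ^^ l) f a = (deriv ^^ l) g a"
    show "\<forall>i<n. \<forall>j<n. S f i j = S g i j"
    proof (intro allI impI)
      fix i j assume ij: "i < n" "j < n"
      show "S f i j = S g i j"
        using entries(1)[OF ij]
      proof (elim disjE exE conjE)
        assume "\<forall>r. (J ^\<^sub>m r) $$ (i, j) = 0"
        thus ?thesis by (simp add: S_def)
      next
        fix m a l assume ma: "(m, a) \<in> set n_as" "l < m" "\<forall>r. (J ^\<^sub>m r) $$ (i, j) = of_nat (r choose l) * a ^ (r - l)"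
        thus ?thesis using S_entry[OF f mu1[OF ma(1)] ma(3)] S_entry[OF g mu1[OF ma(1)] ma(3)] * by auto
      qed
    qed
  qed
  also have "\<dots> \<longleftrightarrow> (\<forall>\<mu>\<in>spectrum A. \<forall>l<eigenvalue_order A \<mu>. (deriv ^^ l) f \<mu> = (deriv ^^ l) g \<mu>)"
  proof
    assume *: "\<forall>(m, a)\<in>set n_as. \<forall>l<m. (deriv ^^ l) f a = (deriv ^^ l) g a"
    show "\<forall>\<mu>\<in>spectrum A. \<forall>l<eigenvalue_order A \<mu>. (deriv ^^ l) f \<mu> = (deriv ^^ l) g \<mu>"
    proof (intro ballI allI impI)
      fix \<mu> l assume \<mu>: "\<mu> \<in> spectrum A" "l < eigenvalue_order A \<mu>"
      then obtain m where "(m, \<mu>) \<in> set n_as" "l < m" using order[OF \<mu>(1), of l] by blast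
      thus "(deriv ^^ l) f \<mu> = (deriv ^^ l) g \<mu>" using * by blast
    qed
  next
    assume *: "\<forall>\<mu>\<in>spectrum A. \<forall>l<eigenvalue_order A \<mu>. (deriv ^^ l) f \<mu> = (deriv ^^ l) g \<mu>"
    show "\<forall>(m, a)\<in>set n_as. \<forall>l<m. (deriv ^^ l) f a = (deriv ^^ l) g a"
    proof clarify
      fix m a l assume ma: "(m, a) \<in> set n_as" "l < m"
      hence a: "a \<in> spectrum A" unfolding sp by force
      hence "l < eigenvalue_order A a" using order[OF a, of l] ma by blast
      thus "(deriv ^^ l) f a = (deriv ^^ l) g a" using * a by blast
    qed
  qed
  finally show ?thesis .
qed

text \<open>The bridge from matrices to functions: agreement on a matrix becomes congruence modulo
  its Blaschke factor, now with a list of zeros.\<close>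

lemma blaschke_mat_bprod:
  fixes A :: "complex mat"
  assumes A: "square_mat A" and spec: "spectrum A \<subseteq> ball 0 1"
  shows "\<exists>zs. set zs \<subseteq> ball 0 1 \<and> (\<forall>z. bprod zs z = blaschke_mat A z) \<and>
    (\<forall>f g. f holomorphic_on ball 0 1 \<longrightarrow> g holomorphic_on ball 0 1 \<longrightarrow>
       (mat_fun f A = mat_fun g A \<longleftrightarrow>
         (\<exists>q. q holomorphic_on ball 0 1 \<and> (\<forall>z\<in>ball 0 1. f z = g z + bprod zs z * q z))))"
proof -
  have A': "A \<in> carrier_mat (dim_row A) (dim_row A)" using A by auto
  have fin: "finite (spectrum A)" using card_finite_spectrum[OF A'] by simp
  obtain zs where zs: "set zs \<subseteq> spectrum A" "\<And>z. bprod zs z = blaschke_mat A z"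
    and iff: "\<And>h. h holomorphic_on ball 0 1 \<Longrightarrow> ((\<forall>\<mu>\<in>spectrum A. \<forall>l<eigenvalue_order A \<mu>. (deriv ^^ l) h \<mu> = 0) \<longleftrightarrow>
        (\<exists>q. q holomorphic_on ball 0 1 \<and> (\<forall>z\<in>ball 0 1. h z = bprod zs z * q z)))"
    using vanishing_orders_list[OF fin spec, of "eigenvalue_order A"] unfolding blaschke_mat_def by blast
  have "mat_fun f A = mat_fun g A \<longleftrightarrow>
         (\<exists>q. q holomorphic_on ball 0 1 \<and> (\<forall>z\<in>ball 0 1. f z = g z + bprod zs z * q z))"
    if fg: "f holomorphic_on ball 0 1" "g holomorphic_on ball 0 1" for f g
  proof -
    have "(deriv ^^ l) (\<lambda>z. f z - g z) \<mu> = (deriv ^^ l) f \<mu> - (deriv ^^ l) g \<mu>" if "\<mu> \<in> spectrum A" for l \<mu>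
      using that spec by (intro higher_deriv_diff[OF fg]) auto
    hence "mat_fun f A = mat_fun g A \<longleftrightarrow> (\<forall>\<mu>\<in>spectrum A. \<forall>l<eigenvalue_order A \<mu>. (deriv ^^ l) (\<lambda>z. f z - g z) \<mu> = 0)"
      unfolding mat_fun_eq_iff[OF A' spec fg] by simp
    also have "\<dots> \<longleftrightarrow> (\<exists>q. q holomorphic_on ball 0 1 \<and> (\<forall>z\<in>ball 0 1. f z - g z = bprod zs z * q z))"
      using iff[of "\<lambda>z. f z - g z"] fg by (auto intro: holomorphic_intros)
    finally show ?thesis by (simp add: algebra_simps)
  qed
  thus ?thesis using zs spec by (intro exI[of _ zs]) auto
qed

section \<open>Interpolation and strong separation\<close>

lemma norm_Bp_le_1:
  assumes "\<And>n. set (Z n) \<subseteq> ball 0 1" "z \<in> cball 0 1"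
  shows "norm (Bp Z S z) \<le> 1"
  unfolding Bp_def prod_norm[symmetric] using norm_bprod_le_1[OF assms(1) assms(2)] by (intro prod_le_1) auto

lemma norm_Bp_antimono:
  assumes "\<And>n. set (Z n) \<subseteq> ball 0 1" "z \<in> cball 0 1" "finite T" "S \<subseteq> T"
  shows "norm (Bp Z T z) \<le> norm (Bp Z S z)"
proof -
  have "norm (Bp Z T z) = norm (Bp Z (T - S) z) * norm (Bp Z S z)"
    unfolding Bp_def by (simp add: prod.subset_diff[OF assms(4,3)] norm_mult)
  also have "\<dots> \<le> 1 * norm (Bp Z S z)"
    by (intro mult_right_mono norm_Bp_le_1 assms) auto
  finally show ?thesis by simp
qed

lemma blaschke_involution:
  assumes "norm a < 1" "norm z < 1"
  shows "blaschke a (blaschke a z) = z"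
proof -
  have d: "1 - cnj a * z \<noteq> 0" using blaschke_denom_nonzero[of a z] assms by simp
  have e: "1 - cnj a * a \<noteq> 0" using blaschke_denom_nonzero[of a a] assms by simp
  have "a - blaschke a z = (1 - cnj a * a) * z / (1 - cnj a * z)"
    using d by (simp add: blaschke_def field_simps)
  moreover have "1 - cnj a * blaschke a z = (1 - cnj a * a) / (1 - cnj a * z)"
    using d by (simp add: blaschke_def field_simps)
  ultimately show ?thesis unfolding blaschke_def[of a "blaschke a z"] using d e by simp
qed

lemma norm_blaschke_less_1:
  assumes "norm a < 1" "norm z < 1"
  shows "norm (blaschke a z) < 1"
proof -
  have "norm (Moebius_function 0 a z) < 1" using assms by (rule Moebius_function_norm_lt_1)
  thus ?thesis
    by (simp add: blaschke_def Moebius_function_def norm_divide norm_mult norm_minus_commute)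
qed

text \<open>The Schwarz lemma, applied to \<open>h\<close> composed with the involution
  \<open>blaschke w\<close> that moves the zero to 0, bounds \<open>norm (h z)\<close> by
  \<open>C * norm (blaschke w z)\<close>. The value of \<open>q\<close> at \<open>w\<close> is
  reached by continuity.\<close>

lemma blaschke_quotient_bounded:
  assumes h: "h holomorphic_on ball 0 1" and C: "\<And>z. z \<in> ball 0 1 \<Longrightarrow> norm (h z) \<le> C"
    and q: "q holomorphic_on ball 0 1" and w: "norm w < 1"
    and eq: "\<And>z. z \<in> ball 0 1 \<Longrightarrow> h z = blaschke w z * q z" and z: "z \<in> ball 0 1"
  shows "norm (q z) \<le> C"
proof -
  have b: "blaschke w holomorphic_on ball 0 1"
    using blaschke_analytic[OF w] by (meson analytic_imp_holomorphic ball_subset_cball holomorphic_on_subset)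
  have C0: "0 \<le> C" using order_trans[OF norm_ge_zero C[OF z]] .
  have h_le: "norm (h z) \<le> C * norm (blaschke w z)" if z: "z \<in> ball 0 1" for z
  proof (rule field_le_epsilon)
    fix \<eta> :: real assume \<eta>: "0 < \<eta>"
    \<comment> \<open>Division by \<open>C + \<eta>\<close> makes the bound strict, as the Schwarz
      lemma requires, and covers \<open>C = 0\<close>.\<close>
    define f where "f = (\<lambda>u. h (blaschke w u) / of_real (C + \<eta>))"
    have fh: "f holomorphic_on ball 0 1"
      unfolding f_def using norm_blaschke_less_1[OF w] C0 \<eta>
      by (intro holomorphic_intros holomorphic_on_compose_gen[OF b h, unfolded o_def]) auto
    have f_norm: "norm (f u) = norm (h (blaschke w u)) / (C + \<eta>)" for u
      unfolding f_def norm_divide norm_of_real using C0 \<eta> by simp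
    have f0: "f 0 = 0"
      using eq[of w] w by (simp add: f_def blaschke_def)
    have f1: "norm (f u) < 1" if "norm u < 1" for u
      using C[of "blaschke w u"] norm_blaschke_less_1[OF w that] C0 \<eta> by (simp add: f_norm)
    have "norm (f (blaschke w z)) \<le> norm (blaschke w z)"
      using z norm_blaschke_less_1[OF w] by (intro Schwarz_Lemma(1)[OF fh f0 f1]) auto
    hence "norm (h z) \<le> (C + \<eta>) * norm (blaschke w z)"
      using z C0 \<eta> blaschke_involution[OF w, of z] by (simp add: f_norm field_simps)
    also have "\<dots> = C * norm (blaschke w z) + \<eta> * norm (blaschke w z)" by (simp add: algebra_simps)
    also have "\<eta> * norm (blaschke w z) \<le> \<eta> * 1"
      using \<eta> norm_blaschke_less_1[OF w, of z] z by (intro mult_left_mono) auto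
    finally show "norm (h z) \<le> C * norm (blaschke w z) + \<eta>" by simp
  qed
  have q_le: "norm (q z) \<le> C" if z: "z \<in> ball 0 1" "z \<noteq> w" for z
  proof -
    have "blaschke w z \<noteq> 0" using blaschke_eq_0_iff[OF w, of z] z by auto
    thus ?thesis using h_le[OF z(1)] unfolding eq[OF z(1)] by (simp add: norm_mult mult.commute)
  qed
  show ?thesis
  proof (cases "z = w")
    case True
    have "(q \<longlongrightarrow> q w) (at w)"
      using q w by (auto simp: isCont_def[symmetric] intro!: holomorphic_on_imp_continuous_on
         continuous_on_interior[of "ball 0 1"])
    moreover have "eventually (\<lambda>z. norm (q z) \<le> C) (at w)"
    proof -
      have "eventually (\<lambda>z. z \<in> ball 0 1 - {w}) (at w)" using w by (intro eventually_at_in_open) auto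
      thus ?thesis by eventually_elim (use q_le in auto)
    qed
    ultimately have "norm (q w) \<le> C" by (intro Lim_norm_ubound[of "at w"]) auto
    thus ?thesis using True by simp
  qed (use q_le z in auto)
qed

lemma bprod_quotient_bounded:
  assumes "set zs \<subseteq> ball 0 1" "q holomorphic_on ball 0 1"
    and "\<And>z. z \<in> ball 0 1 \<Longrightarrow> norm (bprod zs z * q z) \<le> C" and "z \<in> ball 0 1"
  shows "norm (q z) \<le> C"
  using assms
proof (induction zs arbitrary: q z)
  case Nil
  thus ?case by simp
next
  case (Cons w zs)
  have *: "norm (bprod zs z * q z) \<le> C" if "z \<in> ball 0 1" for z
  proof (rule blaschke_quotient_bounded[of "\<lambda>z. bprod (w # zs) z * q z" C "\<lambda>z. bprod zs z * q z" w])
    show "(\<lambda>z. bprod (w # zs) z * q z) holomorphic_on ball 0 1"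
      by (intro holomorphic_on_mult bprod_holomorphic Cons.prems)
    show "(\<lambda>z. bprod zs z * q z) holomorphic_on ball 0 1"
      using Cons.prems by (intro holomorphic_on_mult bprod_holomorphic) auto
  qed (use Cons.prems that in auto)
  show ?case using Cons.IH[of q z] Cons.prems * by auto
qed

lemma Bp_divides:
  assumes Z: "\<And>n. set (Z n) \<subseteq> ball 0 1" and disj: "\<And>k n. k \<noteq> n \<Longrightarrow> set (Z k) \<inter> set (Z n) = {}"
    and h: "h holomorphic_on ball 0 1" and S: "finite S"
    and dvd: "\<And>n. n \<in> S \<Longrightarrow> \<exists>q. q holomorphic_on ball 0 1 \<and> (\<forall>z\<in>ball 0 1. h z = bprod (Z n) z * q z)"
  shows "\<exists>q. q holomorphic_on ball 0 1 \<and> (\<forall>z\<in>ball 0 1. h z = Bp Z S z * q z)"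
  using S dvd
proof (induction S)
  case empty
  show ?case using h by (intro exI[of _ h]) (auto simp: Bp_def)
next
  case (insert n S)
  obtain q where q: "q holomorphic_on ball 0 1" "\<And>z. z \<in> ball 0 1 \<Longrightarrow> h z = Bp Z S z * q z"
    using insert.IH insert.prems by auto
  obtain p where p: "p holomorphic_on ball 0 1" "\<And>z. z \<in> ball 0 1 \<Longrightarrow> h z = bprod (Z n) z * p z"
    using insert.prems[of n] by auto
  obtain zs where zs: "set zs \<subseteq> ball 0 1" "bprod zs = Bp Z S" "set zs = (\<Union>n\<in>S. set (Z n))"
    by (rule Bp_eq_bprod[OF insert.hyps(1) Z])
  have "set (Z k) \<inter> set (Z n) = {}" if "k \<in> S" for k
    using that insert.hyps by (intro disj) auto
  hence disj': "set zs \<inter> set (Z n) = {}" unfolding zs(3) by auto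
  have "bprod zs z * q z = bprod (Z n) z * p z" if "z \<in> ball 0 1" for z
    using q(2)[OF that] p(2)[OF that] zs(2) by simp
  from bprod_coprime_divide[OF zs(1) Z disj' q(1) p(1) this]
  obtain r where r: "r holomorphic_on ball 0 1" "\<And>z. z \<in> ball 0 1 \<Longrightarrow> q z = bprod (Z n) z * r z" by blast
  have "h z = Bp Z (insert n S) z * r z" if "z \<in> ball 0 1" for z
    using q(2)[OF that] r(2)[OF that] insert.hyps by (simp add: Bp_def mult_ac)
  thus ?case using r(1) by blast
qed

text \<open>Dividing out a finite Blaschke product does not increase the bound
  \<open>C\<close>.\<close>

lemma norm_le_Bp:
  assumes Z: "\<And>n. set (Z n) \<subseteq> ball 0 1" and disj: "\<And>k n. k \<noteq> n \<Longrightarrow> set (Z k) \<inter> set (Z n) = {}"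
    and h: "h holomorphic_on ball 0 1" "\<And>z. z \<in> ball 0 1 \<Longrightarrow> norm (h z) \<le> C" and S: "finite S"
    and dvd: "\<And>n. n \<in> S \<Longrightarrow> \<exists>q. q holomorphic_on ball 0 1 \<and> (\<forall>z\<in>ball 0 1. h z = bprod (Z n) z * q z)"
    and z: "z \<in> ball 0 1"
  shows "norm (h z) \<le> C * norm (Bp Z S z)"
proof -
  obtain q where q: "q holomorphic_on ball 0 1" "\<And>z. z \<in> ball 0 1 \<Longrightarrow> h z = Bp Z S z * q z"
    using Bp_divides[where Z = Z, OF Z disj h(1) S dvd] by blast
  obtain zs where zs: "set zs \<subseteq> ball 0 1" "bprod zs = Bp Z S" by (rule Bp_eq_bprod[OF S Z])
  have "norm (q z) \<le> C"
    by (rule bprod_quotient_bounded[OF zs(1) q(1) _ z]) (use q(2) h(2) zs(2) in auto)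
  thus ?thesis using q(2)[OF z] by (simp add: norm_mult mult.commute mult_right_mono)
qed

text \<open>If the conclusion fails, it fails on blocks of indices arbitrarily far out; so violating
  sets can be chosen in disjoint blocks, and their union violates the hypothesis.\<close>

lemma gliding_hump:
  fixes B :: "nat set \<Rightarrow> 'a \<Rightarrow> real"
  assumes B: "\<And>S z. z \<in> D \<Longrightarrow> 0 \<le> B S z" "\<And>S z. z \<in> D \<Longrightarrow> B S z \<le> 1"
    and mult: "\<And>S T z. z \<in> D \<Longrightarrow> finite S \<Longrightarrow> finite T \<Longrightarrow> S \<inter> T = {} \<Longrightarrow> B (S \<union> T) z = B S z * B T z"
    and sep: "\<And>T. \<exists>e>0. \<forall>X. finite X \<longrightarrow> (\<forall>z\<in>D. e \<le> B (X \<inter> T) z + B (X - T) z)"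
  shows "\<exists>e>0. \<forall>X S. finite X \<longrightarrow> S \<subseteq> X \<longrightarrow> (\<forall>z\<in>D. e \<le> B S z + B (X - S) z)"
proof (rule ccontr)
  assume neg: "\<not> ?thesis"
  have antimono: "B T z \<le> B S z" if "z \<in> D" "finite T" "S \<subseteq> T" for S T z
  proof -
    have "B T z = B S z * B (T - S) z"
      using mult[OF that(1), of S "T - S"] that finite_subset[of S T] by (simp add: Un_absorb1)
    also have "\<dots> \<le> B S z * 1" using B that by (intro mult_left_mono) auto
    finally show ?thesis by simp
  qed
  \<comment> \<open>If some tail satisfied the bound \<open>\<epsilon>\<close>, the conclusion would
    hold for all indices, against \<open>neg\<close>. The hypothesis for the single set
    \<open>{..<M}\<close> glues head and tail together.\<close>
  have block: "\<exists>X S z. finite X \<and> X \<subseteq> {M..} \<and> S \<subseteq> X \<and> z \<in> D \<and> B S z + B (X - S) z < \<epsilon>"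
    if \<epsilon>: "0 < \<epsilon>" for M and \<epsilon> :: real
  proof (rule ccontr)
    assume "\<not> ?thesis"
    hence tail: "\<epsilon> \<le> B S z + B (X - S) z" if "finite X" "X \<subseteq> {M..}" "S \<subseteq> X" "z \<in> D" for X S z
      using that by (meson not_le)
    have "\<forall>U. \<exists>e>0. \<forall>z\<in>D. e \<le> B ({..<M} \<inter> U) z + B ({..<M} - U) z"
      using sep by (meson finite_lessThan)
    then obtain e where e: "\<And>U. 0 < e U" "\<And>U z. z \<in> D \<Longrightarrow> e U \<le> B ({..<M} \<inter> U) z + B ({..<M} - U) z"
      by metis
    \<comment> \<open>The constants depend on the set, but the finite head has finitely many
      subsets, so a positive minimum exists.\<close>
    define e1 where "e1 = Min (e ` Pow {..<M})"
    have e1: "0 < e1" "\<And>U. U \<subseteq> {..<M} \<Longrightarrow> e1 \<le> e U"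
      unfolding e1_def using e(1) by (subst Min_gr_iff) auto
    obtain e2 where e2: "0 < e2" "\<And>X z. finite X \<Longrightarrow> z \<in> D \<Longrightarrow> e2 \<le> B (X \<inter> {..<M}) z + B (X - {..<M}) z"
      using sep[of "{..<M}"] by blast
    define t where "t = Min {\<epsilon>, e1, e2} / 2"
    have t: "0 < t" "2 * t \<le> \<epsilon>" "2 * t \<le> e1" "2 * t \<le> e2" using \<epsilon> e1 e2 by (auto simp: t_def)
    have low: "t\<^sup>2 \<le> B S z + B (X - S) z" if X: "finite X" "S \<subseteq> X" and z: "z \<in> D" for X S z
    proof -
      have fin: "finite S" using X finite_subset by blast
      define u u' v v' where "u = B (S \<inter> {..<M}) z" "u' = B ((X - S) \<inter> {..<M}) z"
        "v = B (S - {..<M}) z" "v' = B ((X - S) - {..<M}) z"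
      have bd: "0 \<le> u" "0 \<le> u'" "0 \<le> v" "0 \<le> v'" "u \<le> 1" "u' \<le> 1" "v \<le> 1" "v' \<le> 1"
        using B z by (auto simp: u_u'_v_v'_def)
      have 1: "B S z = u * v" "B (X - S) z = u' * v'"
        using mult[OF z, of "S \<inter> {..<M}" "S - {..<M}"] mult[OF z, of "(X - S) \<inter> {..<M}" "(X - S) - {..<M}"] X fin
        by (auto simp: u_u'_v_v'_def Int_Diff_Un)
      have bounds: "2 * t \<le> u + u'"
      proof -
        have "2 * t \<le> e (S \<inter> {..<M})" using t e1(2)[of "S \<inter> {..<M}"] by auto
        also have "\<dots> \<le> B ({..<M} \<inter> (S \<inter> {..<M})) z + B ({..<M} - (S \<inter> {..<M})) z" by (rule e(2)[OF z])
        also have "{..<M} \<inter> (S \<inter> {..<M}) = S \<inter> {..<M}" by auto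
        also have "B ({..<M} - (S \<inter> {..<M})) z \<le> u'"
          unfolding u_u'_v_v'_def by (rule antimono[OF z]) auto
        finally show ?thesis by (simp add: u_u'_v_v'_def)
      qed
      have bounds': "2 * t \<le> v + v'"
      proof -
        have "X - {..<M} - (S - {..<M}) = X - S - {..<M}" by auto
        moreover have "\<epsilon> \<le> B (S - {..<M}) z + B (X - {..<M} - (S - {..<M})) z"
          using X by (intro tail z) auto
        ultimately show ?thesis using t by (simp add: u_u'_v_v'_def)
      qed
      have cross: "2 * t \<le> u * u' + v * v'"
      proof -
        have "X \<inter> {..<M} = (S \<inter> {..<M}) \<union> ((X - S) \<inter> {..<M})" "X - {..<M} = (S - {..<M}) \<union> ((X - S) - {..<M})"
          using X by auto
        hence "B (X \<inter> {..<M}) z = u * u'" "B (X - {..<M}) z = v * v'"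
          using mult[OF z, of "S \<inter> {..<M}" "(X - S) \<inter> {..<M}"] mult[OF z, of "S - {..<M}" "(X - S) - {..<M}"] X fin
          by (auto simp: u_u'_v_v'_def)
        thus ?thesis using e2(2)[OF X(1) z] t by simp
      qed
      have prods: "u * u' \<le> u" "v * v' \<le> v" "u * u' \<le> u'" "v * v' \<le> v'"
        using bd by (auto simp: mult_left_le mult_left_le_one_le)
      \<comment> \<open>Otherwise each of the two products has a factor below \<open>t\<close>. If
        both lie in the head or both in the tail, \<open>bounds\<close> or \<open>bounds'\<close>
        fails; if they are \<open>u\<close> and \<open>v'\<close>, or \<open>v\<close> and
        \<open>u'\<close>, then \<open>cross\<close> fails.\<close>
      have "(t \<le> u \<and> t \<le> v) \<or> (t \<le> u' \<and> t \<le> v')"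
      proof (rule ccontr)
        assume "\<not> ?thesis"
        hence "(u < t \<or> v < t) \<and> (u' < t \<or> v' < t)" by auto
        thus False using bounds bounds' cross prods by (elim conjE disjE) linarith+
      qed
      thus ?thesis unfolding 1
      proof
        assume "t \<le> u \<and> t \<le> v"
        hence "t * t \<le> u * v" using t by (intro mult_mono) auto
        thus "t\<^sup>2 \<le> u * v + u' * v'" using bd by (simp add: power2_eq_square add_increasing2)
      next
        assume "t \<le> u' \<and> t \<le> v'"
        hence "t * t \<le> u' * v'" using t by (intro mult_mono) auto
        thus "t\<^sup>2 \<le> u * v + u' * v'" using bd by (simp add: power2_eq_square add_increasing)
      qed
    qed
    have "\<exists>e>0. \<forall>X S. finite X \<longrightarrow> S \<subseteq> X \<longrightarrow> (\<forall>z\<in>D. e \<le> B S z + B (X - S) z)"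
    proof (intro exI[of _ "t\<^sup>2"] conjI allI impI ballI)
      show "0 < t\<^sup>2" using t by simp
    qed (rule low)
    with neg show False by contradiction
  qed
  have "\<forall>M j. \<exists>X S z. finite X \<and> X \<subseteq> {M..} \<and> S \<subseteq> X \<and> z \<in> D \<and> B S z + B (X - S) z < 1 / real (Suc j)"
    using block by simp
  then obtain X S z where XSz: "\<And>M j. finite (X M j)" "\<And>M j. X M j \<subseteq> {M..}" "\<And>M j. S M j \<subseteq> X M j"
     "\<And>M j. z M j \<in> D" "\<And>M j. B (S M j) (z M j) + B (X M j - S M j) (z M j) < 1 / real (Suc j)"
    by metis
  \<comment> \<open>The next block starts beyond the current start and all of the current block;
    inserting \<open>M\<close> also covers an empty block.\<close>
  define m where "m = rec_nat 0 (\<lambda>j M. Suc (Max (insert M (X M j))))"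
  have m_Suc: "m (Suc j) = Suc (Max (insert (m j) (X (m j) j)))" for j by (simp add: m_def)
  have X_less: "x < m (Suc j)" if "x \<in> X (m j) j" for x j
    unfolding m_Suc using that XSz(1)[of "m j" j] by (simp add: less_Suc_eq_le)
  have "m j \<le> m (Suc j)" for j
    unfolding m_Suc using XSz(1)[of "m j" j] by (simp add: le_SucI)
  hence mono: "m i \<le> m j" if "i \<le> j" for i j using that by (rule lift_Suc_mono_le)
  have disj: "X (m i) i \<inter> X (m j) j = {}" if "i < j" for i j
  proof -
    have "x < y" if "x \<in> X (m i) i" "y \<in> X (m j) j" for x y
    proof -
      have "x < m (Suc i)" using X_less[OF that(1)] .
      also have "\<dots> \<le> m j" using mono[of "Suc i" j] \<open>i < j\<close> by simp
      also have "\<dots> \<le> y" using XSz(2)[of "m j" j] that(2) by auto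
      finally show ?thesis .
    qed
    thus ?thesis by fastforce
  qed
  define T where "T = (\<Union>j. S (m j) j)"
  obtain e where e: "0 < e" "\<And>X z. finite X \<Longrightarrow> z \<in> D \<Longrightarrow> e \<le> B (X \<inter> T) z + B (X - T) z"
    using sep[of T] by blast
  obtain j where j: "1 / real (Suc j) < e" using nat_approx_posE[OF e(1)] by blast
  have "X (m j) j \<inter> T = S (m j) j"
  proof
    show "X (m j) j \<inter> T \<subseteq> S (m j) j"
    proof
      fix x assume x: "x \<in> X (m j) j \<inter> T"
      then obtain i where i: "x \<in> S (m i) i" by (auto simp: T_def)
      hence "x \<in> X (m i) i" using XSz(3) by blast
      hence "i = j" using x disj[of i j] disj[of j i] by (cases i j rule: linorder_cases) auto
      thus "x \<in> S (m j) j" using i by simp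
    qed
    show "S (m j) j \<subseteq> X (m j) j \<inter> T" using XSz(3) by (auto simp: T_def)
  qed
  moreover from this have "X (m j) j - T = X (m j) j - S (m j) j" by auto
  ultimately have "e < 1 / real (Suc j)"
    using e(2)[OF XSz(1)[of "m j" j] XSz(4)[of "m j" j]] XSz(5)[of "m j" j] by simp
  thus False using j by simp
qed

text \<open>If some factor is small, its index is removed. Otherwise the first partial product that is
  less than \<open>e\<close> is still at least \<open>e\<^sup>2\<close>, and the product of the remaining factors is at least \<open>e\<close>.\<close>

lemma one_exceptional_index:
  assumes Z: "\<And>n. set (Z n) \<subseteq> ball 0 1" and z: "z \<in> ball 0 1" and e: "0 < e" "e \<le> 1"
    and split: "\<And>X S. finite X \<Longrightarrow> S \<subseteq> X \<Longrightarrow> e \<le> norm (Bp Z S z) \<or> e \<le> norm (Bp Z (X - S) z)"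
  shows "\<exists>n. \<forall>N. e ^ 3 \<le> norm (Bp Z ({..<N} - {n}) z)"
proof -
  have z': "z \<in> cball 0 1" using z by auto
  note antimono = norm_Bp_antimono[where Z = Z, OF Z z']
  have e3: "e ^ 3 \<le> e" using e power_decreasing[of 1 3 e] by simp
  show ?thesis
  proof (cases "\<exists>n. norm (bprod (Z n) z) < e")
    case True
    then obtain n where n: "norm (Bp Z {n} z) < e" by (auto simp: Bp_def)
    have "e ^ 3 \<le> norm (Bp Z ({..<N} - {n}) z)" for N
    proof -
      have "e \<le> norm (Bp Z (insert n {..<N} - {n}) z)"
        using split[of "insert n {..<N}" "{n}"] n by auto
      thus ?thesis using e3 by simp
    qed
    thus ?thesis by blast
  next
    case False
    hence large: "e \<le> norm (bprod (Z n) z)" for n by (meson not_le)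
    have "e ^ 3 \<le> norm (Bp Z {..<N} z)" for N
    proof (rule ccontr)
      assume small: "\<not> e ^ 3 \<le> norm (Bp Z {..<N} z)"
      hence N: "norm (Bp Z {..<N} z) < e" using e3 by simp
      define M where "M = (LEAST M. norm (Bp Z {..<M} z) < e)"
      have M: "norm (Bp Z {..<M} z) < e" "M \<le> N" unfolding M_def using N by (auto intro: LeastI Least_le)
      have "M \<noteq> 0"
      proof
        assume "M = 0"
        with M(1) e show False by (simp add: Bp_def)
      qed
      then obtain m where m: "M = Suc m" using not0_implies_Suc by blast
      have "\<not> norm (Bp Z {..<m} z) < e" using not_less_Least[of m "\<lambda>M. norm (Bp Z {..<M} z) < e"] m by (simp add: M_def)
      hence "e * e \<le> norm (bprod (Z m) z) * norm (Bp Z {..<m} z)"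
        using large e by (intro mult_mono) auto
      hence eM: "e * e \<le> norm (Bp Z {..<M} z)" by (simp add: m Bp_def lessThan_Suc norm_mult)
      have sub: "{..<M} \<subseteq> {..<N}" using M(2) by auto
      have "e \<le> norm (Bp Z ({..<N} - {..<M}) z)"
        using split[OF finite_lessThan sub] M(1) by auto
      hence "(e * e) * e \<le> norm (Bp Z {..<M} z) * norm (Bp Z ({..<N} - {..<M}) z)"
        using eM e by (intro mult_mono) auto
      also have "\<dots> = norm (Bp Z ({..<M} \<union> ({..<N} - {..<M})) z)"
        by (subst Bp_union_disjoint) (auto simp: norm_mult)
      also have "{..<M} \<union> ({..<N} - {..<M}) = {..<N}" using sub by auto
      finally show False using small by (simp add: power3_eq_cube)
    qed
    \<comment> \<open>The index 0 is arbitrary: leaving out a factor only enlarges the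
      product.\<close>
    hence "e ^ 3 \<le> norm (Bp Z ({..<N} - {0}) z)" for N
      using antimono[of "{..<N}" "{..<N} - {0}"] order_trans by blast
    thus ?thesis by blast
  qed
qed

section \<open>The two implications, in terms of lists of zeros\<close>

context
  fixes A :: "nat \<Rightarrow> complex mat" and Z :: "nat \<Rightarrow> complex list"
  assumes sq: "\<And>n. square_mat (A n)" and spec: "\<And>n. spectrum (A n) \<subseteq> ball 0 1"
    and Z: "\<And>n. set (Z n) \<subseteq> ball 0 1" and Z_eq: "\<And>n z. bprod (Z n) z = blaschke_mat (A n) z"
    and Z_iff: "\<And>n f g. f holomorphic_on ball 0 1 \<Longrightarrow> g holomorphic_on ball 0 1 \<Longrightarrow>
       mat_fun f (A n) = mat_fun g (A n) \<longleftrightarrow>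
         (\<exists>q. q holomorphic_on ball 0 1 \<and> (\<forall>z\<in>ball 0 1. f z = g z + bprod (Z n) z * q z))"
begin

lemma interpolating_imp_indicator:
  assumes "interpolating_Hinf A"
  shows "\<exists>\<psi> C. \<psi> holomorphic_on ball 0 1 \<and> (\<forall>z\<in>ball 0 1. norm (\<psi> z) \<le> C) \<and> 0 < C \<and>
    (\<forall>n. \<exists>q. q holomorphic_on ball 0 1 \<and> (\<forall>z\<in>ball 0 1. \<psi> z = (if n \<in> T then 1 else 0) + bprod (Z n) z * q z))"
proof -
  define \<phi> :: "nat \<Rightarrow> complex \<Rightarrow> complex" where "\<phi> n z = (if n \<in> T then 1 else 0)" for n z
  have "\<phi> n \<in> Hinf" for n
    by (auto simp: Hinf_def \<phi>_def[abs_def] intro!: boundedI[of _ 1])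
  moreover have "Hinf_norm (\<phi> n) \<le> 1" for n
    unfolding Hinf_norm_def \<phi>_def by (intro cSUP_least) auto
  hence "bdd_above (range (\<lambda>n. Hinf_norm (\<phi> n)))" by (intro bdd_aboveI[of _ 1]) auto
  ultimately obtain \<psi> where \<psi>: "\<psi> \<in> Hinf" "\<And>n. mat_fun \<psi> (A n) = mat_fun (\<phi> n) (A n)"
    using assms unfolding interpolating_Hinf_def by blast
  have hol: "\<psi> holomorphic_on ball 0 1" "\<And>n. \<phi> n holomorphic_on ball 0 1"
    using \<psi>(1) by (auto simp: Hinf_def \<phi>_def[abs_def])
  obtain C where C: "0 < C" "\<And>z. z \<in> ball 0 1 \<Longrightarrow> norm (\<psi> z) \<le> C"
    using \<psi>(1) unfolding Hinf_def bounded_pos by auto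
  have "\<exists>q. q holomorphic_on ball 0 1 \<and> (\<forall>z\<in>ball 0 1. \<psi> z = (if n \<in> T then 1 else 0) + bprod (Z n) z * q z)" for n
    using Z_iff[OF hol(1) hol(2), of n n] \<psi>(2)[of n] unfolding \<phi>_def by blast
  with hol(1) C show ?thesis by blast
qed

text \<open>At a common zero, a function interpolating 1 at \<open>n\<close> and 0 at
  \<open>k\<close> would take both values.\<close>

lemma interpolating_imp_disjoint:
  assumes int: "interpolating_Hinf A" and "k \<noteq> n"
  shows "set (Z k) \<inter> set (Z n) = {}"
proof (rule ccontr)
  assume "set (Z k) \<inter> set (Z n) \<noteq> {}"
  then obtain c where c: "c \<in> set (Z k)" "c \<in> set (Z n)" by blast
  have c1: "c \<in> ball 0 1" using Z[of k] c by blast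
  have c0: "bprod (Z k) c = 0" "bprod (Z n) c = 0"
    using bprod_eq_0_iff[OF Z, of c k] bprod_eq_0_iff[OF Z, of c n] c c1 by auto
  obtain \<psi> C where \<psi>: "\<And>m. \<exists>q. q holomorphic_on ball 0 1 \<and>
      (\<forall>z\<in>ball 0 1. \<psi> z = (if m \<in> {n} then 1 else 0) + bprod (Z m) z * q z)"
    using interpolating_imp_indicator[OF int, of "{n}"] by blast
  have "\<psi> c = 1" using \<psi>[of n] c0 c1 by auto
  moreover have "\<psi> c = 0" using \<psi>[of k] c0 c1 \<open>k \<noteq> n\<close> by auto
  ultimately show False by simp
qed

text \<open>The interpolating \<open>\<psi>\<close> is divisible by the product over
  \<open>X - T\<close>, and \<open>\<psi> - 1\<close> by that over \<open>X \<inter> T\<close>; as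
  \<open>\<psi> z\<close> and \<open>\<psi> z - 1\<close> cannot both be small, neither can the two
  products. The bound depends on \<open>T\<close> through \<open>C\<close>, but not on
  \<open>X\<close>.\<close>

lemma interpolating_imp_split:
  assumes int: "interpolating_Hinf A"
  shows "\<exists>e>0. \<forall>X. finite X \<longrightarrow> (\<forall>z\<in>ball 0 1. e \<le> norm (Bp Z (X \<inter> T) z) + norm (Bp Z (X - T) z))"
proof -
  obtain \<psi> C where \<psi>: "\<psi> holomorphic_on ball 0 1" "\<And>z. z \<in> ball 0 1 \<Longrightarrow> norm (\<psi> z) \<le> C" "0 < C"
     "\<And>n. \<exists>q. q holomorphic_on ball 0 1 \<and> (\<forall>z\<in>ball 0 1. \<psi> z = (if n \<in> T then 1 else 0) + bprod (Z n) z * q z)"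
    using interpolating_imp_indicator[OF int, of T] by blast
  note disj = interpolating_imp_disjoint[OF int]
  have "1 / (C + 1) \<le> norm (Bp Z (X \<inter> T) z) + norm (Bp Z (X - T) z)" if X: "finite X" and z: "z \<in> ball 0 1" for X z
  proof -
    have "norm (\<psi> z) \<le> C * norm (Bp Z (X - T) z)"
    proof (rule norm_le_Bp[where Z = Z, OF Z disj \<psi>(1,2) _ _ z])
      show "\<exists>q. q holomorphic_on ball 0 1 \<and> (\<forall>z\<in>ball 0 1. \<psi> z = bprod (Z n) z * q z)" if "n \<in> X - T" for n
        using \<psi>(4)[of n] that by auto
    qed (use X in auto)
    moreover have "norm (\<psi> z - 1) \<le> (C + 1) * norm (Bp Z (X \<inter> T) z)"
    proof (rule norm_le_Bp[where Z = Z, OF Z disj _ _ _ _ z])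
      show "(\<lambda>z. \<psi> z - 1) holomorphic_on ball 0 1" by (intro holomorphic_intros \<psi>)
      show "norm (\<psi> z - 1) \<le> C + 1" if "z \<in> ball 0 1" for z
        using \<psi>(2)[OF that] norm_triangle_ineq4[of "\<psi> z" 1] by simp
      show "\<exists>q. q holomorphic_on ball 0 1 \<and> (\<forall>z\<in>ball 0 1. \<psi> z - 1 = bprod (Z n) z * q z)" if "n \<in> X \<inter> T" for n
        using \<psi>(4)[of n] that by (auto simp: algebra_simps)
    qed (use X in auto)
    moreover have "1 \<le> norm (\<psi> z) + norm (\<psi> z - 1)"
      using norm_triangle_ineq4[of "\<psi> z" "\<psi> z - 1"] by simp
    moreover have "C * norm (Bp Z (X - T) z) \<le> (C + 1) * norm (Bp Z (X - T) z)"
      by (intro mult_right_mono) auto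
    ultimately have "1 \<le> (C + 1) * (norm (Bp Z (X \<inter> T) z) + norm (Bp Z (X - T) z))"
      by (simp add: distrib_left)
    thus ?thesis using \<psi>(3) by (simp add: field_simps)
  qed
  thus ?thesis using \<psi>(3) by (intro exI[of _ "1 / (C + 1)"]) auto
qed

lemma partial_products_eq: "(\<Prod>k\<in>{..<N} - {n}. norm (blaschke_mat (A k) z)) = norm (Bp Z ({..<N} - {n}) z)"
  by (simp add: Bp_def Z_eq prod_norm)

text \<open>Partial products decrease, so lower bounds for the limit and for all of them are the
  same. Boundedness is checked first, since real suprema and infima are meaningful only
  then.\<close>

lemma strongly_separated_iff:
  "strongly_separated A \<longleftrightarrow> (\<exists>e>0. \<forall>z\<in>ball 0 1. \<exists>n. \<forall>N. e \<le> norm (Bp Z ({..<N} - {n}) z))"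
proof -
  define L where "L n z = lim (\<lambda>N. \<Prod>k\<in>{..<N} - {n}. norm (blaschke_mat (A k) z))" for n z
  note conv = strongly_separated_product_convergent[of A, OF spec, unfolded partial_products_eq]
  have L: "(\<lambda>N. norm (Bp Z ({..<N} - {n}) z)) \<longlonglongrightarrow> L n z" if "z \<in> ball 0 1" for n z
    using conv(2)[OF that] unfolding L_def partial_products_eq convergent_LIMSEQ_iff .
  have L_le: "L n z \<le> norm (Bp Z ({..<N} - {n}) z)" if "z \<in> ball 0 1" for n z N
    by (rule decseq_ge[OF conv(1)[OF that] L[OF that]])
  have L_ge: "e \<le> L n z" if "z \<in> ball 0 1" "\<And>N. e \<le> norm (Bp Z ({..<N} - {n}) z)" for e n z
    using L[OF that(1)] by (rule LIMSEQ_le_const) (use that(2) in auto)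
  have L0: "0 \<le> L n z" if "z \<in> ball 0 1" for n z by (rule L_ge[OF that]) simp
  have L1: "L n z \<le> 1" if "z \<in> ball 0 1" for n z
    using L_le[OF that, of n 0] by (simp add: Bp_def)
  have bdd: "bdd_above (range (\<lambda>n. L n z))" if "z \<in> ball 0 1" for z
    using L1[OF that] by (intro bdd_aboveI[of _ 1]) auto
  have sup0: "0 \<le> (SUP n. L n z)" if "z \<in> ball 0 1" for z
    using cSUP_upper[OF UNIV_I bdd[OF that], of 0] L0[OF that, of 0] by linarith
  have inf_bdd: "bdd_below ((\<lambda>z. SUP n. L n z) ` ball 0 1)" using sup0 by (intro bdd_belowI[of _ 0]) auto
  have eq: "strongly_separated A \<longleftrightarrow> 0 < (INF z\<in>ball 0 1. SUP n. L n z)"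
    by (simp add: strongly_separated_def L_def)
  show ?thesis unfolding eq
  proof
    assume pos: "0 < (INF z\<in>ball 0 1. SUP n. L n z)" (is "0 < ?I")
    have "\<exists>n. \<forall>N. ?I / 2 \<le> norm (Bp Z ({..<N} - {n}) z)" if z: "z \<in> ball 0 1" for z
    proof -
      \<comment> \<open>The supremum over \<open>n\<close> need not be attained; giving up half of
        the infimum leaves room to pick an index.\<close>
      have "?I / 2 < ?I" using pos by simp
      also have "?I \<le> (SUP n. L n z)" by (rule cINF_lower[OF inf_bdd z])
      finally obtain n where "?I / 2 < L n z"
        using less_cSUP_iff[OF UNIV_not_empty bdd[OF z], of "?I / 2"] by blast
      thus ?thesis using L_le[OF z, of n] by (meson less_imp_le order_trans)
    qed
    thus "\<exists>e>0. \<forall>z\<in>ball 0 1. \<exists>n. \<forall>N. e \<le> norm (Bp Z ({..<N} - {n}) z)"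
      using pos by (intro exI[of _ "?I / 2"]) auto
  next
    assume "\<exists>e>0. \<forall>z\<in>ball 0 1. \<exists>n. \<forall>N. e \<le> norm (Bp Z ({..<N} - {n}) z)"
    then obtain e where e: "0 < e" "\<And>z. z \<in> ball 0 1 \<Longrightarrow> \<exists>n. \<forall>N. e \<le> norm (Bp Z ({..<N} - {n}) z)" by blast
    have "e \<le> (INF z\<in>ball 0 1. SUP n. L n z)"
    proof (rule cINF_greatest)
      fix z :: complex assume z: "z \<in> ball 0 1"
      obtain n where "\<And>N. e \<le> norm (Bp Z ({..<N} - {n}) z)" using e(2)[OF z] by blast
      hence "e \<le> L n z" by (rule L_ge[OF z])
      also have "\<dots> \<le> (SUP n. L n z)" by (rule cSUP_upper[OF UNIV_I bdd[OF z]])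
      finally show "e \<le> (SUP n. L n z)" .
    qed simp
    thus "0 < (INF z\<in>ball 0 1. SUP n. L n z)" using e(1) by linarith
  qed
qed

lemma interpolating_imp_strongly_separated:
  assumes int: "interpolating_Hinf A"
  shows "strongly_separated A"
proof -
  have "\<exists>e>0. \<forall>X S. finite X \<longrightarrow> S \<subseteq> X \<longrightarrow> (\<forall>z\<in>ball 0 1. e \<le> norm (Bp Z S z) + norm (Bp Z (X - S) z))"
  proof (rule gliding_hump[where B = "\<lambda>S z. norm (Bp Z S z)" and D = "ball 0 1"])
    show "norm (Bp Z S z) \<le> 1" if "z \<in> ball 0 1" for S z
      using that by (intro norm_Bp_le_1 Z) auto
    show "norm (Bp Z (S \<union> T) z) = norm (Bp Z S z) * norm (Bp Z T z)" if "finite S" "finite T" "S \<inter> T = {}" for S T z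
      by (simp add: Bp_union_disjoint[OF that] norm_mult)
    show "\<exists>e>0. \<forall>X. finite X \<longrightarrow> (\<forall>z\<in>ball 0 1. e \<le> norm (Bp Z (X \<inter> T) z) + norm (Bp Z (X - T) z))" for T
      by (rule interpolating_imp_split[OF int])
  qed simp
  then obtain e where e: "0 < e" "\<forall>X S. finite X \<longrightarrow> S \<subseteq> X \<longrightarrow> (\<forall>z\<in>ball 0 1. e \<le> norm (Bp Z S z) + norm (Bp Z (X - S) z))"
    by (elim exE conjE)
  \<comment> \<open>One of two summands is at least half of their sum; the cap 1 is demanded by
    \<open>one_exceptional_index\<close>.\<close>
  define d where "d = min (e / 2) 1"
  have d: "0 < d" "d \<le> 1" "2 * d \<le> e" using e(1) by (auto simp: d_def)
  have "\<exists>n. \<forall>N. d ^ 3 \<le> norm (Bp Z ({..<N} - {n}) z)" if z: "z \<in> ball 0 1" for z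
  proof (rule one_exceptional_index[where Z = Z, OF Z z d(1,2)])
    fix X S :: "nat set" assume "finite X" "S \<subseteq> X"
    hence "e \<le> norm (Bp Z S z) + norm (Bp Z (X - S) z)" using e(2) z by simp
    thus "d \<le> norm (Bp Z S z) \<or> d \<le> norm (Bp Z (X - S) z)" using d(3) by linarith
  qed
  thus ?thesis unfolding strongly_separated_iff using d(1) by (intro exI[of _ "d ^ 3"]) auto
qed

text \<open>Dilation makes the data analytic on the closed disc, at the price that the data also
  vary with \<open>N\<close>. In the limit the interpolation is checked through derivatives at the
  eigenvalues, which pass to locally uniform limits, rather than through quotients by Blaschke
  products.\<close>

lemma strongly_separated_imp_interpolating:
  assumes ss: "strongly_separated A"
  shows "interpolating_Hinf A"
  unfolding interpolating_Hinf_def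
proof (intro allI impI)
  fix \<phi> :: "nat \<Rightarrow> complex \<Rightarrow> complex"
  assume \<phi>: "(\<forall>n. \<phi> n \<in> Hinf) \<and> bdd_above (range (\<lambda>n. Hinf_norm (\<phi> n)))"
  hence hol: "\<phi> n holomorphic_on ball 0 1" for n by (auto simp: Hinf_def)
  obtain K0 where K0: "\<And>n. Hinf_norm (\<phi> n) \<le> K0" using \<phi> unfolding bdd_above_def by auto
  define K where "K = max K0 1"
  have K: "0 < K" by (simp add: K_def)
  have \<phi>_le: "norm (\<phi> n z) \<le> K" if z: "z \<in> ball 0 1" for n z
  proof -
    have "bounded (\<phi> n ` ball 0 1)" using \<phi> by (auto simp: Hinf_def)
    hence "bdd_above ((\<lambda>z. norm (\<phi> n z)) ` ball 0 1)"
      unfolding bounded_iff by (auto intro: bdd_aboveI2)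
    hence "norm (\<phi> n z) \<le> Hinf_norm (\<phi> n)"
      unfolding Hinf_norm_def using z by (intro cSUP_upper)
    thus ?thesis using K0[of n] by (simp add: K_def)
  qed
  obtain e where e: "0 < e" "\<And>z. z \<in> ball 0 1 \<Longrightarrow> \<exists>n. \<forall>N. e \<le> norm (Bp Z ({..<N} - {n}) z)"
    using ss unfolding strongly_separated_iff by blast
  define \<delta> where "\<delta> = min e 1"
  have \<delta>: "0 < \<delta>" "\<delta> \<le> 1" "\<delta> \<le> e" using e(1) by (auto simp: \<delta>_def)
  obtain C where C: "0 < C" and interp: "\<And>N Z \<phi>. (\<forall>n. set (Z n) \<subseteq> ball 0 1) \<and> (\<forall>n. disc_analytic (\<phi> n)) \<and>
      (\<forall>n. \<forall>z\<in>cball 0 1. norm (\<phi> n z) \<le> 1) \<and>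
      (\<forall>z\<in>ball 0 1. \<exists>n. \<delta> \<le> norm (Bp Z ({..<N} - {n}) z)) \<Longrightarrow>
      \<exists>F. F holomorphic_on ball 0 1 \<and> (\<forall>z\<in>ball 0 1. norm (F z) \<le> C) \<and>
        (\<forall>n<N. \<exists>q. q holomorphic_on ball 0 1 \<and> (\<forall>z\<in>ball 0 1. F z = \<phi> n z + bprod (Z n) z * q z))"
    using finite_interpolation[OF \<delta>(1,2)] by blast
  \<comment> \<open>The double successor keeps \<open>\<rho> 0\<close> positive.\<close>
  define \<rho> :: "nat \<Rightarrow> real" where "\<rho> N = 1 - inverse (real (Suc (Suc N)))" for N
  have \<rho>: "0 < \<rho> N" "\<rho> N < 1" for N by (auto simp: \<rho>_def field_simps)
  have \<rho>_lim: "\<rho> \<longlonglongrightarrow> 1"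
  proof -
    have "(\<lambda>N. 1 - inverse (real (Suc (Suc N)))) \<longlonglongrightarrow> 1 - 0"
      by (intro tendsto_diff tendsto_const LIMSEQ_Suc[OF LIMSEQ_inverse_real_of_nat])
    thus ?thesis by (simp add: \<rho>_def[abs_def])
  qed
  have \<rho>_ball: "of_real (\<rho> N) * z \<in> ball 0 1" if "norm z \<le> 1" for N and z :: complex
  proof -
    have "norm (of_real (\<rho> N) * z) \<le> \<rho> N * 1"
      using \<rho>[of N] that unfolding norm_mult by (intro mult_mono) auto
    thus ?thesis using \<rho>[of N] by simp
  qed
  have "\<exists>G. G holomorphic_on ball 0 1 \<and> (\<forall>z\<in>ball 0 1. norm (G z) \<le> K * C) \<and>
        (\<forall>n<N. mat_fun G (A n) = mat_fun (\<lambda>z. \<phi> n (of_real (\<rho> N) * z)) (A n))" for N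
  proof -
    have an: "disc_analytic (\<lambda>z. \<phi> n (of_real (\<rho> N) * z) / of_real K)" for n
    proof -
      have "open ((\<lambda>z :: complex. of_real (\<rho> N) * z) -` ball 0 1)"
        by (intro open_vimage continuous_intros open_ball)
      hence "open {z :: complex. of_real (\<rho> N) * z \<in> ball 0 1}" unfolding vimage_def .
      moreover have "(\<lambda>z. \<phi> n (of_real (\<rho> N) * z) / of_real K) holomorphic_on {z :: complex. of_real (\<rho> N) * z \<in> ball 0 1}"
        using K by (intro holomorphic_intros holomorphic_on_compose_gen[OF _ hol, unfolded o_def]) auto
      moreover have "cball 0 1 \<subseteq> {z :: complex. of_real (\<rho> N) * z \<in> ball 0 1}" using \<rho>_ball by auto
      ultimately show ?thesis unfolding analytic_on_holomorphic by blast
    qed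
    have 1: "norm (\<phi> n (of_real (\<rho> N) * z) / of_real K) \<le> 1" if "z \<in> cball 0 1" for n z
      using \<phi>_le[OF \<rho>_ball, of z n N] that K by (simp add: norm_divide)
    have 2: "\<exists>n. \<delta> \<le> norm (Bp Z ({..<N} - {n}) z)" if "z \<in> ball 0 1" for z
      using e(2)[OF that] \<delta>(3) order_trans by blast
    have "\<exists>F. F holomorphic_on ball 0 1 \<and> (\<forall>z\<in>ball 0 1. norm (F z) \<le> C) \<and>
        (\<forall>n<N. \<exists>q. q holomorphic_on ball 0 1 \<and>
           (\<forall>z\<in>ball 0 1. F z = \<phi> n (of_real (\<rho> N) * z) / of_real K + bprod (Z n) z * q z))"
      by (rule interp[where Z = Z and N = N]) (intro conjI allI ballI Z an 1 2)
    then obtain F where F: "F holomorphic_on ball 0 1" "\<forall>z\<in>ball 0 1. norm (F z) \<le> C"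
        "\<forall>n<N. \<exists>q. q holomorphic_on ball 0 1 \<and>
           (\<forall>z\<in>ball 0 1. F z = \<phi> n (of_real (\<rho> N) * z) / of_real K + bprod (Z n) z * q z)"
      by (elim exE conjE)
    show ?thesis
    proof (rule exI[of _ "\<lambda>z. of_real K * F z"], intro conjI ballI allI impI)
      show KF: "(\<lambda>z. of_real K * F z) holomorphic_on ball 0 1" by (intro holomorphic_intros F)
      show "norm (of_real K * F z) \<le> K * C" if "z \<in> ball 0 1" for z
        using bspec[OF F(2) that] K by (simp add: norm_mult)
      fix n assume "n < N"
      with F(3) have "\<exists>q. q holomorphic_on ball 0 1 \<and>
           (\<forall>z\<in>ball 0 1. F z = \<phi> n (of_real (\<rho> N) * z) / of_real K + bprod (Z n) z * q z)" by simp
      then obtain q where q: "q holomorphic_on ball 0 1"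
        "\<forall>z\<in>ball 0 1. F z = \<phi> n (of_real (\<rho> N) * z) / of_real K + bprod (Z n) z * q z"
        by (elim exE conjE)
      have hol': "(\<lambda>z. \<phi> n (of_real (\<rho> N) * z)) holomorphic_on ball 0 1"
        using \<rho>_ball by (intro holomorphic_intros holomorphic_on_compose_gen[OF _ hol, unfolded o_def]) auto
      show "mat_fun (\<lambda>z. of_real K * F z) (A n) = mat_fun (\<lambda>z. \<phi> n (of_real (\<rho> N) * z)) (A n)"
        unfolding Z_iff[OF KF hol']
      proof (rule exI[of _ "\<lambda>z. of_real K * q z"], intro conjI ballI)
        show "(\<lambda>z. of_real K * q z) holomorphic_on ball 0 1" by (intro holomorphic_intros q)
        show "of_real K * F z = \<phi> n (of_real (\<rho> N) * z) + bprod (Z n) z * (of_real K * q z)" if "z \<in> ball 0 1" for z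
          unfolding bspec[OF q(2) that] using K by (simp add: distrib_left)
      qed
    qed
  qed
  then obtain G where G: "\<And>N. G N holomorphic_on ball 0 1" "\<And>N z. z \<in> ball 0 1 \<Longrightarrow> norm (G N z) \<le> K * C"
    "\<And>N n. n < N \<Longrightarrow> mat_fun (G N) (A n) = mat_fun (\<lambda>z. \<phi> n (of_real (\<rho> N) * z)) (A n)" by metis
  obtain \<psi> r where \<psi>: "\<psi> holomorphic_on ball 0 1" and r: "strict_mono (r :: nat \<Rightarrow> nat)"
    and lim: "\<And>z. z \<in> ball 0 1 \<Longrightarrow> (\<lambda>j. G (r j) z) \<longlonglongrightarrow> \<psi> z"
    and ulim: "\<And>K. compact K \<Longrightarrow> K \<subseteq> ball 0 1 \<Longrightarrow> uniform_limit K (G \<circ> r) \<psi> sequentially"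
  proof (rule Montel[of "ball 0 1" "range G" G])
    show "\<exists>B. \<forall>h\<in>range G. \<forall>z\<in>L. norm (h z) \<le> B" if "compact L" "L \<subseteq> ball 0 1" for L
      using G(2) that by (intro exI[of _ "K * C"]) auto
  qed (use G(1) in auto)
  have "norm (\<psi> z) \<le> K * C" if "z \<in> ball 0 1" for z
    using lim[OF that] G(2)[OF that] by (intro Lim_norm_ubound[OF sequentially_bot]) auto
  hence \<psi>_Hinf: "\<psi> \<in> Hinf" using \<psi> by (auto simp: Hinf_def intro!: boundedI[of _ "K * C"])
  have "mat_fun \<psi> (A n) = mat_fun (\<phi> n) (A n)" for n
  proof -
    have car: "A n \<in> carrier_mat (dim_row (A n)) (dim_row (A n))" using sq[of n] by auto
    show ?thesis
      unfolding mat_fun_eq_iff[OF car spec \<psi> hol]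
    proof (intro ballI allI impI)
      fix \<mu> l assume \<mu>: "\<mu> \<in> spectrum (A n)" and l: "l < eigenvalue_order (A n) \<mu>"
      have \<mu>1: "norm \<mu> < 1" using spec[of n] \<mu> by auto
      obtain s where s: "norm \<mu> < s" "s < 1" using \<mu>1 dense by blast
      have "uniform_limit (ball 0 s) (G \<circ> r) \<psi> sequentially"
        by (rule uniform_limit_on_subset[OF ulim[of "cball 0 s"]]) (use s in auto)
      hence "(\<lambda>j. (deriv ^^ l) ((G \<circ> r) j) \<mu>) \<longlonglongrightarrow> (deriv ^^ l) \<psi> \<mu>"
      proof (rule higher_deriv_complex_uniform_limit)
        have "(G \<circ> r) j holomorphic_on ball 0 s" for j
          using holomorphic_on_subset[OF G(1)[of "r j"], of "ball 0 s"] s subset_ball[of s 1 "0 :: complex"] by simp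
        thus "\<forall>\<^sub>F j in sequentially. (G \<circ> r) j holomorphic_on ball 0 s" by simp
      qed (use s in auto)
      moreover have "(\<lambda>j. (deriv ^^ l) ((G \<circ> r) j) \<mu>) \<longlonglongrightarrow> (deriv ^^ l) (\<phi> n) \<mu>"
      proof (rule Lim_transform_eventually)
        have "(deriv ^^ l) (\<phi> n) holomorphic_on ball 0 1" using hol by (intro holomorphic_higher_deriv) auto
        hence "isCont ((deriv ^^ l) (\<phi> n)) \<mu>"
          using \<mu>1 by (intro continuous_on_interior[of "ball 0 1"] holomorphic_on_imp_continuous_on) auto
        moreover have \<rho>r: "(\<lambda>j. complex_of_real (\<rho> (r j))) \<longlonglongrightarrow> 1"
          using tendsto_of_real[OF LIMSEQ_subseq_LIMSEQ[OF \<rho>_lim r]] by (simp add: o_def)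
        moreover have "(\<lambda>j. of_real (\<rho> (r j)) * \<mu>) \<longlonglongrightarrow> 1 * \<mu>"
          by (intro tendsto_mult \<rho>r tendsto_const)
        ultimately have "(\<lambda>j. of_real (\<rho> (r j)) ^ l * (deriv ^^ l) (\<phi> n) (of_real (\<rho> (r j)) * \<mu>)) \<longlonglongrightarrow> 1 ^ l * (deriv ^^ l) (\<phi> n) \<mu>"
          by (intro tendsto_mult tendsto_power) (auto intro: isCont_tendsto_compose)
        thus "(\<lambda>j. of_real (\<rho> (r j)) ^ l * (deriv ^^ l) (\<phi> n) (of_real (\<rho> (r j)) * \<mu>)) \<longlonglongrightarrow> (deriv ^^ l) (\<phi> n) \<mu>"
          by simp
        \<comment> \<open>The power of \<open>\<rho> N\<close> comes from the chain rule for the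
          dilation. Interpolation is known for \<open>n < N\<close>, hence eventually along the
          subsequence.\<close>
        have "of_real (\<rho> N) ^ l * (deriv ^^ l) (\<phi> n) (of_real (\<rho> N) * \<mu>) = (deriv ^^ l) (G N) \<mu>" if N: "n < N" for N
        proof -
          have hol': "(\<lambda>z. \<phi> n (of_real (\<rho> N) * z)) holomorphic_on ball 0 1"
            using \<rho>_ball by (intro holomorphic_intros holomorphic_on_compose_gen[OF _ hol, unfolded o_def]) auto
          have "(deriv ^^ l) (G N) \<mu> = (deriv ^^ l) (\<lambda>z. \<phi> n (of_real (\<rho> N) * z)) \<mu>"
            using G(3)[OF N] \<mu> l unfolding mat_fun_eq_iff[OF car spec G(1) hol'] by blast
          also have "\<dots> = of_real (\<rho> N) ^ l * (deriv ^^ l) (\<phi> n) (of_real (\<rho> N) * \<mu>)"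
            using \<rho>_ball \<mu>1 by (intro higher_deriv_compose_linear[OF hol, of "ball 0 1"]) auto
          finally show ?thesis by simp
        qed
        moreover have "eventually (\<lambda>j. n < r j) sequentially"
          using filterlim_subseq[OF r] eventually_gt_at_top[of n] by (simp add: filterlim_iff)
        ultimately show "\<forall>\<^sub>F j in sequentially. of_real (\<rho> (r j)) ^ l * (deriv ^^ l) (\<phi> n) (of_real (\<rho> (r j)) * \<mu>) = (deriv ^^ l) ((G \<circ> r) j) \<mu>"
          by (auto elim!: eventually_mono)
      qed
      ultimately show "(deriv ^^ l) \<psi> \<mu> = (deriv ^^ l) (\<phi> n) \<mu>" by (rule LIMSEQ_unique)
    qed
  qed
  thus "\<exists>\<psi>\<in>Hinf. \<forall>n. mat_fun \<psi> (A n) = mat_fun (\<phi> n) (A n)" using \<psi>_Hinf by blast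
qed

end

theorem theorem1p3:
  fixes A :: "nat \<Rightarrow> complex mat"
  assumes "\<And>n. square_mat (A n)" and "\<And>n. 0 < dim_row (A n)"
    and "\<And>n. spectrum (A n) \<subseteq> ball 0 1"
  shows "interpolating_Hinf A \<longleftrightarrow> strongly_separated A"
proof -
  obtain Z where Z: "\<And>n. set (Z n) \<subseteq> ball 0 1" "\<And>n z. bprod (Z n) z = blaschke_mat (A n) z"
    "\<And>n f g. f holomorphic_on ball 0 1 \<Longrightarrow> g holomorphic_on ball 0 1 \<Longrightarrow>
       mat_fun f (A n) = mat_fun g (A n) \<longleftrightarrow>
         (\<exists>q. q holomorphic_on ball 0 1 \<and> (\<forall>z\<in>ball 0 1. f z = g z + bprod (Z n) z * q z))"
    using blaschke_mat_bprod[OF assms(1,3)] by metis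
  show ?thesis
  proof
    assume "interpolating_Hinf A"
    thus "strongly_separated A"
      by (rule interpolating_imp_strongly_separated[where A = A and Z = Z, rotated -1])
         (assumption | rule assms Z)+
  next
    assume "strongly_separated A"
    thus "interpolating_Hinf A"
      by (rule strongly_separated_imp_interpolating[where A = A and Z = Z, rotated -1])
         (assumption | rule assms Z)+
  qed
qed

end
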